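(* Let $f$ be a weak G-type potential and let $K_f^{\mathrm p}$ be its periodic kernel associated with the lattice $\mathcal V$. Then: (a) $K_f^{\mathrm p}$ is well defined and continuous as a function from $\mathbb R^d\times\mathbb R^d$ to $\mathbb R\cup\{\infty\}$. Furthermore, $K_f^{\mathrm p}(x,y)$ is finite for any $x,y\in\mathbb R^d$ such that $x-y\notin\mathcal V$. (b) $K_f^{\mathrm p}(x,y)$ is symmetric in $(x,y)$, is periodic in each of the variables $x$ and $y$ with respect to the lattice $\mathcal V$, and depends only on $x-y$. (c) If $f$ is a G-type potential and the sum defining the classical periodic energy $$E_f^{\mathrm{cp}}(\omega_N)=\sum_{i\neq j}\Big(\sum_{v\in\mathcal V}f(x_i-x_j+v)\Big),\qquad \omega_N=(x_j)_{j=1}^N,$$ converges absolutely, then $E_f^{\mathrm{cp}}(\omega_N)$ and $E_f^{\mathrm p}(\omega_N)$ differ by a constant multiple of $N(N-1)$, where the constant does not depend on the configuration $\omega_N$.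
   Context: Let $V$ be a real $d\times d$ matrix with linearly independent columns $v_1,\dots,v_d$ and $\det V=1$; let $\mathcal V=\{Vk:k\in\mathbb Z^d\}$ and let $\mathcal V^*=\{w\in\mathbb R^d: w\cdot v\in\mathbb Z\ \forall v\in\mathcal V\}$ be the dual lattice. Signed measures are Borel, $\mu^{\pm}$ denote the positive and negative parts of $\mu$, and $\int_a^b h\,d\mu$ means integration over the half-open interval $[a,b)$ (over $(0,b)$ if $a=0$ and $\mu$ is a measure on $(0,\infty)$). G-type potential: a lower-semicontinuous $f:\mathbb R^d\to\mathbb R\cup\{\infty\}$ such that for every $q\ne0$, $f(q)$ is finite and $f(q)=\int_0^\infty e^{-|q|^2t}\,d\mu_f(t)$ for some signed measure $\mu_f$ on $(0,\infty)$ with finite negative part, and $f(0)=\mu_f((0,\infty))\in\mathbb R\cup\{\infty\}$. Weak G-type potential: a lower-semicontinuous $f:\mathbb R^d\to\mathbb R\cup\{\infty\}$ for which there are a function $f^*:(0,1)\to\mathbb R$ and a signed measure $\mu_f$ on $(0,\infty)$ with finite negative part such that (W1) for every $q\neq0$, $f(q)$ is finite and $f(q)=\lim_{\alpha\to0^+}\big(\int_\alpha^\infty e^{-|q|^2t}\,d\mu_f(t)+f^*(\alpha)\big)$, where $\int_\alpha^\infty e^{-|q|^2t}\,d\mu_f(t)<\infty$ for all $\alpha>0$; and (W2) if $w_0$ is an element of $\mathcal V^*\setminus\{0\}$ of minimal length, then $\int_0^1 t^{-d/2}e^{-\pi^2|w_0|^2/t}\,d\mu_f(t)<\infty$. Every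 G-type potential is a weak G-type potential with the same $\mu_f$. For a weak G-type potential $f$ define $$K_f^{\mathrm p}(x,y)=\sum_{v\in\mathcal V}\int_1^\infty e^{-|x-y+v|^2t}\,d\mu_f(t)+\sum_{w\in\mathcal V^*\setminus\{0\}}e^{2\pi i w\cdot(x-y)}\int_0^1\frac{\pi^{d/2}}{t^{d/2}}e^{-\pi^2|w|^2/t}\,d\mu_f(t),$$ and for $\omega_N=(x_j)_{j=1}^N\in(\mathbb R^d)^N$, $E_f^{\mathrm p}(\omega_N)=\sum_{1\le j,k\le N,\,j\ne k}K_f^{\mathrm p}(x_j,x_k)$. *)

theory Defs
  imports "HOL-Analysis.Analysis"
begin

subsection \<open>Lattices\<close>

definition lattice :: "real^'n^'n \<Rightarrow> (real^'n) set" where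
  "lattice V = {V *v k | k. \<forall>i. k $ i \<in> \<int>}"

definition dual_lattice :: "real^'n^'n \<Rightarrow> (real^'n) set" where
  "dual_lattice V = {w. \<forall>v\<in>lattice V. w \<bullet> v \<in> \<int>}"

subsection \<open>Signed Borel measures on the open half-line\<close>

definition halfline :: "real measure" where
  "halfline = restrict_space borel {0<..}"

text \<open>
  A signed measure is a countably additive extended-real set function that takes at most one of the
  two infinite values. Its values off the Borel subsets of the half-line are irrelevant.
\<close>
definition signed_measure :: "(real set \<Rightarrow> ereal) \<Rightarrow> bool" where
  "signed_measure \<mu> \<longleftrightarrow>
     \<mu> {} = 0 \<and>
     ((\<forall>A\<in>sets halfline. \<mu> A \<noteq> -\<infinity>) \<or> (\<forall>A\<in>sets halfline. \<mu> A \<noteq> \<infinity>)) \<and>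
     (\<forall>A. range A \<subseteq> sets halfline \<longrightarrow> disjoint_family A \<longrightarrow>
        (\<lambda>i::nat. \<mu> (A i)) sums \<mu> (\<Union>i. A i))"

text \<open>
  The positive and negative parts are the upper and lower variations of the signed measure.
  The coercion \<^const>\<open>e2ennreal\<close> sends negative values to \<open>0\<close>, which does not affect the suprema,
  as the empty set is among the competitors.
\<close>
definition pos_part :: "(real set \<Rightarrow> ereal) \<Rightarrow> real measure" where
  "pos_part \<mu> = measure_of {0<..} (sets halfline)
     (\<lambda>A. SUP B\<in>{B \<in> sets halfline. B \<subseteq> A}. e2ennreal (\<mu> B))"

definition neg_part :: "(real set \<Rightarrow> ereal) \<Rightarrow> real measure" where
  "neg_part \<mu> = measure_of {0<..} (sets halfline)
     (\<lambda>A. SUP B\<in>{B \<in> sets halfline. B \<subseteq> A}. e2ennreal (- \<mu> B))"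

text \<open>
  Integrals of nonnegative functions. As \<open>\<infinity> - \<infinity> = \<infinity>\<close> in \<^typ>\<open>ereal\<close>, an undefined integral has
  the value \<open>\<infinity>\<close>; in particular \<open>signed_integral \<mu> A h < \<infinity>\<close> excludes this case.
\<close>
definition signed_integral_exists :: "(real set \<Rightarrow> ereal) \<Rightarrow> real set \<Rightarrow> (real \<Rightarrow> real) \<Rightarrow> bool" where
  "signed_integral_exists \<mu> A h \<longleftrightarrow>
     (\<integral>\<^sup>+t\<in>A. ennreal (h t) \<partial>pos_part \<mu>) < \<infinity> \<or> (\<integral>\<^sup>+t\<in>A. ennreal (h t) \<partial>neg_part \<mu>) < \<infinity>"

definition signed_integral :: "(real set \<Rightarrow> ereal) \<Rightarrow> real set \<Rightarrow> (real \<Rightarrow> real) \<Rightarrow> ereal" where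
  "signed_integral \<mu> A h =
     enn2ereal (\<integral>\<^sup>+t\<in>A. ennreal (h t) \<partial>pos_part \<mu>)
     - enn2ereal (\<integral>\<^sup>+t\<in>A. ennreal (h t) \<partial>neg_part \<mu>)"

subsection \<open>Potentials\<close>

definition lower_semicontinuous :: "('a::topological_space \<Rightarrow> ereal) \<Rightarrow> bool" where
  "lower_semicontinuous f \<longleftrightarrow> (\<forall>a. open {x. a < f x})"

text \<open>The predicates relate a potential \<open>f\<close> to a signed measure \<open>\<mu>\<close> representing it.\<close>

definition G_type_potential :: "(real^'n \<Rightarrow> ereal) \<Rightarrow> (real set \<Rightarrow> ereal) \<Rightarrow> bool" where
  "G_type_potential f \<mu> \<longleftrightarrow>
     lower_semicontinuous f \<and> (\<forall>q. f q \<noteq> -\<infinity>) \<and>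
     signed_measure \<mu> \<and> finite_measure (neg_part \<mu>) \<and>
     (\<forall>q. q \<noteq> 0 \<longrightarrow> \<bar>f q\<bar> \<noteq> \<infinity> \<and>
        f q = signed_integral \<mu> {0<..} (\<lambda>t. exp (- (norm q)\<^sup>2 * t))) \<and>
     f 0 = \<mu> {0<..}"

definition weak_G_type_potential ::
    "real^'n^'n \<Rightarrow> (real^'n \<Rightarrow> ereal) \<Rightarrow> (real set \<Rightarrow> ereal) \<Rightarrow> bool" where
  "weak_G_type_potential V f \<mu> \<longleftrightarrow>
     lower_semicontinuous f \<and> (\<forall>q. f q \<noteq> -\<infinity>) \<and>
     signed_measure \<mu> \<and> finite_measure (neg_part \<mu>) \<and>
     (\<exists>fstar :: real \<Rightarrow> real. \<forall>q. q \<noteq> 0 \<longrightarrow>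
        \<bar>f q\<bar> \<noteq> \<infinity> \<and>
        (\<forall>\<alpha>>0. signed_integral \<mu> {\<alpha>..} (\<lambda>t. exp (- (norm q)\<^sup>2 * t)) < \<infinity>) \<and>
        ((\<lambda>\<alpha>. signed_integral \<mu> {\<alpha>..} (\<lambda>t. exp (- (norm q)\<^sup>2 * t)) + ereal (fstar \<alpha>))
           \<longlongrightarrow> f q) (at_right 0)) \<and>
     (\<forall>w0 \<in> dual_lattice V - {0}.
        (\<forall>w \<in> dual_lattice V - {0}. norm w0 \<le> norm w) \<longrightarrow>
        signed_integral \<mu> {0<..<1}
          (\<lambda>t. t powr (- real CARD('n) / 2) * exp (- pi\<^sup>2 * (norm w0)\<^sup>2 / t)) < \<infinity>)"

subsection \<open>The periodic kernel and energies\<close>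

definition near_term :: "(real set \<Rightarrow> ereal) \<Rightarrow> real^'n \<Rightarrow> ereal" where
  "near_term \<mu> z = signed_integral \<mu> {1..} (\<lambda>t. exp (- (norm z)\<^sup>2 * t))"

definition far_integrand :: "real^'n \<Rightarrow> real \<Rightarrow> real" where
  "far_integrand w t =
     pi powr (real CARD('n) / 2) / t powr (real CARD('n) / 2) * exp (- pi\<^sup>2 * (norm w)\<^sup>2 / t)"

definition far_coeff :: "(real set \<Rightarrow> ereal) \<Rightarrow> real^'n \<Rightarrow> ereal" where
  "far_coeff \<mu> w = signed_integral \<mu> {0<..<1} (far_integrand w)"

definition far_term :: "(real set \<Rightarrow> ereal) \<Rightarrow> real^'n \<Rightarrow> real^'n \<Rightarrow> complex" where
  "far_term \<mu> z w =
     exp (2 * complex_of_real pi * \<i> * complex_of_real (w \<bullet> z))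
     * complex_of_real (real_of_ereal (far_coeff \<mu> w))"

text \<open>
  The second sum has complex terms; its value is real because \<open>w\<close> and \<open>-w\<close> contribute conjugate
  terms. That it is real, and that the sums and integrals used in \<open>periodic_kernel\<close> do not take
  their default values, is expressed by \<open>periodic_kernel_well_defined\<close>.
\<close>
definition periodic_kernel ::
    "real^'n^'n \<Rightarrow> (real set \<Rightarrow> ereal) \<Rightarrow> real^'n \<Rightarrow> real^'n \<Rightarrow> ereal" where
  "periodic_kernel V \<mu> x y =
     (\<Sum>\<^sub>\<infinity>v\<in>lattice V. near_term \<mu> (x - y + v))
     + ereal (Re (\<Sum>\<^sub>\<infinity>w\<in>dual_lattice V - {0}. far_term \<mu> (x - y) w))"

definition periodic_kernel_well_defined ::
    "real^'n^'n \<Rightarrow> (real set \<Rightarrow> ereal) \<Rightarrow> real^'n \<Rightarrow> real^'n \<Rightarrow> bool" where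
  "periodic_kernel_well_defined V \<mu> x y \<longleftrightarrow>
     (\<forall>v \<in> lattice V.
        signed_integral_exists \<mu> {1..} (\<lambda>t. exp (- (norm (x - y + v))\<^sup>2 * t)) \<and>
        near_term \<mu> (x - y + v) \<noteq> -\<infinity>) \<and>
     (\<lambda>v. near_term \<mu> (x - y + v)) summable_on lattice V \<and>
     (\<forall>w \<in> dual_lattice V - {0}.
        signed_integral_exists \<mu> {0<..<1} (far_integrand w) \<and> \<bar>far_coeff \<mu> w\<bar> \<noteq> \<infinity>) \<and>
     far_term \<mu> (x - y) summable_on (dual_lattice V - {0}) \<and>
     (\<Sum>\<^sub>\<infinity>w\<in>dual_lattice V - {0}. far_term \<mu> (x - y) w) \<in> \<real> \<and>
     periodic_kernel V \<mu> x y \<noteq> -\<infinity>"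

text \<open>A configuration of \<open>N\<close> points is given by the values of \<open>x\<close> on \<open>{1..N}\<close>.\<close>

definition periodic_energy ::
    "real^'n^'n \<Rightarrow> (real set \<Rightarrow> ereal) \<Rightarrow> nat \<Rightarrow> (nat \<Rightarrow> real^'n) \<Rightarrow> ereal" where
  "periodic_energy V \<mu> N x =
     (\<Sum>j\<in>{1..N}. \<Sum>k\<in>{1..N} - {j}. periodic_kernel V \<mu> (x j) (x k))"

definition classical_periodic_energy ::
    "real^'n^'n \<Rightarrow> (real^'n \<Rightarrow> ereal) \<Rightarrow> nat \<Rightarrow> (nat \<Rightarrow> real^'n) \<Rightarrow> ereal" where
  "classical_periodic_energy V f N x =
     (\<Sum>i\<in>{1..N}. \<Sum>j\<in>{1..N} - {i}. \<Sum>\<^sub>\<infinity>v\<in>lattice V. f (x i - x j + v))"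

definition classical_energy_abs_convergent ::
    "real^'n^'n \<Rightarrow> (real^'n \<Rightarrow> ereal) \<Rightarrow> nat \<Rightarrow> (nat \<Rightarrow> real^'n) \<Rightarrow> bool" where
  "classical_energy_abs_convergent V f N x \<longleftrightarrow>
     (\<Sum>i\<in>{1..N}. \<Sum>j\<in>{1..N} - {i}. \<Sum>\<^sub>\<infinity>v\<in>lattice V. \<bar>f (x i - x j + v)\<bar>) < \<infinity>"

end

theory Submission
  imports Defs "HOL-Probability.Probability"
begin

text \<open>
  The near part converges because, apart from finitely many lattice translates, its terms are
  dominated by \<open>exp (- |z + v|\<^sup>2 / 2)\<close>; the far part because for \<open>t < 1\<close> the integrand at \<open>w\<close> is
  at most \<open>exp (- pi\<^sup>2 (|w|\<^sup>2 - |w0|\<^sup>2))\<close> times the integrand at a shortest dual vector \<open>w0\<close>. Both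
  bounds are locally uniform in \<open>z = x - y\<close>, which gives continuity, with the value \<open>\<infinity>\<close> coming only
  from a finite sum.

  For the comparison of the energies one splits \<open>f\<close> at \<open>t = 1\<close> and has to evaluate
  \<open>\<Sum>v. \<integral>t\<in>(0,1). exp (- |z + v|\<^sup>2 t) d\<mu>\<close>. Absolute convergence of this sum does not allow
  exchanging it with the signed integral, so it is first Abel-regularised by \<open>exp (- e |z + v|\<^sup>2)\<close>.
  Then Fubini and Poisson summation for Gaussians turn it into a dual sum whose term at \<open>w = 0\<close>
  does not depend on \<open>z\<close>, and whose remaining terms tend to the far part as \<open>e \<rightarrow> 0\<close>.

  Poisson summation itself is Fourier uniqueness on the torus, obtained from the
  Stone-Weierstrass theorem: both sides are continuous, periodic and have the same coefficients.
\<close>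

text \<open>The obstacle in (c) is cancellation: the sum of the absolute values of the signed
  integrals may converge while the same sum against the total variation of \<mu> diverges. The
  factor \<open>exp (- e |q|^2)\<close> is chosen because it merely replaces \<open>t\<close> by
  \<open>t + e\<close> in the Gaussian: for fixed \<open>e\<close> everything is dominated on (0,1),
  where a G-type potential gives \<mu> finite mass, and Poisson summation applies at
  \<open>t + e\<close>. The dual terms with \<open>w\<close> nonzero are bounded uniformly in
  \<open>e\<close>, but the term at 0 contains \<open>(t + e) powr (- d / 2)\<close> and has no
  limit a priori. Its convergence is read off from the convergence of all the rest, and the limit is
  the constant in (c). The value \<infinity> shapes the remaining arguments. Addition of extended
  reals is discontinuous at opposite infinities, so a lattice sum is split into finitely many
  extended real terms, containing every possibly infinite one, and a real remainder.\<close>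

section \<open>Lebesgue measure under linear maps and Gaussian integrals\<close>

text \<open>Singling out one coordinate turns a shear in that direction into a translation of the
  inner one-dimensional integral.\<close>

lemma nn_integral_lborel_cart_insert:
  fixes m :: "'n::finite" and f :: "real^'n \<Rightarrow> ennreal"
  assumes [measurable]: "f \<in> borel_measurable borel"
  shows "(\<integral>\<^sup>+x. f x \<partial>lborel) =
    (\<integral>\<^sup>+g. (\<integral>\<^sup>+y. f (\<Sum>b\<in>Basis. (g(axis m 1 := y)) b *\<^sub>R b) \<partial>lborel)
        \<partial>(\<Pi>\<^sub>M b\<in>(Basis :: (real^'n) set) - {axis m 1}. lborel))"
proof -
  interpret product_sigma_finite "\<lambda>b::real^'n. lborel :: real measure" ..
  let ?B = "Basis :: (real^'n) set"
  have B: "?B = insert (axis m 1) (?B - {axis m 1})"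
    by auto
  have "(\<integral>\<^sup>+x. f x \<partial>lborel) = (\<integral>\<^sup>+g. f (\<Sum>b\<in>?B. g b *\<^sub>R b) \<partial>(\<Pi>\<^sub>M b\<in>?B. lborel))"
    by (subst lborel_eq) (simp add: nn_integral_distr)
  also have "\<dots> = (\<integral>\<^sup>+g. f (\<Sum>b\<in>?B. g b *\<^sub>R b) \<partial>(\<Pi>\<^sub>M b\<in>insert (axis m 1) (?B - {axis m 1}). lborel))"
    using B by simp
  also have "\<dots> = (\<integral>\<^sup>+g. (\<integral>\<^sup>+y. f (\<Sum>b\<in>Basis. (g(axis m 1 := y)) b *\<^sub>R b) \<partial>lborel)
        \<partial>(\<Pi>\<^sub>M b\<in>?B - {axis m 1}. lborel))"
  proof (rule product_nn_integral_insert)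
    show "(\<lambda>g. f (\<Sum>b\<in>?B. g b *\<^sub>R b)) \<in> borel_measurable (\<Pi>\<^sub>M b\<in>insert (axis m 1) (?B - {axis m 1}). lborel)"
      unfolding B[symmetric] by measurable
  qed auto
  finally show ?thesis .
qed

lemma sum_Basis_cart: "(\<Sum>b\<in>Basis. g b *\<^sub>R b) $ i = g (axis i (1::real))"
  for g :: "real^'n \<Rightarrow> real"
proof -
  have inj: "inj (\<lambda>i::'n. axis i (1::real))" by (auto simp: inj_def axis_eq_axis)
  have B: "(Basis :: (real^'n) set) = range (\<lambda>i. axis i 1)"
    by (auto simp: Basis_vec_def)
  show ?thesis
    unfolding B by (subst sum.reindex[OF inj]) (simp add: axis_def if_distrib cong: if_cong)
qed

lemma nn_integral_lborel_shear:
  fixes f :: "real^'n \<Rightarrow> ennreal"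
  assumes [measurable]: "f \<in> borel_measurable borel" and mn: "m \<noteq> n"
  shows "(\<integral>\<^sup>+x. f ((\<chi> i j. if i = m \<and> j = n then c else of_bool (i = j)) *v x) \<partial>lborel)
       = (\<integral>\<^sup>+x. f x \<partial>lborel)"
proof -
  let ?A = "(\<chi> i j. if i = m \<and> j = n then c else of_bool (i = j)) :: real^'n^'n"
  let ?S = "\<lambda>g::real^'n \<Rightarrow> real. \<Sum>b\<in>Basis. g b *\<^sub>R b"
  have [measurable]: "(*v) ?A \<in> borel_measurable borel"
    by (intro borel_measurable_continuous_onI matrix_vector_mult_linear_continuous_on)
  have A: "(?A *v x) $ i = x $ i + (if i = m then c * x $ n else 0)" for x i
  proof -
    have "(?A *v x) $ i = (\<Sum>j\<in>UNIV. (if j = i then x $ j else 0) + (if j = n then (if i = m then c * x $ j else 0) else 0))"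
      unfolding matrix_vector_mult_def using mn by (auto intro!: sum.cong)
    then show ?thesis by (simp add: sum.distrib)
  qed
  have key: "?A *v ?S (g(axis m 1 := y)) = ?S (g(axis m 1 := c * g (axis n 1) + y))" for g y
    unfolding vec_eq_iff A sum_Basis_cart using mn by (auto simp: axis_eq_axis)
  have "(\<integral>\<^sup>+y. f (?S (g(axis m 1 := c * g (axis n 1) + y))) \<partial>lborel)
      = (\<integral>\<^sup>+y. f (?S (g(axis m 1 := y))) \<partial>lborel)" for g
    by (subst (2) nn_integral_real_affine[where c = 1 and t = "c * g (axis n 1)"]) (auto simp: fun_upd_def)
  then show ?thesis
    by (subst (1 2) nn_integral_lborel_cart_insert[of _ m]) (measurable, simp only: key)
qed

lemma nn_integral_lborel_swap:
  fixes f :: "real^'n \<Rightarrow> ennreal"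
  assumes [measurable]: "f \<in> borel_measurable borel" 
  shows "(\<integral>\<^sup>+x. f ((\<chi> i j. mat 1 $ i $ Transposition.transpose m n j) *v x) \<partial>lborel)
       = (\<integral>\<^sup>+x. f x \<partial>lborel)"
proof -
  let ?A = "(\<chi> i j. mat 1 $ i $ Transposition.transpose m n j) :: real^'n^'n"
  let ?t = "Transposition.transpose m n"
  have [measurable]: "(*v) ?A \<in> borel_measurable borel"
    by (intro borel_measurable_continuous_onI matrix_vector_mult_linear_continuous_on)
  have A: "(?A *v x) $ i = x $ ?t i" for x i
  proof -
    have "i = ?t j \<longleftrightarrow> j = ?t i" for j by (metis transpose_involutory)
    then show ?thesis by (simp add: matrix_vector_mult_def mat_def if_distrib[of "\<lambda>a. a * _"] cong: if_cong)
  qed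
  \<comment> \<open>Lebesgue measure is determined by its values on boxes, and a swap of coordinates
    only permutes the side lengths of a box.\<close>
  have L: "(lborel :: (real^'n) measure) = distr lborel borel ((*v) ?A)"
  proof (rule lborel_eqI)
    fix l u :: "real^'n" assume lu: "\<And>b. b \<in> Basis \<Longrightarrow> l \<bullet> b \<le> u \<bullet> b"
    have le: "l $ i \<le> u $ i" for i using lu[of "axis i 1"] by (simp add: inner_axis)
    \<comment> \<open>The swap is an involution, so the preimage of the box is also its
      image.\<close>
    have "(*v) ?A -` box l u = box (?A *v l) (?A *v u)"
    proof safe
      fix x assume "?A *v x \<in> box l u"
      then have h: "l $ i < x $ ?t i \<and> x $ ?t i < u $ i" for i by (auto simp: mem_box_cart A)
      show "x \<in> box (?A *v l) (?A *v u)" unfolding mem_box_cart A using h[of "?t _"] by simp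
    qed (auto simp: mem_box_cart A, (metis transpose_involutory)+)
    then have "emeasure (distr lborel borel ((*v) ?A)) (box l u) = emeasure lborel (box (?A *v l) (?A *v u))"
      by (simp add: emeasure_distr)
    also have "\<dots> = ennreal (\<Prod>b\<in>Basis. (?A *v u - ?A *v l) \<bullet> b)"
    proof (rule emeasure_lborel_box)
      fix b :: "real^'n" assume "b \<in> Basis"
      then obtain i where "b = axis i 1" by (auto simp: Basis_vec_def)
      then show "(?A *v l) \<bullet> b \<le> (?A *v u) \<bullet> b" using le by (simp add: inner_axis A)
    qed
    also have "(\<Prod>b\<in>Basis. (?A *v u - ?A *v l) \<bullet> b) = (\<Prod>i\<in>UNIV. (u - l) $ ?t i)"
    proof -
      have inj: "inj (\<lambda>i::'n. axis i (1::real))" by (auto simp: inj_def axis_eq_axis)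
      have B: "(Basis :: (real^'n) set) = range (\<lambda>i. axis i 1)" by (auto simp: Basis_vec_def)
      show ?thesis unfolding B by (subst prod.reindex[OF inj]) (simp add: inner_axis A)
    qed
    also have "\<dots> = (\<Prod>i\<in>UNIV. (u - l) $ i)"
      using prod.permute[OF permutes_swap_id, where S=UNIV and g="\<lambda>i. (u - l)$i"] by (simp add: o_def)
    also have "\<dots> = (\<Prod>b\<in>Basis. (u - l) \<bullet> b)"
    proof -
      have inj: "inj (\<lambda>i::'n. axis i (1::real))" by (auto simp: inj_def axis_eq_axis)
      have B: "(Basis :: (real^'n) set) = range (\<lambda>i. axis i 1)" by (auto simp: Basis_vec_def)
      show ?thesis unfolding B by (subst prod.reindex[OF inj]) (simp add: inner_axis)
    qed
    finally show "emeasure (distr lborel borel ((*v) ?A)) (box l u) = ennreal (\<Prod>b\<in>Basis. (u - l) \<bullet> b)" .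
  qed simp
  show ?thesis
    by (subst (2) L) (simp add: nn_integral_distr)
qed

lemma nn_integral_lborel_diagonal:
  fixes f :: "real^'n \<Rightarrow> ennreal" and A :: "real^'n^'n"
  assumes [measurable]: "f \<in> borel_measurable borel" and diag: "\<And>i j. i \<noteq> j \<Longrightarrow> A $ i $ j = 0"
    and det: "det A \<noteq> 0"
  shows "(\<integral>\<^sup>+x. f x \<partial>lborel) = ennreal \<bar>det A\<bar> * (\<integral>\<^sup>+x. f (A *v x) \<partial>lborel)"
proof -
  have dA: "det A = (\<Prod>i\<in>UNIV. A $ i $ i)" by (rule det_diagonal[OF diag])
  \<comment> \<open>Affine scaling of \<open>lborel\<close> takes its factors indexed by basis
    vectors; at \<open>axis i 1\<close> this function returns the diagonal entry of row
    \<open>i\<close>.\<close>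
  define c where "c b = (\<Sum>i\<in>UNIV. A $ i $ i * b $ i)" for b :: "real^'n"
  have c: "c (axis i 1) = A $ i $ i" for i
    unfolding c_def by (simp add: axis_def if_distrib cong: if_cong)
  have inj: "inj (\<lambda>i::'n. axis i (1::real))" by (auto simp: inj_def axis_eq_axis)
  have B: "(Basis :: (real^'n) set) = range (\<lambda>i. axis i 1)" by (auto simp: Basis_vec_def)
  have 1: "0 + (\<Sum>j\<in>Basis. (c j * (x \<bullet> j)) *\<^sub>R j) = A *v x" for x
  proof -
    have "(A *v x) $ i = A $ i $ i * x $ i" for i
    proof -
      have "(A *v x) $ i = (\<Sum>j\<in>UNIV. A $ i $ j * x $ j)"
        by (simp add: matrix_vector_mult_def)
      also have "\<dots> = (\<Sum>j\<in>UNIV. if j = i then A $ i $ i * x $ i else 0)"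
        by (rule sum.cong) (auto simp: diag)
      finally show ?thesis by simp
    qed
    then show ?thesis unfolding add_0 vec_eq_iff sum_Basis_cart by (simp add: c inner_axis)
  qed
  have 2: "(\<Prod>j\<in>Basis. \<bar>c j\<bar>) = \<bar>det A\<bar>"
    unfolding B by (subst prod.reindex[OF inj]) (simp add: c dA abs_prod)
  have nz: "c j \<noteq> 0" if "j \<in> Basis" for j
    using that det unfolding B dA by (auto simp: c)
  have [measurable]: "(*v) A \<in> borel_measurable borel"
    by (intro borel_measurable_continuous_onI matrix_vector_mult_linear_continuous_on)
  have "lborel = density (distr lborel borel (\<lambda>x. 0 + (\<Sum>j\<in>Basis. (c j * (x \<bullet> j)) *\<^sub>R j))) (\<lambda>_. (\<Prod>j\<in>Basis. \<bar>c j\<bar>))"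
    by (rule lborel_affine_euclidean[OF nz])
  then have L: "lborel = density (distr lborel borel ((*v) A)) (\<lambda>_. \<bar>det A\<bar>)"
    unfolding 1 2 .
  show ?thesis
    by (subst L) (simp add: nn_integral_density nn_integral_distr nn_integral_cmult)
qed

text \<open>
  The library's linear change of variables requires a well-ordered index type; the elementary
  matrices do not.
\<close>
lemma nn_integral_lborel_matrix:
  fixes f :: "real^'n \<Rightarrow> ennreal" and A :: "real^'n^'n"
  assumes "f \<in> borel_measurable borel" and "det A \<noteq> 0"
  shows "(\<integral>\<^sup>+x. f x \<partial>lborel) = ennreal \<bar>det A\<bar> * (\<integral>\<^sup>+x. f (A *v x) \<partial>lborel)"
proof -
  define P where "P A \<longleftrightarrow> (det A \<noteq> 0 \<longrightarrow> (\<forall>f \<in> borel_measurable borel.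
    (\<integral>\<^sup>+x. f x \<partial>lborel) = ennreal \<bar>det A\<bar> * (\<integral>\<^sup>+x. f (A *v x) \<partial>lborel)))" for A :: "real^'n^'n"
  have "P A"
  proof (rule induct_matrix_elementary)
    fix A B assume A: "P A" and B: "P B"
    show "P (A ** B)" unfolding P_def
    proof (intro impI ballI)
      fix f :: "real^'n \<Rightarrow> ennreal" assume d: "det (A ** B) \<noteq> 0" and f [measurable]: "f \<in> borel_measurable borel"
      have dA: "det A \<noteq> 0" and dB: "det B \<noteq> 0" using d by (simp_all add: det_mul)
      have [measurable]: "(*v) A \<in> borel_measurable borel"
        by (intro borel_measurable_continuous_onI matrix_vector_mult_linear_continuous_on)
      have "(\<integral>\<^sup>+x. f x \<partial>lborel) = ennreal \<bar>det A\<bar> * (\<integral>\<^sup>+x. f (A *v x) \<partial>lborel)"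
        using A dA f unfolding P_def by blast
      also have "(\<integral>\<^sup>+x. f (A *v x) \<partial>lborel) = ennreal \<bar>det B\<bar> * (\<integral>\<^sup>+x. f (A *v (B *v x)) \<partial>lborel)"
      proof -
        have f': "(\<lambda>x. f (A *v x)) \<in> borel_measurable borel" by measurable
        from B dB have "\<forall>f \<in> borel_measurable borel.
            (\<integral>\<^sup>+x. f x \<partial>lborel) = ennreal \<bar>det B\<bar> * (\<integral>\<^sup>+x. f (B *v x) \<partial>lborel)"
          unfolding P_def by blast
        from bspec[OF this f'] show ?thesis .
      qed
      finally show "(\<integral>\<^sup>+x. f x \<partial>lborel) = ennreal \<bar>det (A ** B)\<bar> * (\<integral>\<^sup>+x. f ((A ** B) *v x) \<partial>lborel)"
        by (simp only: det_mul abs_mult ennreal_mult abs_ge_zero matrix_vector_mul_assoc mult.assoc)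
    qed
  next
    fix A :: "real^'n^'n" and i assume "row i A = 0"
    then have "det A = 0" by (intro det_zero_row(1)) 
    then show "P A" by (simp add: P_def)
  next
    fix A :: "real^'n^'n" assume "\<And>i j. i \<noteq> j \<Longrightarrow> A $ i $ j = 0"
    then show "P A" unfolding P_def by (auto intro: nn_integral_lborel_diagonal)
  next
    fix m n :: 'n assume "m \<noteq> n"
    have "\<bar>det (\<chi> i j. mat 1 $ i $ Transposition.transpose m n j :: real^'n^'n)\<bar> = 1"
      using \<open>m \<noteq> n\<close> by (simp add: det_permute_columns permutes_swap_id sign_swap_id abs_mult)
    then show "P (\<chi> i j. mat 1 $ i $ Transposition.transpose m n j)"
      unfolding P_def by (simp add: nn_integral_lborel_swap)
  next
    fix m n :: 'n and c assume mn: "m \<noteq> n"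
    let ?A = "(\<chi> i j. if i = m \<and> j = n then c else of_bool (i = j)) :: real^'n^'n"
    have "?A = (\<chi> k. if k = m then row m (mat 1) + c *s row n (mat 1) else row k (mat 1))"
      using mn by (auto simp: vec_eq_iff row_def mat_def)
    then have "det ?A = 1" using det_row_operation[OF mn, of "mat 1" c] by simp
    then show "P ?A" unfolding P_def using mn by (simp add: nn_integral_lborel_shear)
  qed
  then show ?thesis using assms unfolding P_def by blast
qed

section \<open>Fourier transform of the Gaussian\<close>

lemma has_bochner_integral_lborel_prod:
  fixes f :: "'a::euclidean_space \<Rightarrow> real \<Rightarrow> complex"
  assumes f: "\<And>b. b \<in> Basis \<Longrightarrow> has_bochner_integral lborel (f b) (c b)"
  shows "has_bochner_integral lborel (\<lambda>x. \<Prod>b\<in>Basis. f b (x \<bullet> b)) (\<Prod>b\<in>Basis. c b)"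
proof -
  interpret product_sigma_finite "\<lambda>b::'a. lborel :: real measure" ..
  have int: "integrable lborel (f b)" and eq: "integral\<^sup>L lborel (f b) = c b" if "b \<in> Basis" for b
    using f[OF that] by (auto simp: has_bochner_integral_iff)
  have [measurable]: "f b \<in> borel_measurable borel" if "b \<in> Basis" for b
    using int[OF that] by (auto dest: borel_measurable_integrable)
  have D: "has_bochner_integral (distr (\<Pi>\<^sub>M b\<in>Basis. lborel) borel (\<lambda>g. \<Sum>b\<in>Basis. g b *\<^sub>R b))
      (\<lambda>x::'a. \<Prod>b\<in>Basis. f b (x \<bullet> b)) (\<Prod>b\<in>Basis. c b)"
  proof (subst has_bochner_integral_distr)
    have "has_bochner_integral (\<Pi>\<^sub>M b\<in>(Basis::'a set). lborel) (\<lambda>g. \<Prod>b\<in>Basis. f b (g b)) (\<Prod>b\<in>Basis. c b)"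
      unfolding has_bochner_integral_iff
      using product_integrable_prod[of Basis f] product_integral_prod[of Basis f] int eq by simp
    then show "has_bochner_integral (\<Pi>\<^sub>M b\<in>(Basis::'a set). lborel)
        (\<lambda>g. \<Prod>b\<in>Basis. f b ((\<Sum>b\<in>Basis. g b *\<^sub>R b) \<bullet> b)) (\<Prod>b\<in>Basis. c b)"
      by (simp cong: prod.cong)
  qed measurable
  then show ?thesis by (subst lborel_eq)
qed

text \<open>This is the characteristic function of the standard normal distribution after the
  substitution \<open>x = c * y\<close>.\<close>

lemma has_bochner_integral_gaussian_iexp:
  fixes s t :: real
  assumes t: "t > 0"
  shows "has_bochner_integral lborel (\<lambda>x. complex_of_real (exp (- t * x\<^sup>2)) * iexp (s * x))
           (complex_of_real (sqrt (pi / t) * exp (- s\<^sup>2 / (4 * t))))"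
proof -
  \<comment> \<open>This scale turns \<open>exp (- x\<^sup>2 / 2)\<close> into
    \<open>exp (- t * x\<^sup>2)\<close>; the frequency must then be divided by it.\<close>
  define c where "c = sqrt (2 * t)"
  define u where "u = s / c"
  have c: "c > 0" "c\<^sup>2 = 2 * t" using t by (auto simp: c_def)
  interpret N: prob_space std_normal_distribution by (rule prob_space_normal_density) simp
  have "integrable std_normal_distribution (\<lambda>x. iexp (u * x))"
    by (rule N.integrable_const_bound[where B = 1]) auto
  then have "integrable lborel (\<lambda>x. std_normal_density x *\<^sub>R iexp (u * x))"
    by (subst (asm) integrable_density) auto
  moreover have "(CLBINT x. std_normal_density x *\<^sub>R iexp (u * x)) = complex_of_real (exp (- u\<^sup>2 / 2))"
    using fun_cong[OF char_std_normal_distribution, of u] unfolding char_def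
    by (subst (asm) integral_density) auto
  ultimately have "has_bochner_integral lborel (\<lambda>x. std_normal_density x *\<^sub>R iexp (u * x)) (complex_of_real (exp (- u\<^sup>2 / 2)))"
    by (simp add: has_bochner_integral_iff)
  then have "has_bochner_integral lborel (\<lambda>x. std_normal_density (0 + c * x) *\<^sub>R iexp (u * (0 + c * x)))
      (complex_of_real (exp (- u\<^sup>2 / 2)) /\<^sub>R \<bar>c\<bar>)"
    using c by (subst (asm) lborel_has_bochner_integral_real_affine_iff[where c = c and t = 0]) auto
  then have "has_bochner_integral lborel (\<lambda>x. complex_of_real (sqrt (2 * pi)) * (std_normal_density (0 + c * x) *\<^sub>R iexp (u * (0 + c * x))))
      (complex_of_real (sqrt (2 * pi)) * (complex_of_real (exp (- u\<^sup>2 / 2)) /\<^sub>R \<bar>c\<bar>))"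
    by (rule has_bochner_integral_mult_right)
  moreover have "complex_of_real (sqrt (2 * pi)) * (std_normal_density (0 + c * x) *\<^sub>R iexp (u * (0 + c * x)))
      = complex_of_real (exp (- t * x\<^sup>2)) * iexp (s * x)" for x
    using c by (simp add: normal_density_def scaleR_conv_of_real power_mult_distrib u_def mult.commute)
  moreover have "complex_of_real (sqrt (2 * pi)) * (complex_of_real (exp (- u\<^sup>2 / 2)) /\<^sub>R \<bar>c\<bar>)
      = complex_of_real (sqrt (pi / t) * exp (- s\<^sup>2 / (4 * t)))"
  proof -
    have "sqrt (2 * pi) / c = sqrt (pi / t)"
      unfolding c_def real_sqrt_divide[symmetric] by simp
    moreover have "- u\<^sup>2 / 2 = - s\<^sup>2 / (4 * t)"
      by (simp add: u_def power_divide c)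
    ultimately show ?thesis using c by (simp add: scaleR_conv_of_real field_simps flip: of_real_mult of_real_divide)
  qed
  ultimately show ?thesis by simp
qed

lemma prod_sqrt_Basis:
  assumes "t > 0"
  shows "(\<Prod>b\<in>(Basis :: (real^'n) set). sqrt (pi / t)) = pi powr (real CARD('n) / 2) / t powr (real CARD('n) / 2)"
proof -
  have "(\<Prod>b\<in>(Basis :: (real^'n) set). sqrt (pi / t)) = sqrt (pi / t) ^ CARD('n)"
    by simp
  also have "\<dots> = (pi / t) powr (1/2 * real CARD('n))"
    using assms by (simp add: powr_half_sqrt[symmetric] powr_realpow[symmetric] powr_powr)
  finally show ?thesis using assms by (simp add: powr_divide)
qed

text \<open>Gaussian and character both factor over the coordinates. Thus
  \<open>far_integrand w t\<close> is the Fourier transform of \<open>exp (- t |x|^2)\<close> at the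
  frequency \<open>w\<close>. Real and imaginary parts are separated because the Fourier analysis
  below is carried out with real functions.\<close>

lemma
  fixes w :: "real^'n"
  assumes t: "t > 0"
  shows has_bochner_integral_gaussian_cos:
      "has_bochner_integral lborel (\<lambda>x. exp (- t * (norm x)\<^sup>2) * cos (2 * pi * (w \<bullet> x))) (far_integrand w t)" (is ?C)
    and has_bochner_integral_gaussian_sin:
      "has_bochner_integral lborel (\<lambda>x. exp (- t * (norm x)\<^sup>2) * sin (2 * pi * (w \<bullet> x))) 0" (is ?S)
proof -
  have "has_bochner_integral lborel
      (\<lambda>x. \<Prod>b\<in>Basis. complex_of_real (exp (- t * (x \<bullet> b)\<^sup>2)) * iexp (2 * pi * (w \<bullet> b) * (x \<bullet> b)))
      (\<Prod>b\<in>Basis. complex_of_real (sqrt (pi / t) * exp (- (2 * pi * (w \<bullet> b))\<^sup>2 / (4 * t))))"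
    by (intro has_bochner_integral_lborel_prod has_bochner_integral_gaussian_iexp t)
  moreover have "(\<Prod>b\<in>Basis. complex_of_real (exp (- t * (x \<bullet> b)\<^sup>2)) * iexp (2 * pi * (w \<bullet> b) * (x \<bullet> b)))
      = complex_of_real (exp (- t * (norm x)\<^sup>2)) * iexp (2 * pi * (w \<bullet> x))" for x
  proof -
    have "(\<Prod>b\<in>Basis. exp (- t * (x \<bullet> b)\<^sup>2)) = exp (- t * (norm x)\<^sup>2)"
      by (simp add: exp_sum[symmetric] power2_norm_eq_inner euclidean_inner[of x x] sum_distrib_left sum_negf
          flip: power2_eq_square)
    then have "(\<Prod>b\<in>Basis. complex_of_real (exp (- t * (x \<bullet> b)\<^sup>2))) = complex_of_real (exp (- t * (norm x)\<^sup>2))"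
      by (simp only: of_real_prod[symmetric])
    moreover have "(\<Prod>b\<in>Basis. iexp (2 * pi * (w \<bullet> b) * (x \<bullet> b))) = exp (\<Sum>b\<in>Basis. \<i> * complex_of_real (2 * pi * (w \<bullet> b) * (x \<bullet> b)))"
      by (rule exp_sum[symmetric]) simp
    moreover have "(\<Sum>b\<in>Basis. \<i> * complex_of_real (2 * pi * (w \<bullet> b) * (x \<bullet> b))) = \<i> * complex_of_real (2 * pi * (w \<bullet> x))"
      by (simp add: euclidean_inner[of w x] sum_distrib_left mult.assoc)
    ultimately show ?thesis unfolding prod.distrib by simp
  qed
  moreover have "(\<Prod>b\<in>Basis. complex_of_real (sqrt (pi / t) * exp (- (2 * pi * (w \<bullet> b))\<^sup>2 / (4 * t))))
      = complex_of_real (far_integrand w t)"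
  proof -
    have "(\<Prod>b\<in>Basis. exp (- (2 * pi * (w \<bullet> b))\<^sup>2 / (4 * t))) = exp (- pi\<^sup>2 * (norm w)\<^sup>2 / t)"
      by (simp add: exp_sum[symmetric] power2_norm_eq_inner euclidean_inner[of w w] sum_distrib_left
          sum_divide_distrib sum_negf power_mult_distrib flip: power2_eq_square)
    then have "(\<Prod>b\<in>Basis. sqrt (pi / t) * exp (- (2 * pi * (w \<bullet> b))\<^sup>2 / (4 * t))) = far_integrand w t"
      unfolding prod.distrib prod_sqrt_Basis[OF t] by (simp add: far_integrand_def)
    then show ?thesis by (simp only: of_real_prod[symmetric])
  qed
  ultimately have *: "has_bochner_integral lborel (\<lambda>x. complex_of_real (exp (- t * (norm x)\<^sup>2)) * iexp (2 * pi * (w \<bullet> x)))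
      (complex_of_real (far_integrand w t))" by simp
  show ?C using has_bochner_integral_bounded_linear[OF bounded_linear_Re *] by (simp add: Re_exp)
  show ?S using has_bochner_integral_bounded_linear[OF bounded_linear_Im *] by (simp add: Im_exp)
qed

section \<open>Exchanging unordered sums with integrals and limits\<close>

lemma has_sum_integral:
  fixes f :: "'i \<Rightarrow> 'a \<Rightarrow> real"
  assumes A: "countable A" and int: "\<And>i. i \<in> A \<Longrightarrow> integrable M (f i)"
    and sum: "(\<lambda>i. \<integral>x. \<bar>f i x\<bar> \<partial>M) summable_on A"
    and pt: "\<And>x. x \<in> space M \<Longrightarrow> (\<lambda>i. \<bar>f i x\<bar>) summable_on A"
  shows "((\<lambda>i. \<integral>x. f i x \<partial>M) has_sum (\<integral>x. (\<Sum>\<^sub>\<infinity>i\<in>A. f i x) \<partial>M)) A"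
proof (cases "finite A")
  case True
  then show ?thesis using int by (auto intro!: has_sum_finiteI)
next
  case False
  \<comment> \<open>\<open>from_nat_into\<close> is a bijection from all natural numbers only for an
    infinite set, hence the separate finite case.\<close>
  then have e: "bij_betw (from_nat_into A) UNIV A" (is "bij_betw ?e _ _")
    using A by (simp add: bij_betw_from_nat_into)
  have eA: "?e n \<in> A" for n using bij_betwE[OF e] by auto
  have s1: "summable (\<lambda>n. \<integral>x. norm (f (?e n) x) \<partial>M)"
    using sum unfolding summable_on_reindex_bij_betw[OF e, symmetric] real_norm_def
    by (rule summable_on_imp_summable)
  have s2: "summable (\<lambda>n. norm (f (?e n) x))" if "x \<in> space M" for x
    using pt[OF that] unfolding summable_on_reindex_bij_betw[OF e, symmetric] real_norm_def
    by (rule summable_on_imp_summable)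
  have eq: "(\<Sum>\<^sub>\<infinity>i\<in>A. f i x) = (\<Sum>n. f (?e n) x)" if "x \<in> space M" for x
  proof -
    have "((\<lambda>n. f (?e n) x) has_sum (\<Sum>n. f (?e n) x)) UNIV"
      using s2[OF that] by (intro norm_summable_imp_has_sum summable_sums summable_norm_cancel[OF s2[OF that]])
    then show ?thesis
      unfolding has_sum_reindex_bij_betw[OF e, where f = "\<lambda>i. f i x"] by (rule infsumI)
  qed
  have "(\<lambda>n. \<integral>x. f (?e n) x \<partial>M) sums (\<integral>x. (\<Sum>n. f (?e n) x) \<partial>M)"
    by (rule sums_integral) (use int eA s1 s2 in auto)
  moreover have "summable (\<lambda>n. norm (\<integral>x. f (?e n) x \<partial>M))"
    by (rule summable_comparison_test'[OF s1]) (use integral_norm_bound in auto)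
  ultimately have "((\<lambda>n. \<integral>x. f (?e n) x \<partial>M) has_sum (\<integral>x. (\<Sum>n. f (?e n) x) \<partial>M)) UNIV"
    by (intro norm_summable_imp_has_sum)
  then have h: "((\<lambda>i. \<integral>x. f i x \<partial>M) has_sum (\<integral>x. (\<Sum>n. f (?e n) x) \<partial>M)) A"
    unfolding has_sum_reindex_bij_betw[OF e, where f = "\<lambda>i. \<integral>x. f i x \<partial>M"] .
  have "(\<integral>x. (\<Sum>\<^sub>\<infinity>i\<in>A. f i x) \<partial>M) = (\<integral>x. (\<Sum>n. f (?e n) x) \<partial>M)"
    by (rule Bochner_Integration.integral_cong) (simp_all add: eq)
  then show ?thesis using h by simp
qed

text \<open>Tannery's theorem: by the Weierstrass M-test the finite partial sums converge uniformly
  on \<open>S\<close>, so the two limits may be exchanged. The bound is asked for on a fixed set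
  \<open>S\<close> because uniform convergence needs one.\<close>

lemma tendsto_infsum_dominated:
  fixes f :: "'i \<Rightarrow> 'a \<Rightarrow> real"
  assumes lim: "\<And>i. i \<in> A \<Longrightarrow> (f i \<longlongrightarrow> g i) F"
    and le: "\<And>i k. i \<in> A \<Longrightarrow> k \<in> S \<Longrightarrow> \<bar>f i k\<bar> \<le> M i" and ev: "eventually (\<lambda>k. k \<in> S) F"
    and M: "M summable_on A" and F: "F \<noteq> bot"
  shows "((\<lambda>k. \<Sum>\<^sub>\<infinity>i\<in>A. f i k) \<longlongrightarrow> (\<Sum>\<^sub>\<infinity>i\<in>A. g i)) F"
proof -
  have gM: "\<bar>g i\<bar> \<le> M i" if "i \<in> A" for i
  proof -
    have "\<forall>\<^sub>F k in F. \<bar>f i k\<bar> \<le> M i"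
      using ev by (rule eventually_mono) (use le that in auto)
    then show ?thesis
      by (rule tendsto_upperbound[OF tendsto_rabs[OF lim[OF that]] _ F])
  qed
  have "(\<lambda>i. norm (g i)) summable_on A"
    by (rule summable_on_comparison_test[OF M]) (use gM in auto)
  then have "(g has_sum (\<Sum>\<^sub>\<infinity>i\<in>A. g i)) A"
    by (rule has_sum_infsum[OF abs_summable_summable])
  then have 1: "((\<lambda>X. \<Sum>i\<in>X. g i) \<longlongrightarrow> (\<Sum>\<^sub>\<infinity>i\<in>A. g i)) (finite_subsets_at_top A)"
    by (simp add: has_sum_def)
  have 2: "\<forall>\<^sub>F X in finite_subsets_at_top A. ((\<lambda>k. \<Sum>i\<in>X. f i k) \<longlongrightarrow> (\<Sum>i\<in>X. g i)) F"
    by (rule eventually_finite_subsets_at_top_weakI) (use lim in \<open>auto intro!: tendsto_sum\<close>)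
  have 3: "uniform_limit S (\<lambda>X k. \<Sum>i\<in>X. f i k) (\<lambda>k. \<Sum>\<^sub>\<infinity>i\<in>A. f i k) (finite_subsets_at_top A)"
    by (rule Weierstrass_m_test_general) (use le M in auto)
  show ?thesis
    by (rule swap_uniform_limit'[OF 2 1 3 ev finite_subsets_at_top_neq_bot])
qed

section \<open>Unimodular lattices\<close>

locale unimodular_lattice =
  fixes V :: "real^'n^'n"
  assumes det_V: "det V = 1"
begin

abbreviation U :: "real^'n^'n" where "U \<equiv> matrix_inv V"

text \<open>A half-open fundamental domain: every point has exactly one lattice translate in it, so
  the tiling holds without exceptional null sets.\<close>

definition cell :: "(real^'n) set" where
  "cell = {x. \<forall>i. 0 \<le> (U *v x) $ i \<and> (U *v x) $ i < 1}"

lemma inverse_V: "V ** U = mat 1" "U ** V = mat 1"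
proof -
  have "invertible V" using det_V by (simp add: invertible_det_nz)
  then have "V ** U = mat 1 \<and> U ** V = mat 1"
    unfolding invertible_def matrix_inv_def by (rule someI_ex)
  then show "V ** U = mat 1" "U ** V = mat 1" by auto
qed

lemma V_U [simp]: "V *v (U *v x) = x" and U_V [simp]: "U *v (V *v x) = x"
  by (simp_all add: matrix_vector_mul_assoc inverse_V)

lemma det_U: "det U = 1"
  using det_mul[of V U] by (simp add: inverse_V det_V)

lemma lattice_iff: "x \<in> lattice V \<longleftrightarrow> (\<forall>i. (U *v x) $ i \<in> \<int>)"
proof
  assume "x \<in> lattice V"
  then show "\<forall>i. (U *v x) $ i \<in> \<int>" unfolding lattice_def by auto
next
  assume "\<forall>i. (U *v x) $ i \<in> \<int>"
  then show "x \<in> lattice V" unfolding lattice_def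
    by (intro CollectI exI[of _ "U *v x"]) auto
qed

lemma lattice_zero: "0 \<in> lattice V"
  by (simp add: lattice_iff)

lemma lattice_add: "x \<in> lattice V \<Longrightarrow> y \<in> lattice V \<Longrightarrow> x + y \<in> lattice V"
  by (simp add: lattice_iff matrix_vector_right_distrib)

lemma lattice_diff: "x \<in> lattice V \<Longrightarrow> y \<in> lattice V \<Longrightarrow> x - y \<in> lattice V"
  by (simp add: lattice_iff matrix_vector_mult_diff_distrib)

lemma lattice_uminus: "x \<in> lattice V \<Longrightarrow> - x \<in> lattice V"
  using lattice_diff[OF lattice_zero] by simp

lemma bij_lattice_add: "a \<in> lattice V \<Longrightarrow> bij_betw (\<lambda>v. v + a) (lattice V) (lattice V)"
  by (rule bij_betw_byWitness[where f' = "\<lambda>v. v - a"]) (auto intro: lattice_add lattice_diff)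

lemma bij_lattice_uminus: "bij_betw uminus (lattice V) (lattice V)"
  by (rule bij_betw_byWitness[where f' = uminus]) (auto intro: lattice_uminus)

lemma countable_lattice: "countable (lattice V)"
proof -
  have "finite (UNIV :: 'n set)" by simp
  then have "countable (Pi\<^sub>E (UNIV :: 'n set) (\<lambda>_. (\<int> :: real set)))"
    by (intro countable_PiE) (auto simp: Ints_def)
  moreover have "lattice V \<subseteq> (\<lambda>k. V *v (\<chi> i. k i)) ` Pi\<^sub>E UNIV (\<lambda>_. \<int>)"
  proof
    fix x assume "x \<in> lattice V"
    then obtain k where "x = V *v k" "\<forall>i. k $ i \<in> \<int>" unfolding lattice_def by auto
    then show "x \<in> (\<lambda>k. V *v (\<chi> i. k i)) ` Pi\<^sub>E UNIV (\<lambda>_. \<int>)"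
      by (intro image_eqI[of _ _ "\<lambda>i. k $ i"]) auto
  qed
  ultimately show ?thesis by (meson countable_image countable_subset)
qed

lemma row_U_inner: "row i U \<bullet> x = (U *v x) $ i"
  by (metis matrix_vector_mul_component row_def vec_lambda_eta)

text \<open>The rows of \<open>U\<close> are the basis dual to the columns of \<open>V\<close>. They
  provide a nonzero dual vector and the frequencies that embed the torus.\<close>

lemma row_U_dual: "row i U \<in> dual_lattice V"
  by (auto simp: dual_lattice_def row_U_inner lattice_iff)

lemma dual_lattice_zero: "0 \<in> dual_lattice V"
  by (simp add: dual_lattice_def)

lemma dual_lattice_add: "x \<in> dual_lattice V \<Longrightarrow> y \<in> dual_lattice V \<Longrightarrow> x + y \<in> dual_lattice V"
  by (auto simp: dual_lattice_def inner_add_left)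

lemma dual_lattice_diff: "x \<in> dual_lattice V \<Longrightarrow> y \<in> dual_lattice V \<Longrightarrow> x - y \<in> dual_lattice V"
  by (auto simp: dual_lattice_def inner_diff_left)

lemma dual_lattice_uminus: "x \<in> dual_lattice V \<Longrightarrow> - x \<in> dual_lattice V"
  by (auto simp: dual_lattice_def)

lemma bij_dual_uminus: "bij_betw uminus (dual_lattice V - {0}) (dual_lattice V - {0})"
  by (rule bij_betw_byWitness[where f' = uminus]) (auto intro: dual_lattice_uminus)

text \<open>The dual lattice is again generated by a matrix of determinant one, so countability,
  Gaussian summability and finiteness of balls carry over from \<open>lattice V\<close>.\<close>

lemma dual_lattice_eq: "dual_lattice V = lattice (transpose U)"
proof -
  have tr: "transpose U *v (transpose V *v w) = w" for w
    unfolding matrix_vector_mul_assoc matrix_transpose_mul[symmetric] inverse_V transpose_mat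
    by (rule matrix_vector_mul_lid)
  have tr': "transpose V *v (transpose U *v w) = w" for w
    unfolding matrix_vector_mul_assoc matrix_transpose_mul[symmetric] inverse_V transpose_mat
    by (rule matrix_vector_mul_lid)
  have inn: "w \<bullet> (V *v k) = (transpose V *v w) \<bullet> k" for w k
    by (metis dot_lmul_matrix vector_transpose_matrix transpose_transpose inner_commute)
  show ?thesis
  proof safe
    fix w assume w: "w \<in> dual_lattice V"
    have int: "(transpose V *v w) $ i \<in> \<int>" for i
    proof -
      have "V *v axis i 1 \<in> lattice V"
        unfolding lattice_def by (intro CollectI exI[of _ "axis i 1"]) (auto simp: axis_def)
      then have "w \<bullet> (V *v axis i 1) \<in> \<int>" using w by (auto simp: dual_lattice_def)
      then show ?thesis unfolding inn by (simp add: inner_axis)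
    qed
    then show "w \<in> lattice (transpose U)"
      unfolding lattice_def by (intro CollectI exI[of _ "transpose V *v w"] conjI allI) (rule tr[symmetric], rule int)
  next
    fix w assume "w \<in> lattice (transpose U)"
    then obtain l where w: "w = transpose U *v l" and l: "\<forall>i. l $ i \<in> \<int>" by (auto simp: lattice_def)
    show "w \<in> dual_lattice V" unfolding dual_lattice_def
    proof (intro CollectI ballI)
      fix v assume "v \<in> lattice V"
      then obtain k where v: "v = V *v k" and k: "\<forall>i. k $ i \<in> \<int>" by (auto simp: lattice_def)
      have "w \<bullet> v = l \<bullet> k" by (simp only: v inn w tr')
      then show "w \<bullet> v \<in> \<int>" using l k by (auto simp: inner_vec_def)
    qed
  qed
qed

lemma unimodular_dual: "unimodular_lattice (transpose U)"
  by unfold_locales (simp add: det_U)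

lemma countable_dual: "countable (dual_lattice V)"
  unfolding dual_lattice_eq by (rule unimodular_lattice.countable_lattice[OF unimodular_dual])

lemma cos_dual_periodic: "w \<in> dual_lattice V \<Longrightarrow> v \<in> lattice V \<Longrightarrow> cos (2 * pi * (w \<bullet> (x + v))) = cos (2 * pi * (w \<bullet> x))"
  and sin_dual_periodic: "w \<in> dual_lattice V \<Longrightarrow> v \<in> lattice V \<Longrightarrow> sin (2 * pi * (w \<bullet> (x + v))) = sin (2 * pi * (w \<bullet> x))"
  by (auto simp: dual_lattice_def inner_add_right distrib_left cos_add sin_add cos_integer_2pi sin_integer_2pi)

lemma cell_translate: "\<exists>!v. v \<in> lattice V \<and> x + v \<in> cell"
proof
  let ?v = "V *v (\<chi> i. - of_int \<lfloor>(U *v x) $ i\<rfloor>)"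
  show "?v \<in> lattice V \<and> x + ?v \<in> cell"
    by (auto simp: lattice_iff cell_def matrix_vector_right_distrib) linarith
  fix v assume v: "v \<in> lattice V \<and> x + v \<in> cell"
  have "(U *v v) $ i = - of_int \<lfloor>(U *v x) $ i\<rfloor>" for i
  proof -
    obtain k where k: "(U *v v) $ i = of_int k" using v by (auto simp: lattice_iff elim: Ints_cases)
    have "0 \<le> (U *v x) $ i + (U *v v) $ i" "(U *v x) $ i + (U *v v) $ i < 1"
      using v by (auto simp: cell_def matrix_vector_right_distrib)
    then have "\<lfloor>(U *v x) $ i\<rfloor> = - k" unfolding k by (intro floor_unique) auto
    then show ?thesis by (simp add: k)
  qed
  then have "U *v v = (\<chi> i. - of_int \<lfloor>(U *v x) $ i\<rfloor>)" by (simp add: vec_eq_iff)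
  then have "V *v (U *v v) = ?v" by simp
  then show "v = ?v" by simp
qed

text \<open>The tiling property as a partition of unity: exactly one summand is nonzero.\<close>

lemma has_sum_indicator_cell: "((\<lambda>v. indicator cell (x + v) * c) has_sum (c :: real)) (lattice V)"
proof -
  obtain v where v: "v \<in> lattice V" "x + v \<in> cell" "\<And>u. u \<in> lattice V \<Longrightarrow> x + u \<in> cell \<Longrightarrow> u = v"
    using cell_translate[of x] by blast
  have z: "x + u \<notin> cell" if "u \<in> lattice V" "u \<noteq> v" for u
    using that v(3)[of u] by blast
  have "((\<lambda>u. indicator cell (x + u) * c) has_sum (\<Sum>u\<in>{v}. indicator cell (x + u) * c)) {v}"
    by (rule has_sum_finite) simp
  moreover have "((\<lambda>u. indicator cell (x + u) * c) has_sum (\<Sum>u\<in>{v}. indicator cell (x + u) * c)) (lattice V) \<longleftrightarrow>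
     ((\<lambda>u. indicator cell (x + u) * c) has_sum (\<Sum>u\<in>{v}. indicator cell (x + u) * c)) {v}"
    by (rule has_sum_cong_neutral) (auto simp: z v(1))
  ultimately show ?thesis using v(2) by simp
qed

lemma cell_measurable [measurable]: "cell \<in> sets borel"
proof -
  have [measurable]: "(\<lambda>x. (U *v x) $ i) \<in> borel_measurable borel" for i
    unfolding row_U_inner[symmetric] by measurable
  have "cell = (\<Inter>i. {x. 0 \<le> (U *v x) $ i \<and> (U *v x) $ i < 1})" by (auto simp: cell_def)
  also have "\<dots> \<in> sets borel" by measurable
  finally show ?thesis .
qed

text \<open>\<open>V\<close> maps the half-open unit cube onto the cell and preserves volume. Volume
  one means that Fourier coefficients over the cell need no normalising factor.\<close>

lemma emeasure_cell: "emeasure lborel cell = 1"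
proof -
  let ?Q = "{x::real^'n. \<forall>i. 0 \<le> x $ i \<and> x $ i < 1}"
  have [measurable]: "(\<lambda>x::real^'n. x $ i) \<in> borel_measurable borel" for i
    by (intro borel_measurable_continuous_onI continuous_intros)
  have "?Q = (\<Inter>i. {x. 0 \<le> x $ i \<and> x $ i < 1})" by auto
  also have "\<dots> \<in> sets borel" by measurable
  finally have Q [measurable]: "?Q \<in> sets borel" .
  have "(\<lambda>x. V *v x) -` cell = ?Q"
    by (auto simp: cell_def)
  then have ind: "indicator cell (V *v x) = (indicator ?Q x :: ennreal)" for x
    by (auto simp: indicator_def)
  have "emeasure lborel cell = (\<integral>\<^sup>+x. indicator cell x \<partial>lborel)"
    by simp
  also have "\<dots> = (\<integral>\<^sup>+x. indicator cell (V *v x) \<partial>lborel)"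
    by (subst nn_integral_lborel_matrix[of _ V]) (simp_all add: det_V)
  also have "\<dots> = emeasure lborel ?Q"
    unfolding ind by (subst nn_integral_indicator) (use Q in auto)
  also have "\<dots> = 1"
  \<comment> \<open>The half-open cube lies between the open and the closed unit box, both of volume
    one.\<close>
  proof (rule antisym)
    have one: "1 \<bullet> b = 1" if "b \<in> Basis" for b :: "real^'n"
      using that by (auto simp: Basis_vec_def inner_axis)
    have 1: "emeasure lborel (cbox (0::real^'n) 1) = 1"
      by (subst emeasure_lborel_cbox) (simp_all add: one)
    have 2: "emeasure lborel (box (0::real^'n) 1) = 1"
      by (subst emeasure_lborel_box) (simp_all add: one)
    have "?Q \<subseteq> cbox 0 1" by (auto simp: mem_box_cart less_imp_le)
    then show "emeasure lborel ?Q \<le> 1" using emeasure_mono[of ?Q "cbox 0 1" lborel] 1 by simp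
    have "box 0 1 \<subseteq> ?Q" by (auto simp: mem_box_cart less_imp_le)
    then show "1 \<le> emeasure lborel ?Q" using emeasure_mono[of "box 0 1" ?Q lborel] 2
Q
      by simp
  qed
  finally show ?thesis .
qed

end

section \<open>Translations of Lebesgue integrals and of Gaussians\<close>

lemma lborel_integral_translate:
  fixes f :: "'a::euclidean_space \<Rightarrow> real"
  assumes "f \<in> borel_measurable borel"
  shows "(\<integral>x. f (c + x) \<partial>lborel) = (\<integral>x. f x \<partial>lborel)"
  using assms by (subst (2) lborel_distr_plus[of c, symmetric]) (simp add: integral_distr)

lemma lborel_integrable_translate:
  fixes f :: "'a::euclidean_space \<Rightarrow> real"
  assumes f: "integrable lborel f"
  shows "integrable lborel (\<lambda>x. f (c + x))"
proof -
  have [measurable]: "f \<in> borel_measurable borel" using f by (auto dest: borel_measurable_integrable)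
  have "integrable (distr lborel borel ((+) c)) f" using f by (simp add: lborel_distr_plus)
  then show ?thesis by (subst (asm) integrable_distr_eq) auto
qed

lemma integrable_indicator_mult:
  fixes f :: "'a::euclidean_space \<Rightarrow> real"
  assumes f: "integrable lborel f" and A: "A \<in> sets borel"
  shows "integrable lborel (\<lambda>x. indicator A x * f x)"
proof (rule Bochner_Integration.integrable_bound[OF f])
  have [measurable]: "f \<in> borel_measurable borel" using f by (auto dest: borel_measurable_integrable)
  note A [measurable]
  show "(\<lambda>x. indicator A x * f x) \<in> borel_measurable lborel" by measurable
  show "AE x in lborel. norm (indicator A x * f x) \<le> norm (f x)"
    by (auto simp: indicator_def)
qed

lemma norm_sq_le_shift: "(norm a)\<^sup>2 \<le> 2 * (norm x)\<^sup>2 + 2 * (norm (x + a))\<^sup>2"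
  for a x :: "'a::real_inner"
proof -
  have "norm a \<le> norm (x + a) + norm x" using norm_triangle_ineq4[of "x + a" x] by simp
  then have "(norm a)\<^sup>2 \<le> (norm (x + a) + norm x)\<^sup>2" by (intro power_mono) auto
  also have "\<dots> \<le> 2 * (norm x)\<^sup>2 + 2 * (norm (x + a))\<^sup>2"
    using sum_squares_bound[of "norm (x + a)" "norm x"] by (simp add: power2_sum)
  finally show ?thesis .
qed

text \<open>Separates the shift \<open>x\<close> from the lattice vector \<open>a\<close> at the
  price of halving the rate. For \<open>x\<close> in a bounded set this yields one summable
  majorant.\<close>

lemma exp_neg_norm_sq_shift:
  fixes a x :: "'a::real_inner"
  assumes "c \<ge> 0"
  shows "exp (- c * (norm (x + a))\<^sup>2) \<le> exp (c * (norm x)\<^sup>2) * exp (- (c / 2) * (norm a)\<^sup>2)"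
proof -
  have "c * (norm a)\<^sup>2 \<le> c * (2 * (norm x)\<^sup>2 + 2 * (norm (x + a))\<^sup>2)"
    using norm_sq_le_shift assms by (rule mult_left_mono)
  then show ?thesis by (simp add: exp_add[symmetric] algebra_simps)
qed

section \<open>Unfolding integrals over the lattice; Gaussian lattice sums\<close>

context unimodular_lattice
begin

text \<open>Insert the partition of unity by translated cells, exchange sum and integral, and
  translate each piece back into \<open>cell\<close>. Finite partial sums of the indicators are at
  most 1, so the integral of \<open>|f|\<close> bounds the sum of the norms.\<close>

lemma has_sum_integral_cell:
  fixes f :: "real^'n \<Rightarrow> real"
  assumes f: "integrable lborel f"
  shows
      "((\<lambda>v. \<integral>x. indicator cell x * f (x + v) \<partial>lborel) has_sum (\<integral>x. f x \<partial>lborel)) (lattice V)"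
proof -
  have fm [measurable]: "f \<in> borel_measurable borel" using f by (auto dest: borel_measurable_integrable)
  have int: "integrable lborel (\<lambda>x. indicator cell (x + v) * f x)" for v
  proof -
    have "integrable lborel (\<lambda>x. indicator {x. x + v \<in> cell} x * f x)"
      by (rule integrable_indicator_mult[OF f]) measurable
    then show ?thesis by (simp add: indicator_def)
  qed
  have "((\<lambda>v. \<integral>x. indicator cell (x + v) * f x \<partial>lborel) has_sum
      (\<integral>x. (\<Sum>\<^sub>\<infinity>v\<in>lattice V. indicator cell (x + v) * f x) \<partial>lborel)) (lattice V)"
  proof (rule has_sum_integral[OF countable_lattice int])
    show "(\<lambda>v. \<integral>x. \<bar>indicator cell (x + v) * f x\<bar> \<partial>lborel) summable_on lattice V"
    proof (rule nonneg_bdd_above_summable_on)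
      show "bdd_above (sum (\<lambda>v. \<integral>x. \<bar>indicator cell (x + v) * f x\<bar> \<partial>lborel) ` {F. F \<subseteq> lattice V \<and> finite F})"
      proof (rule bdd_aboveI2)
        fix F assume F: "F \<in> {F. F \<subseteq> lattice V \<and> finite F}"
        have "(\<Sum>v\<in>F. \<integral>x. \<bar>indicator cell (x + v) * f x\<bar> \<partial>lborel) = (\<integral>x. (\<Sum>v\<in>F. \<bar>indicator cell (x + v) * f x\<bar>) \<partial>lborel)"
          by (rule Bochner_Integration.integral_sum[symmetric]) (use int in auto)
        also have "\<dots> \<le> (\<integral>x. \<bar>f x\<bar> \<partial>lborel)"
        proof (rule integral_mono)
          fix x
          have "(\<Sum>v\<in>F. indicator cell (x + v) * \<bar>f x\<bar>) \<le> \<bar>f x\<bar>"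
            by (rule finite_sum_le_has_sum[OF has_sum_indicator_cell]) (use F in auto)
          then show "(\<Sum>v\<in>F. \<bar>indicator cell (x + v) * f x\<bar>) \<le> \<bar>f x\<bar>" by (simp add: abs_mult)
        qed (use int f in auto)
        finally show "(\<Sum>v\<in>F. \<integral>x. \<bar>indicator cell (x + v) * f x\<bar> \<partial>lborel) \<le> (\<integral>x. \<bar>f x\<bar> \<partial>lborel)" .
      qed
    qed simp
    show "(\<lambda>v. \<bar>indicator cell (x + v) * f x\<bar>) summable_on lattice V" for x
      using has_sum_imp_summable[OF has_sum_indicator_cell[of x "\<bar>f x\<bar>"]] by (simp add: abs_mult)
  qed
  moreover have "(\<Sum>\<^sub>\<infinity>v\<in>lattice V. indicator cell (x + v) * f x) = f x" for x
    by (rule infsumI[OF has_sum_indicator_cell])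
  moreover have "(\<integral>x. indicator cell (x + v) * f x \<partial>lborel) = (\<integral>x. indicator cell x * f (x + - v) \<partial>lborel)" for v
    by (subst lborel_integral_translate[of "\<lambda>x. indicator cell (x + v) * f x" "- v", symmetric]) simp_all
  ultimately have "((\<lambda>v. \<integral>x. indicator cell x * f (x + - v) \<partial>lborel) has_sum (\<integral>x. f x \<partial>lborel)) (lattice V)"
    by simp
  then show ?thesis
    unfolding has_sum_reindex_bij_betw[OF bij_lattice_uminus, where f = "\<lambda>v. \<integral>x. indicator cell x * f (x + v) \<partial>lborel"] .
qed

lemma integrable_cell: "integrable lborel (indicator cell :: _ \<Rightarrow> real)"
  by (simp add: emeasure_cell)

lemma integral_cell [simp]: "(\<integral>x. indicator cell x \<partial>lborel) = (1 :: real)"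
  by (simp add: measure_def emeasure_cell)

lemma integrable_cell_bounded:
  assumes [measurable]: "h \<in> borel_measurable borel" and h: "\<And>x. x \<in> cell \<Longrightarrow> \<bar>h x\<bar> \<le> B"
  shows "integrable lborel (\<lambda>x. indicator cell x * h x :: real)"
  by (rule Bochner_Integration.integrable_bound[OF integrable_mult_left[OF integrable_cell, of B]])
     (use h in \<open>auto simp: indicator_def intro!: order_trans[OF h abs_ge_self]\<close>)

lemma cell_subset_compact: "cell \<subseteq> (\<lambda>y. V *v y) ` cbox 0 1"
proof
  fix x assume "x \<in> cell"
  then have "U *v x \<in> cbox 0 1" by (auto simp: cell_def mem_box_cart less_imp_le)
  then show "x \<in> (\<lambda>y. V *v y) ` cbox 0 1" by (intro image_eqI[of _ _ "U *v x"]) auto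
qed

lemma compact_closed_cell: "compact ((\<lambda>y. V *v y) ` cbox 0 1)"
  by (intro compact_continuous_image matrix_vector_mult_linear_continuous_on compact_cbox)

lemma bounded_cell: "\<exists>R>0. \<forall>x\<in>cell. norm x \<le> R"
proof -
  have "bounded cell"
    using compact_imp_bounded[OF compact_closed_cell] cell_subset_compact by (rule bounded_subset)
  then show ?thesis by (auto simp: bounded_pos)
qed

lemma integrable_gaussian: "c > 0 \<Longrightarrow> integrable lborel (\<lambda>x :: real^'n. exp (- c * (norm x)\<^sup>2))"
  using has_bochner_integral_gaussian_cos[of c 0] by (auto simp: has_bochner_integral_iff)

text \<open>Integral comparison: if \<open>R\<close> bounds the cell, then
  \<open>|x + v|^2 \<le> 2 R^2 + 2 |v|^2\<close> for \<open>x\<close> in it. Hence each term is at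
  most \<open>exp (c R^2)\<close> times the integral of the wider Gaussian of rate
  \<open>c / 2\<close> over the cell shifted by \<open>v\<close>, and these integrals add up to the
  integral over the whole space.\<close>

lemma summable_gaussian:
  assumes c: "c > 0"
  shows "(\<lambda>v. exp (- c * (norm v)\<^sup>2)) summable_on lattice V"
proof -
  obtain R where R: "\<And>x. x \<in> cell \<Longrightarrow> norm x \<le> R" using bounded_cell by blast
  let ?g = "\<lambda>x :: real^'n. exp (- (c / 2) * (norm x)\<^sup>2)"
  have g: "integrable lborel ?g" using c by (intro integrable_gaussian) simp
  have S: "(\<lambda>v. exp (c * R\<^sup>2) * (\<integral>x. indicator cell x * ?g (x + v) \<partial>lborel)) summable_on lattice V"
    by (intro summable_on_cmult_right has_sum_imp_summable[OF has_sum_integral_cell[OF g]])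
  show ?thesis
  proof (rule summable_on_comparison_test[OF S])
    fix v assume "v \<in> lattice V"
    have int: "integrable lborel (\<lambda>x. indicator cell x * ?g (x + v))"
      using lborel_integrable_translate[OF g, of v]
      by (intro integrable_indicator_mult) (auto simp: add.commute)
    have "exp (- c * (norm v)\<^sup>2) = (\<integral>x. indicator cell x * exp (- c * (norm v)\<^sup>2) \<partial>lborel)"
      by (simp del: Bochner_Integration.integral_indicator)
    also have "\<dots> \<le> (\<integral>x. exp (c * R\<^sup>2) * (indicator cell x * ?g (x + v)) \<partial>lborel)"
    proof (rule integral_mono)
      show "integrable lborel (\<lambda>x. indicator cell x * exp (- c * (norm v)\<^sup>2))"
        by (intro integrable_mult_left integrable_cell)
      show "integrable lborel (\<lambda>x. exp (c * R\<^sup>2) * (indicator cell x * ?g (x + v)))"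
        by (intro integrable_mult_right int)
      fix x
      show "indicator cell x * exp (- c * (norm v)\<^sup>2) \<le> exp (c * R\<^sup>2) * (indicator cell x * ?g (x + v))"
      proof (cases "x \<in> cell")
        case True
        have "(norm (x + v))\<^sup>2 \<le> 2 * (norm x)\<^sup>2 + 2 * (norm v)\<^sup>2"
          using norm_sq_le_shift[of "x + v" "- x"] by simp
        also have "\<dots> \<le> 2 * R\<^sup>2 + 2 * (norm v)\<^sup>2"
          using R[OF True] by (auto intro!: power_mono)
        finally have "c * (norm (x + v))\<^sup>2 \<le> c * (2 * R\<^sup>2 + 2 * (norm v)\<^sup>2)"
          using c by (intro mult_left_mono) auto
        then show ?thesis using True by (simp add: exp_add[symmetric] algebra_simps)
      qed simp
    qed
    also have "\<dots> = exp (c * R\<^sup>2) * (\<integral>x. indicator cell x * ?g (x + v) \<partial>lborel)" by simp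
    finally show "exp (- c * (norm v)\<^sup>2) \<le> exp (c * R\<^sup>2) * (\<integral>x. indicator cell x * ?g (x + v) \<partial>lborel)" .
  qed simp
qed

lemma summable_gaussian_shift:
  assumes c: "c > 0"
  shows "(\<lambda>v. exp (- c * (norm (z + v))\<^sup>2)) summable_on lattice V"
proof (rule summable_on_comparison_test)
  show "(\<lambda>v. exp (c * (norm z)\<^sup>2) * exp (- (c / 2) * (norm v)\<^sup>2)) summable_on lattice V"
    using c by (intro summable_on_cmult_right summable_gaussian) simp
qed (use exp_neg_norm_sq_shift[of c z] c in auto)

text \<open>On a ball the Gaussian terms are bounded below by \<open>exp (- R^2)\<close>, so
  infinitely many of them could not be summable.\<close>

lemma finite_lattice_ball: "finite {v \<in> lattice V. norm v \<le> R}"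
proof (rule ccontr)
  let ?B = "{v \<in> lattice V. norm v \<le> R}"
  assume inf: "infinite ?B"
  have "(\<lambda>v::real^'n. exp (- 1 * (norm v)\<^sup>2)) summable_on ?B"
    by (rule summable_on_subset_banach[OF summable_gaussian]) auto
  then have "(\<lambda>v::real^'n. exp (- R\<^sup>2)) summable_on ?B"
    by (rule summable_on_comparison_test) (auto intro!: power_mono)
  then show False using infsum_diverge_constant[OF inf, of "exp (- R\<^sup>2)"] by simp
qed

lemma summable_gaussian_dual: "c > 0 \<Longrightarrow> (\<lambda>w. exp (- c * (norm w)\<^sup>2)) summable_on dual_lattice V"
  unfolding dual_lattice_eq by (rule unimodular_lattice.summable_gaussian[OF unimodular_dual])

text \<open>(W2) is quantified over minimal dual vectors and would be vacuous if there were
  none.\<close>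

lemma ex_minimal_dual: "\<exists>w0 \<in> dual_lattice V - {0}. \<forall>w \<in> dual_lattice V - {0}. norm w0 \<le> norm w"
proof -
  obtain i :: 'n where True by simp
  have w1: "row i U \<in> dual_lattice V - {0}"
    using row_U_dual det_U det_zero_row(1)[of i U] by auto
  let ?B = "{w \<in> dual_lattice V - {0}. norm w \<le> norm (row i U)}"
  have "finite ?B"
    by (rule finite_subset[OF _ unimodular_lattice.finite_lattice_ball[OF unimodular_dual, of "norm (row i U)"]])
       (auto simp: dual_lattice_eq)
  then have "\<exists>w0. is_arg_min norm (\<lambda>w. w \<in> ?B) w0"
    using w1 by (intro ex_is_arg_min_if_finite) auto
  then obtain w0 where w0: "w0 \<in> ?B" "\<And>w. w \<in> ?B \<Longrightarrow> norm w0 \<le> norm w"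
    unfolding is_arg_min_linorder by blast
  show ?thesis
  proof (intro bexI[of _ w0] ballI)
    fix w assume "w \<in> dual_lattice V - {0}"
    then show "norm w0 \<le> norm w" using w0 by (cases "norm w \<le> norm (row i U)") auto
  qed (use w0 in auto)
qed

text \<open>Unfolding: with a character for \<open>h\<close>, a Fourier coefficient of the
  periodisation of \<open>g\<close> is a value of the Fourier transform of \<open>g\<close>. With
  the indicator of a shifted cell for \<open>g\<close>, it shows that integrals of periodic
  functions over a cell do not depend on the position of the cell.\<close>

lemma integral_periodization:
  fixes g h :: "real^'n \<Rightarrow> real"
  assumes g: "integrable lborel g" and gs: "\<And>x. (\<lambda>v. \<bar>g (x + v)\<bar>) summable_on lattice V"
    and h [measurable]: "h \<in> borel_measurable borel" and h1: "\<And>x. \<bar>h x\<bar> \<le> 1"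
    and hp: "\<And>v x. v \<in> lattice V \<Longrightarrow> h (x + v) = h x"
  shows "(\<integral>x. indicator cell x * ((\<Sum>\<^sub>\<infinity>v\<in>lattice V. g (x + v)) * h x) \<partial>lborel) = (\<integral>x. g x * h x \<partial>lborel)"
proof -
  have gm [measurable]: "g \<in> borel_measurable borel" using g by (auto dest: borel_measurable_integrable)
  have gh: "integrable lborel (\<lambda>x. g x * h x)"
    by (rule Bochner_Integration.integrable_bound[OF g]) (use h1 in \<open>auto simp: abs_mult intro!: mult_left_le\<close>)
  let ?f = "\<lambda>v x. indicator cell x * (g (x + v) * h x)"
  have gv: "integrable lborel (\<lambda>x. g (x + v) * h (x + v))" for v
    using lborel_integrable_translate[OF gh, of v] by (simp add: add.commute)
  have int: "integrable lborel (?f v)" if "v \<in> lattice V" for v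
    using integrable_indicator_mult[OF gv[of v] cell_measurable] hp[OF that] by simp
  have sumabs: "(\<lambda>v. \<integral>x. \<bar>?f v x\<bar> \<partial>lborel) summable_on lattice V"
  proof -
    have "(\<lambda>v. \<integral>x. indicator cell x * \<bar>g (x + v) * h (x + v)\<bar> \<partial>lborel) summable_on lattice V"
      by (rule has_sum_imp_summable[OF has_sum_integral_cell]) (use gh in auto)
    then show ?thesis by (rule summable_on_cong[THEN iffD1, rotated]) (auto simp: abs_mult hp)
  qed
  have pt: "(\<lambda>v. \<bar>?f v x\<bar>) summable_on lattice V" for x
    using summable_on_cmult_right[OF gs[of x], of "indicator cell x * \<bar>h x\<bar>"] by (simp add: abs_mult mult_ac)
  have eq: "(\<Sum>\<^sub>\<infinity>v\<in>lattice V. ?f v x) = indicator cell x * ((\<Sum>\<^sub>\<infinity>v\<in>lattice V. g (x + v)) * h x)" for x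
    by (simp add: infsum_cmult_right' infsum_cmult_left')
  have "((\<lambda>v. \<integral>x. ?f v x \<partial>lborel) has_sum
      (\<integral>x. indicator cell x * ((\<Sum>\<^sub>\<infinity>v\<in>lattice V. g (x + v)) * h x) \<partial>lborel)) (lattice V)"
    using has_sum_integral[OF countable_lattice int sumabs pt] unfolding eq .
  moreover have "((\<lambda>v. \<integral>x. ?f v x \<partial>lborel) has_sum (\<integral>x. g x * h x \<partial>lborel)) (lattice V)"
    by (rule has_sum_cong[THEN iffD1, rotated, OF has_sum_integral_cell[OF gh]]) (simp add: hp)
  ultimately show "(\<integral>x. indicator cell x * ((\<Sum>\<^sub>\<infinity>v\<in>lattice V. g (x + v)) * h x) \<partial>lborel) = (\<integral>x. g x * h x \<partial>lborel)"
    by (rule has_sum_unique)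
qed

end

section \<open>Uniqueness of Fourier coefficients\<close>

lemma open_AE_lborel_empty:
  fixes S :: "'a::euclidean_space set"
  assumes S: "open S" and ae: "AE x in lborel. x \<notin> S"
  shows "S = {}"
proof (rule ccontr)
  assume "S \<noteq> {}"
  then have "\<not> negligible S" using S by (intro open_not_negligible)
  moreover have "S \<in> null_sets lborel"
    using ae S AE_iff_null_sets[of S lborel] by (simp add: borel_open)
  then have "negligible S" unfolding negligible_iff_null_sets by (rule null_sets_completionI)
  ultimately show False by contradiction
qed

context unimodular_lattice
begin

text \<open>Real trigonometric polynomials on the torus, generated only by linear operations:
  vanishing integrals against the characters then extend to all of them by induction. Closure under
  products is proved separately, from the product-to-sum formulas.\<close>

inductive trig :: "(real^'n \<Rightarrow> real) \<Rightarrow> bool" where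
  trig_cos: "w \<in> dual_lattice V \<Longrightarrow> trig (\<lambda>x. cos (2 * pi * (w \<bullet> x)))"
| trig_sin: "w \<in> dual_lattice V \<Longrightarrow> trig (\<lambda>x. sin (2 * pi * (w \<bullet> x)))"
| trig_add: "trig p \<Longrightarrow> trig q \<Longrightarrow> trig (\<lambda>x. p x + q x)"
| trig_scale: "trig p \<Longrightarrow> trig (\<lambda>x. c * p x)"

lemma trig_const: "trig (\<lambda>x. c)"
  using trig_scale[OF trig_cos[OF dual_lattice_zero], of c] by simp

lemma trig_sum: "finite S \<Longrightarrow> (\<And>b. b \<in> S \<Longrightarrow> trig (p b)) \<Longrightarrow> trig (\<lambda>x. \<Sum>b\<in>S. p b x)"
  by (induction S rule: finite_induct) (simp_all add: trig_const trig_add)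

lemma trig_mult_cos_sin:
  assumes "trig q" "w \<in> dual_lattice V"
  shows "trig (\<lambda>x. cos (2 * pi * (w \<bullet> x)) * q x) \<and> trig (\<lambda>x. sin (2 * pi * (w \<bullet> x)) * q x)"
  using assms(1)
proof induction
  case (trig_cos u)
  note d = dual_lattice_add[OF assms(2) trig_cos] dual_lattice_diff[OF assms(2) trig_cos]
  have "trig (\<lambda>x. 1 / 2 * (cos (2 * pi * ((w + u) \<bullet> x)) + cos (2 * pi * ((w - u) \<bullet> x))))"
    "trig (\<lambda>x. 1 / 2 * (sin (2 * pi * ((w + u) \<bullet> x)) + sin (2 * pi * ((w - u) \<bullet> x))))"
    by (intro trig.intros d)+
  then show ?case
    by (simp add: inner_add_left inner_diff_left distrib_left right_diff_distrib cos_add cos_diff sin_add sin_diff mult.commute)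
next
  case (trig_sin u)
  note d = dual_lattice_add[OF assms(2) trig_sin] dual_lattice_diff[OF assms(2) trig_sin]
  have "trig (\<lambda>x. 1 / 2 * (sin (2 * pi * ((w + u) \<bullet> x)) + - 1 * sin (2 * pi * ((w - u) \<bullet> x))))"
    "trig (\<lambda>x. 1 / 2 * (cos (2 * pi * ((w - u) \<bullet> x)) + - 1 * cos (2 * pi * ((w + u) \<bullet> x))))"
    by (intro trig.intros d)+
  then show ?case
    by (simp add: inner_add_left inner_diff_left distrib_left right_diff_distrib cos_add cos_diff sin_add sin_diff mult.commute)
next
  case (trig_add p q)
  have "trig (\<lambda>x. cos (2 * pi * (w \<bullet> x)) * p x + cos (2 * pi * (w \<bullet> x)) * q x)"
    "trig (\<lambda>x. sin (2 * pi * (w \<bullet> x)) * p x + sin (2 * pi * (w \<bullet> x)) * q x)"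
    using trig_add.IH by (auto intro: trig.trig_add)
  then show ?case by (simp add: distrib_left)
next
  case (trig_scale p c)
  have "trig (\<lambda>x. c * (cos (2 * pi * (w \<bullet> x)) * p x))" "trig (\<lambda>x. c * (sin (2 * pi * (w \<bullet> x)) * p x))"
    using trig_scale.IH by (auto intro: trig.trig_scale)
  then show ?case by (simp add: mult.left_commute)
qed

lemma trig_mult:
  assumes "trig p" "trig q"
  shows "trig (\<lambda>x. p x * q x)"
  using assms(1)
proof induction
  case (trig_add p r)
  have "trig (\<lambda>x. p x * q x + r x * q x)" using trig_add.IH by (rule trig.trig_add)
  then show ?case by (simp add: distrib_right)
next
  case (trig_scale p c)
  have "trig (\<lambda>x. c * (p x * q x))" using trig_scale.IH by (rule trig.trig_scale)
  then show ?case by (simp add: mult.assoc)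
qed (use trig_mult_cos_sin[OF assms(2)] in auto)

lemma trig_continuous: "trig p \<Longrightarrow> continuous_on UNIV p"
  by (induction rule: trig.induct) (auto intro!: continuous_intros)

text \<open>Embeds the torus as a compact subset of a Euclidean space, where ordinary polynomials
  are dense among continuous functions. Pulled back to the torus, polynomials become trigonometric
  polynomials.\<close>

definition torus_map :: "real^'n \<Rightarrow> complex^'n" where
  "torus_map x = (\<chi> i. cis (2 * pi * (row i U \<bullet> x)))"

lemma torus_map_eq_iff: "torus_map x = torus_map y \<longleftrightarrow> x - y \<in> lattice V"
proof -
  have "cis (2 * pi * (row i U \<bullet> x)) = cis (2 * pi * (row i U \<bullet> y)) \<longleftrightarrow> (U *v (x - y)) $ i \<in> \<int>" for i
  proof -
    have "cis (2 * pi * (row i U \<bullet> x)) = cis (2 * pi * (row i U \<bullet> y)) \<longleftrightarrow>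
      (\<exists>n::int. 2 * pi * (row i U \<bullet> x) = 2 * pi * (row i U \<bullet> y) + 2 * pi * n)"
      by (subst sin_cos_eq_iff[symmetric]) (auto simp: complex_eq_iff)
    also have "\<dots> \<longleftrightarrow> (\<exists>n::int. row i U \<bullet> x = row i U \<bullet> y + n)"
      by (intro ex_cong1) (simp flip: distrib_left)
    also have "\<dots> \<longleftrightarrow> (U *v (x - y)) $ i \<in> \<int>"
      by (auto simp: row_U_inner[symmetric] inner_diff_right Ints_def algebra_simps)
    finally show ?thesis .
  qed
  then show ?thesis by (simp add: torus_map_def vec_eq_iff lattice_iff)
qed

lemma continuous_torus_map: "continuous_on S torus_map"
  unfolding torus_map_def by (intro continuous_intros)

lemma trig_polynomial_torus_map:
  assumes "real_polynomial_function p"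
  shows "trig (\<lambda>x. p (torus_map x))"
  using assms
proof induction
  case (linear f)
  have b: "trig (\<lambda>x. torus_map x \<bullet> b)" if bB: "b \<in> Basis" for b
  proof -
    obtain i u where b: "b = axis i u" "u \<in> Basis" using bB unfolding Basis_vec_def by blast
    have "torus_map x \<bullet> b = (if u = 1 then cos (2 * pi * (row i U \<bullet> x)) else sin (2 * pi * (row i U \<bullet> x)))" for x
      using b(2) by (auto simp: b(1) inner_axis torus_map_def Basis_complex_def inner_complex_def)
    then show ?thesis using row_U_dual by (cases "u = 1") (auto intro: trig_cos trig_sin)
  qed
  have "f (torus_map x) = (\<Sum>b\<in>Basis. f b * (torus_map x \<bullet> b))" for x
    using linear by (subst euclidean_representation[symmetric])
      (simp add: linear_sum linear_scale bounded_linear.linear mult.commute)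
  moreover have "trig (\<lambda>x. \<Sum>b\<in>Basis. f b * (torus_map x \<bullet> b))"
    by (intro trig_sum trig_scale b) auto
  ultimately show ?case by simp
qed (auto intro: trig_const trig_add trig_mult)

lemma trig_approximation:
  fixes F :: "real^'n \<Rightarrow> real"
  assumes cont: "continuous_on UNIV F" and per: "\<And>v x. v \<in> lattice V \<Longrightarrow> F (x + v) = F x" and e: "e > 0"
  shows "\<exists>p. trig p \<and> (\<forall>x. \<bar>F x - p x\<bar> < e)"
proof -
  let ?K = "(\<lambda>y. V *v y) ` cbox 0 1"
  let ?T = "torus_map ` ?K"
  \<comment> \<open>\<open>F\<close> descends to the image of the torus. The choice of a preimage
    does not matter: the fibres of \<open>torus_map\<close> are lattice cosets and \<open>F\<close>
    is periodic.\<close>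
  define G where "G z = F (SOME x. torus_map x = z)" for z
  have GF: "G (torus_map x) = F x" for x
  proof -
    have "torus_map (SOME y. torus_map y = torus_map x) = torus_map x" by (rule someI) simp
    then show ?thesis using per[of "(SOME y. torus_map y = torus_map x) - x" x]
      by (simp add: torus_map_eq_iff G_def)
  qed
  have T: "torus_map x \<in> ?T" for x
  proof -
    obtain v where v: "v \<in> lattice V" "x + v \<in> cell" using cell_translate[of x] by blast
    then have "torus_map x = torus_map (x + v)" by (simp add: torus_map_eq_iff lattice_uminus)
    then show ?thesis using v(2) cell_subset_compact by auto
  qed
  have "continuous_on ?T G"
    unfolding continuous_openin_preimage_eq
  proof (intro allI impI)
    fix W :: "real set" assume W: "open W"
    have "openin (top_of_set ?K) (?K \<inter> F -` W)"
      using continuous_on_subset[OF cont] W by (intro continuous_openin_preimage_gen) auto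
    moreover have "?K \<inter> F -` W = ?K \<inter> torus_map -` (?T \<inter> G -` W)"
      by (intro set_eqI) (simp only: Int_iff vimage_eq GF T simp_thms)
    ultimately show "openin (top_of_set ?T) (?T \<inter> G -` W)"
      using Abstract_Topology_2.continuous_imp_quotient_map[OF continuous_torus_map refl compact_closed_cell, of "?T \<inter> G -` W"] by simp
  qed
  moreover have "compact ?T" by (intro compact_continuous_image continuous_torus_map compact_closed_cell)
  ultimately obtain p where p: "real_polynomial_function p" "\<And>z. z \<in> ?T \<Longrightarrow> \<bar>G z - p z\<bar> < e"
    using Stone_Weierstrass_real_polynomial_function[OF _ _ e] by metis
  show ?thesis
    using trig_polynomial_torus_map[OF p(1)] p(2)[OF T] by (intro exI[of _ "\<lambda>x. p (torus_map x)"]) (simp add: GF)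
qed

lemma continuous_cell_bounded:
  fixes h :: "real^'n \<Rightarrow> real"
  assumes "continuous_on UNIV h"
  obtains B where "B \<ge> 0" "\<And>x. x \<in> cell \<Longrightarrow> \<bar>h x\<bar> \<le> B"
proof -
  have "compact (h ` (\<lambda>y. V *v y) ` cbox 0 1)"
    by (intro compact_continuous_image continuous_on_subset[OF assms] compact_closed_cell) auto
  then obtain B where "\<forall>y\<in>h ` (\<lambda>y. V *v y) ` cbox 0 1. norm y \<le> B" "B > 0"
    using compact_imp_bounded bounded_pos by metis
  then show thesis using cell_subset_compact by (intro that[of B]) auto
qed

lemma integrable_cell_continuous:
  fixes h :: "real^'n \<Rightarrow> real"
  assumes "continuous_on UNIV h"
  shows "integrable lborel (\<lambda>x. indicator cell x * h x)"
proof -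
  obtain B where "\<And>x. x \<in> cell \<Longrightarrow> \<bar>h x\<bar> \<le> B" using continuous_cell_bounded[OF assms] by metis
  then show ?thesis by (intro integrable_cell_bounded borel_measurable_continuous_onI assms)
qed

text \<open>\<open>F\<close> is orthogonal to every trigonometric polynomial \<open>p\<close>. If
  \<open>p\<close> is within \<open>e\<close> of \<open>F\<close>, the integral of
  \<open>F * F\<close> over the cell equals that of \<open>F * (F - p)\<close> and is at most
  \<open>e * B\<close>; hence it is 0. Then \<open>F\<close> vanishes almost everywhere, and by
  continuity everywhere.\<close>

lemma periodic_zero_of_coefficients:
  fixes F :: "real^'n \<Rightarrow> real"
  assumes cont: "continuous_on UNIV F" and per: "\<And>v x. v \<in> lattice V \<Longrightarrow> F (x + v) = F x"
    and c: "\<And>w. w \<in> dual_lattice V \<Longrightarrow> (\<integral>x. indicator cell x * (F x * cos (2 * pi * (w \<bullet> x))) \<partial>lborel) = 0"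
    and s: "\<And>w. w \<in> dual_lattice V \<Longrightarrow> (\<integral>x. indicator cell x * (F x * sin (2 * pi * (w \<bullet> x))) \<partial>lborel) = 0"
  shows "F x = 0"
proof -
  have cp: "continuous_on UNIV (\<lambda>x. F x * p x)" if "trig p" for p
    using cont trig_continuous[OF that] by (rule continuous_on_mult)
  have FF: "continuous_on UNIV (\<lambda>x. F x * F x)"
    using cont cont by (rule continuous_on_mult)
  have trig0: "(\<integral>x. indicator cell x * (F x * p x) \<partial>lborel) = 0" if "trig p" for p
    using that
  proof induction
    case (trig_add p q)
    have "(\<integral>x. indicator cell x * (F x * p x) + indicator cell x * (F x * q x) \<partial>lborel) = 0"
      using trig_add by (subst Bochner_Integration.integral_add)
        (auto intro!: integrable_cell_continuous cp)
    then show ?case by (simp add: algebra_simps)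
  next
    case (trig_scale p c)
    have "(\<integral>x. c * (indicator cell x * (F x * p x)) \<partial>lborel) = 0"
      using trig_scale by simp
    then show ?case by (simp add: algebra_simps)
  qed (use c s in auto)
  obtain B where B: "B \<ge> 0" "\<And>x. x \<in> cell \<Longrightarrow> \<bar>F x\<bar> \<le> B" using continuous_cell_bounded[OF cont] by metis
  have le: "(\<integral>x. indicator cell x * (F x * F x) \<partial>lborel) \<le> e * B" if e: "e > 0" for e
  proof -
    obtain p where p: "trig p" "\<And>x. \<bar>F x - p x\<bar> < e" using trig_approximation[OF cont per e] by blast
    have "(\<integral>x. indicator cell x * (F x * F x) \<partial>lborel) =
      (\<integral>x. indicator cell x * (F x * F x) - indicator cell x * (F x * p x) \<partial>lborel)"
      by (subst Bochner_Integration.integral_diff)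
         (auto intro!: integrable_cell_continuous FF cp p(1) simp: trig0[OF p(1)])
    also have "\<dots> \<le> (\<integral>x. indicator cell x * (e * B) \<partial>lborel)"
    proof (rule integral_mono)
      fix x
      show "indicator cell x * (F x * F x) - indicator cell x * (F x * p x) \<le> indicator cell x * (e * B)"
      proof (cases "x \<in> cell")
        case True
        have "F x * F x - F x * p x = F x * (F x - p x)" by (simp add: algebra_simps)
        also have "\<dots> \<le> \<bar>F x\<bar> * \<bar>F x - p x\<bar>" by (metis abs_ge_self abs_mult)
        also have "\<dots> \<le> B * e" using B True p(2)[of x] by (intro mult_mono) auto
        finally show ?thesis using True by (simp add: mult.commute)
      qed simp
    qed (auto intro!: integrable_mult_left integrable_cell Bochner_Integration.integrable_diff integrable_cell_continuous FF cp[OF p(1)])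
    also have "\<dots> = e * B" by (simp del: Bochner_Integration.integral_indicator)
    finally show ?thesis .
  qed
  have "(\<integral>x. indicator cell x * (F x * F x) \<partial>lborel) \<le> 0"
  proof (rule field_le_epsilon)
    fix d :: real assume d: "d > 0"
    \<comment> \<open>Dividing by \<open>B + 1\<close> instead of \<open>B\<close> covers
      \<open>B = 0\<close>.\<close>
    have "(\<integral>x. indicator cell x * (F x * F x) \<partial>lborel) \<le> d / (B + 1) * B"
      using d B(1) by (intro le) auto
    also have "\<dots> \<le> d" using d B(1) by (simp add: field_simps)
    finally show "(\<integral>x. indicator cell x * (F x * F x) \<partial>lborel) \<le> 0 + d" by simp
  qed
  then have "(\<integral>x. indicator cell x * (F x * F x) \<partial>lborel) = 0"
    by (intro antisym integral_nonneg) auto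
  then have "AE x in lborel. indicator cell x * (F x * F x) = 0"
    by (subst (asm) integral_nonneg_eq_0_iff_AE) (auto intro!: integrable_cell_continuous continuous_intros cont)
  then have ae: "AE x in lborel. x \<in> cell \<longrightarrow> F x = 0" by (rule AE_mp) auto
  have Fm [measurable]: "F \<in> borel_measurable borel" using cont by (rule borel_measurable_continuous_onI)
  have "AE x in lborel. v + x \<in> cell \<longrightarrow> F (v + x) = 0" for v
  proof -
    have "AE x in distr lborel borel ((+) v). x \<in> cell \<longrightarrow> F x = 0"
      unfolding lborel_distr_plus by (rule ae)
    then show ?thesis by (subst (asm) AE_distr_iff) auto
  qed
  \<comment> \<open>Countability of the lattice unites the exceptional sets of all translated cells
    into one null set.\<close>
  then have "AE x in lborel. \<forall>v\<in>lattice V. v + x \<in> cell \<longrightarrow> F (v + x) = 0"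
    using countable_lattice by (subst AE_ball_countable) auto
  then have "AE x in lborel. x \<notin> {x. F x \<noteq> 0}"
  proof (rule AE_mp, intro AE_I2 impI)
    fix x assume h: "\<forall>v\<in>lattice V. v + x \<in> cell \<longrightarrow> F (v + x) = 0"
    obtain v where "v \<in> lattice V" "x + v \<in> cell" using cell_translate[of x] by blast
    then have "F (x + v) = 0" "F (x + v) = F x" using h per by (auto simp: add.commute)
    then show "x \<notin> {x. F x \<noteq> 0}" by simp
  qed
  moreover have "open {x. F x \<noteq> 0}"
    using cont by (intro open_Collect_neq) auto
  ultimately have "{x. F x \<noteq> 0} = {}" by (rule open_AE_lborel_empty[rotated])
  then show ?thesis by auto
qed

end

section \<open>Poisson summation for Gaussians\<close>

lemma has_sum_single:
  "a \<in> A \<Longrightarrow> ((\<lambda>u. if u = a then c else 0) has_sum (c :: real)) A"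
proof -
  assume a: "a \<in> A"
  have "((\<lambda>u. if u = a then c else 0) has_sum (\<Sum>u\<in>{a}. if u = a then c else 0)) {a}"
    by (rule has_sum_finite) simp
  moreover have "((\<lambda>u. if u = a then c else 0) has_sum c) A \<longleftrightarrow> ((\<lambda>u. if u = a then c else 0) has_sum c) {a}"
    by (rule has_sum_cong_neutral) (use a in auto)
  ultimately show ?thesis by simp
qed

lemma continuous_on_infsum:
  fixes f :: "'i \<Rightarrow> 'a::metric_space \<Rightarrow> real"
  assumes f: "\<And>i. i \<in> A \<Longrightarrow> continuous_on UNIV (f i)"
    and M: "\<And>z. \<exists>M. M summable_on A \<and> (\<forall>i\<in>A. \<forall>x\<in>ball z 1. \<bar>f i x\<bar> \<le> M i)"
  shows "continuous_on UNIV (\<lambda>x. \<Sum>\<^sub>\<infinity>i\<in>A. f i x)"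
  unfolding continuous_on_def
proof
  fix z
  obtain M where M: "M summable_on A" "\<And>i x. i \<in> A \<Longrightarrow> x \<in> ball z 1 \<Longrightarrow> \<bar>f i x\<bar> \<le> M i" using M[of z] by blast
  show "((\<lambda>x. \<Sum>\<^sub>\<infinity>i\<in>A. f i x) \<longlongrightarrow> (\<Sum>\<^sub>\<infinity>i\<in>A. f i z)) (at z)"
  \<comment> \<open>At an isolated point the filter is trivial, which
    \<open>tendsto_infsum_dominated\<close> excludes.\<close>
  proof (cases "at z = bot")
    case False
    show ?thesis
    proof (rule tendsto_infsum_dominated[where S = "ball z 1", OF _ M(2) _ M(1) False])
      show "\<forall>\<^sub>F k in at z. k \<in> ball z 1" by (rule eventually_at_in_open') auto
    qed (use f in \<open>auto simp: continuous_on_def\<close>)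
  qed simp
qed

lemma far_integrand_minus [simp]: "far_integrand (- w) t = far_integrand w t"
  by (simp add: far_integrand_def)

lemma far_integrand_nonneg: "0 \<le> far_integrand w t"
  by (simp add: far_integrand_def)

context unimodular_lattice
begin

text \<open>Integrals of periodic functions over \<open>cell\<close> and over its translate by
  \<open>a\<close> agree, while the second is minus the first by antiperiodicity.\<close>

lemma integral_cell_antiperiodic:
  fixes h :: "real^'n \<Rightarrow> real"
  assumes hm [measurable]: "h \<in> borel_measurable borel" and h1: "\<And>x. \<bar>h x\<bar> \<le> 1"
    and hp: "\<And>v x. v \<in> lattice V \<Longrightarrow> h (x + v) = h x" and ha: "\<And>x. h (a + x) = - h x"
  shows "(\<integral>x. indicator cell x * h x \<partial>lborel) = 0"
proof -
  let ?g = "\<lambda>x. indicator cell (- a + x) :: real"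
  have "integrable lborel ?g" by (rule lborel_integrable_translate[OF integrable_cell])
  moreover have hs: "((\<lambda>v. ?g (x + v)) has_sum 1) (lattice V)" for x
    using has_sum_indicator_cell[of "- a + x" 1] by (simp add: algebra_simps)
  moreover from hs have "(\<lambda>v. \<bar>?g (x + v)\<bar>) summable_on lattice V" for x
    using has_sum_imp_summable[OF hs] by simp
  ultimately have "(\<integral>x. indicator cell x * ((\<Sum>\<^sub>\<infinity>v\<in>lattice V. ?g (x + v)) * h x) \<partial>lborel) = (\<integral>x. ?g x * h x \<partial>lborel)"
    by (intro integral_periodization hm h1 hp)
  also have "(\<integral>x. ?g x * h x \<partial>lborel) = (\<integral>x. indicator cell x * h (a + x) \<partial>lborel)"
    by (subst lborel_integral_translate[of "\<lambda>x. ?g x * h x" a, symmetric]) simp_all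
  finally show ?thesis using infsumI[OF hs] ha by simp
qed

lemma
  assumes w: "w \<in> dual_lattice V"
  shows integral_cell_cos: "(\<integral>x. indicator cell x * cos (2 * pi * (w \<bullet> x)) \<partial>lborel) = (if w = 0 then 1 else 0)"
    and integral_cell_sin: "(\<integral>x. indicator cell x * sin (2 * pi * (w \<bullet> x)) \<partial>lborel) = 0"
proof -
  have "(\<integral>x. indicator cell x * cos (2 * pi * (w \<bullet> x)) \<partial>lborel) = 0 \<and>
    (\<integral>x. indicator cell x * sin (2 * pi * (w \<bullet> x)) \<partial>lborel) = 0" if w0: "w \<noteq> 0"
  proof -
    \<comment> \<open>\<open>w \<bullet> a = 1/2\<close>, so translation by \<open>a\<close> changes the sign of both functions.\<close>
    define a where "a = (1 / (2 * (w \<bullet> w))) *\<^sub>R w"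
    have "2 * pi * (w \<bullet> (a + x)) = 2 * pi * (w \<bullet> x) + pi" for x
      using w0 by (simp add: a_def inner_add_right distrib_left)
    then have "cos (2 * pi * (w \<bullet> (a + x))) = - cos (2 * pi * (w \<bullet> x))"
      "sin (2 * pi * (w \<bullet> (a + x))) = - sin (2 * pi * (w \<bullet> x))" for x
      by (simp_all add: cos_periodic_pi sin_periodic_pi)
    then show ?thesis
      using cos_dual_periodic[OF w] sin_dual_periodic[OF w]
      by (intro conjI integral_cell_antiperiodic[where a = a]) auto
  qed
  then show "(\<integral>x. indicator cell x * cos (2 * pi * (w \<bullet> x)) \<partial>lborel) = (if w = 0 then 1 else 0)"
    "(\<integral>x. indicator cell x * sin (2 * pi * (w \<bullet> x)) \<partial>lborel) = 0"
    by (cases "w = 0"; simp del: Bochner_Integration.integral_indicator)+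
qed

text \<open>Product-to-sum formulas leave single characters of frequencies \<open>u - w\<close> and
  \<open>u + w\<close>. The two indicators are added, not taken as alternatives, because both equal
  1 when \<open>u = w = 0\<close>.\<close>

lemma
  assumes u: "u \<in> dual_lattice V" and w: "w \<in> dual_lattice V"
  shows integral_cell_cos_cos: "(\<integral>x. indicator cell x * (cos (2 * pi * (u \<bullet> x)) * cos (2 * pi * (w \<bullet> x))) \<partial>lborel)
      = ((if u = w then 1 else 0) + (if u = - w then 1 else 0)) / 2"
    and integral_cell_cos_sin: "(\<integral>x. indicator cell x * (cos (2 * pi * (u \<bullet> x)) * sin (2 * pi * (w \<bullet> x))) \<partial>lborel) = 0"
proof -
  have int: "integrable lborel (\<lambda>x. indicator cell x * cos (2 * pi * (v \<bullet> x)))"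
    "integrable lborel (\<lambda>x. indicator cell x * sin (2 * pi * (v \<bullet> x)))" for v
    by (intro integrable_cell_continuous continuous_intros)+
  have 1: "indicator cell x * (cos (2 * pi * (u \<bullet> x)) * cos (2 * pi * (w \<bullet> x))) =
    (indicator cell x * cos (2 * pi * ((u - w) \<bullet> x)) + indicator cell x * cos (2 * pi * ((u + w) \<bullet> x))) / 2" for x
    by (simp add: inner_add_left inner_diff_left distrib_left right_diff_distrib cos_add cos_diff)
  have 2: "indicator cell x * (cos (2 * pi * (u \<bullet> x)) * sin (2 * pi * (w \<bullet> x))) =
    (indicator cell x * sin (2 * pi * ((u + w) \<bullet> x)) - indicator cell x * sin (2 * pi * ((u - w) \<bullet> x))) / 2" for x
    by (simp add: inner_add_left inner_diff_left distrib_left right_diff_distrib sin_add sin_diff)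
  note d = dual_lattice_add[OF u w] dual_lattice_diff[OF u w]
  show "(\<integral>x. indicator cell x * (cos (2 * pi * (u \<bullet> x)) * cos (2 * pi * (w \<bullet> x))) \<partial>lborel)
      = ((if u = w then 1 else 0) + (if u = - w then 1 else 0)) / 2"
    unfolding 1 using int by (simp add: integral_cell_cos d eq_neg_iff_add_eq_0)
  show "(\<integral>x. indicator cell x * (cos (2 * pi * (u \<bullet> x)) * sin (2 * pi * (w \<bullet> x))) \<partial>lborel) = 0"
    unfolding 2 using int by (simp add: integral_cell_sin d)
qed

text \<open>The terms at \<open>w\<close> and \<open>- w\<close> each contribute half a coefficient,
  and evenness of \<open>c\<close> makes them add up to \<open>c w\<close>. The sine coefficients
  vanish term by term.\<close>

lemma
  fixes c :: "real^'n \<Rightarrow> real"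
  assumes c0: "\<And>u. 0 \<le> c u" and c: "c summable_on dual_lattice V" and cm: "\<And>u. c (- u) = c u"
    and w: "w \<in> dual_lattice V"
  shows cosine_series_cos_coeff: 
      "(\<integral>x. indicator cell x * ((\<Sum>\<^sub>\<infinity>u\<in>dual_lattice V. c u * cos (2 * pi * (u \<bullet> x))) * cos (2 * pi * (w \<bullet> x))) \<partial>lborel) = c w"
    and cosine_series_sin_coeff:
      "(\<integral>x. indicator cell x * ((\<Sum>\<^sub>\<infinity>u\<in>dual_lattice V. c u * cos (2 * pi * (u \<bullet> x))) * sin (2 * pi * (w \<bullet> x))) \<partial>lborel) = 0"
proof -
  have main: "((\<lambda>u. c u * (\<integral>x. indicator cell x * (cos (2 * pi * (u \<bullet> x)) * h x) \<partial>lborel)) has_sum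
     (\<integral>x. indicator cell x * ((\<Sum>\<^sub>\<infinity>u\<in>dual_lattice V. c u * cos (2 * pi * (u \<bullet> x))) * h x) \<partial>lborel)) (dual_lattice V)"
    if hc: "continuous_on UNIV h" and h1: "\<And>x. \<bar>h x\<bar> \<le> 1" for h :: "real^'n \<Rightarrow> real"
  proof -
    let ?f = "\<lambda>u x. c u * (indicator cell x * (cos (2 * pi * (u \<bullet> x)) * h x))"
    have int: "integrable lborel (?f u)" for u
      by (intro integrable_mult_right integrable_cell_continuous continuous_intros hc)
    have le: "\<bar>cos (2 * pi * (u \<bullet> x)) * h x\<bar> \<le> 1" for u x
      unfolding abs_mult using h1[of x] by (intro mult_le_one) auto
    have bd: "\<bar>?f u x\<bar> \<le> c u * indicator cell x" for u x
      using mult_left_mono[OF le c0] c0 by (auto simp: abs_mult indicator_def)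
    have S: "(\<lambda>u. \<integral>x. \<bar>?f u x\<bar> \<partial>lborel) summable_on dual_lattice V"
    proof (rule summable_on_comparison_test[OF c])
      fix u
      have "(\<integral>x. \<bar>?f u x\<bar> \<partial>lborel) \<le> (\<integral>x. c u * indicator cell x \<partial>lborel)"
        by (intro integral_mono integrable_abs int integrable_mult_right integrable_cell bd)
      then show "(\<integral>x. \<bar>?f u x\<bar> \<partial>lborel) \<le> c u" by (simp only: integral_mult_right_zero integral_cell mult_1_right)
    qed simp
    have pt: "(\<lambda>u. \<bar>?f u x\<bar>) summable_on dual_lattice V" for x
      by (rule summable_on_comparison_test[OF summable_on_cmult_left[OF c, of "indicator cell x"] bd]) simp
    have eq: "(\<Sum>\<^sub>\<infinity>u\<in>dual_lattice V. ?f u x) =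
      indicator cell x * ((\<Sum>\<^sub>\<infinity>u\<in>dual_lattice V. c u * cos (2 * pi * (u \<bullet> x))) * h x)" for x
      by (subst infsum_cmult_left'[symmetric], subst infsum_cmult_right'[symmetric])
         (simp add: mult_ac)
    show ?thesis
      using has_sum_integral[OF countable_dual int S pt] unfolding eq by simp
  qed
  have "((\<lambda>u. c u * (((if u = w then 1 else 0) + (if u = - w then 1 else 0)) / 2)) has_sum
     (\<integral>x. indicator cell x * ((\<Sum>\<^sub>\<infinity>u\<in>dual_lattice V. c u * cos (2 * pi * (u \<bullet> x))) * cos (2 * pi * (w \<bullet> x))) \<partial>lborel)) (dual_lattice V)"
    by (rule has_sum_cong[THEN iffD1, rotated, OF main])
       (auto intro!: continuous_intros simp: integral_cell_cos_cos w)
  moreover have "((\<lambda>u. (if u = w then c w / 2 else 0) + (if u = - w then c w / 2 else 0)) has_sum (c w / 2 + c w / 2)) (dual_lattice V)"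
    by (intro has_sum_add has_sum_single w dual_lattice_uminus)
  moreover have "(if u = w then c w / 2 else 0) + (if u = - w then c w / 2 else 0) =
      c u * (((if u = w then 1 else 0) + (if u = - w then 1 else 0)) / 2)" for u
    using cm by auto
  ultimately show "(\<integral>x. indicator cell x * ((\<Sum>\<^sub>\<infinity>u\<in>dual_lattice V. c u * cos (2 * pi * (u \<bullet> x))) * cos (2 * pi * (w \<bullet> x))) \<partial>lborel) = c w"
    using has_sum_unique by fastforce
  have "((\<lambda>u. 0) has_sum
     (\<integral>x. indicator cell x * ((\<Sum>\<^sub>\<infinity>u\<in>dual_lattice V. c u * cos (2 * pi * (u \<bullet> x))) * sin (2 * pi * (w \<bullet> x))) \<partial>lborel)) (dual_lattice V)"
    by (rule has_sum_cong[THEN iffD1, rotated, OF main])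
       (auto intro!: continuous_intros simp: integral_cell_cos_sin w)
  then show "(\<integral>x. indicator cell x * ((\<Sum>\<^sub>\<infinity>u\<in>dual_lattice V. c u * cos (2 * pi * (u \<bullet> x))) * sin (2 * pi * (w \<bullet> x))) \<partial>lborel) = 0"
    using has_sum_unique[OF _ has_sum_0] by blast
qed

lemma summable_far_integrand:
  assumes t: "t > 0"
  shows "(\<lambda>w. far_integrand w t) summable_on dual_lattice V"
proof -
  have "(\<lambda>w::real^'n. pi powr (real CARD('n) / 2) / t powr (real CARD('n) / 2) * exp (- (pi\<^sup>2 / t) * (norm w)\<^sup>2)) summable_on dual_lattice V"
    using t by (intro summable_on_cmult_right summable_gaussian_dual) simp
  then show ?thesis by (simp add: far_integrand_def)
qed

lemma continuous_theta:
  assumes t: "t > 0"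
  shows "continuous_on UNIV (\<lambda>x. \<Sum>\<^sub>\<infinity>v\<in>lattice V. exp (- t * (norm (x + v))\<^sup>2))"
proof (rule continuous_on_infsum)
  fix z :: "real^'n"
  let ?M = "\<lambda>v. exp (t * (norm z + 1)\<^sup>2) * exp (- (t / 2) * (norm v)\<^sup>2)"
  have "\<bar>exp (- t * (norm (x + v))\<^sup>2)\<bar> \<le> ?M v" if x: "x \<in> ball z 1" for v x
  proof -
    have "norm x \<le> norm z + 1" using x norm_triangle_ineq2[of x z] by (simp add: dist_norm norm_minus_commute)
    then have "exp (t * (norm x)\<^sup>2) \<le> exp (t * (norm z + 1)\<^sup>2)"
      using t by (auto intro!: mult_left_mono power_mono)
    then have "exp (t * (norm x)\<^sup>2) * exp (- (t / 2) * (norm v)\<^sup>2) \<le> ?M v"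
      by (rule mult_right_mono) simp
    with exp_neg_norm_sq_shift[of t x v] t have "exp (- t * (norm (x + v))\<^sup>2) \<le> ?M v"
      by (intro order_trans[OF exp_neg_norm_sq_shift]) simp_all
    then show ?thesis by simp
  qed
  moreover have "?M summable_on lattice V"
    using t by (intro summable_on_cmult_right summable_gaussian) simp
  ultimately show "\<exists>M. M summable_on lattice V \<and> (\<forall>v\<in>lattice V. \<forall>x\<in>ball z 1. \<bar>exp (- t * (norm (x + v))\<^sup>2)\<bar> \<le> M v)"
    by blast
qed (intro continuous_intros)

lemma continuous_cosine_series:
  fixes c :: "real^'n \<Rightarrow> real"
  assumes c: "(\<lambda>u. \<bar>c u\<bar>) summable_on A"
  shows "continuous_on UNIV (\<lambda>x. \<Sum>\<^sub>\<infinity>u\<in>A. c u * cos (2 * pi * (u \<bullet> x)))"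
proof (rule continuous_on_infsum)
  show "\<exists>M. M summable_on A \<and> (\<forall>u\<in>A. \<forall>x\<in>ball z 1. \<bar>c u * cos (2 * pi * (u \<bullet> x))\<bar> \<le> M u)" for z
    by (intro exI[of _ "\<lambda>u. \<bar>c u\<bar>"] conjI c) (auto simp: abs_mult intro!: mult_left_le)
qed (intro continuous_intros)

theorem theta_transformation:
  assumes t: "t > 0"
  shows "(\<Sum>\<^sub>\<infinity>v\<in>lattice V. exp (- t * (norm (z + v))\<^sup>2)) =
    (\<Sum>\<^sub>\<infinity>w\<in>dual_lattice V. far_integrand w t * cos (2 * pi * (w \<bullet> z)))"
proof -
  let ?T = "\<lambda>x. \<Sum>\<^sub>\<infinity>v\<in>lattice V. exp (- t * (norm (x + v))\<^sup>2)"
  let ?H = "\<lambda>x. \<Sum>\<^sub>\<infinity>w\<in>dual_lattice V. far_integrand w t * cos (2 * pi * (w \<bullet> x))"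
  note c = far_integrand_nonneg summable_far_integrand[OF t] far_integrand_minus
  have T: "continuous_on UNIV ?T" by (rule continuous_theta[OF t])
  have H: "continuous_on UNIV ?H"
    using c(2) by (intro continuous_cosine_series) (simp add: far_integrand_nonneg)
  have Tp: "?T (x + v) = ?T x" if "v \<in> lattice V" for v x
    using infsum_reindex_bij_betw[OF bij_lattice_add[OF that], of "\<lambda>u. exp (- t * (norm (x + u))\<^sup>2)"]
    by (simp add: add_ac)
  have Hp: "?H (x + v) = ?H x" if "v \<in> lattice V" for v x
    by (rule infsum_cong) (simp add: cos_dual_periodic that)
  have gint: "integrable lborel (\<lambda>x::real^'n. exp (- t * (norm x)\<^sup>2))" by (rule integrable_gaussian[OF t])
  have gs: "(\<lambda>v. \<bar>exp (- t * (norm (x + v))\<^sup>2)\<bar>) summable_on lattice V" for x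
    using summable_gaussian_shift[OF t] by simp
  have diff: "(\<integral>x. indicator cell x * ((?T x - ?H x) * h x) \<partial>lborel) =
      (\<integral>x. indicator cell x * (?T x * h x) \<partial>lborel) - (\<integral>x. indicator cell x * (?H x * h x) \<partial>lborel)"
    if "continuous_on UNIV h" for h :: "real^'n \<Rightarrow> real"
    using integrable_cell_continuous[OF continuous_on_mult[OF T that]]
      integrable_cell_continuous[OF continuous_on_mult[OF H that]]
    by (subst Bochner_Integration.integral_diff[symmetric]) (auto simp: algebra_simps)
  have "?T z - ?H z = 0"
  proof (rule periodic_zero_of_coefficients)
    show "continuous_on UNIV (\<lambda>x. ?T x - ?H x)" using T H by (rule continuous_on_diff)
    show "?T (x + v) - ?H (x + v) = ?T x - ?H x" if "v \<in> lattice V" for v x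
      by (simp only: Tp[OF that] Hp[OF that])
    fix w assume w: "w \<in> dual_lattice V"
    have cw: "continuous_on UNIV (\<lambda>x. cos (2 * pi * (w \<bullet> x)))" "continuous_on UNIV (\<lambda>x. sin (2 * pi * (w \<bullet> x)))"
      by (intro continuous_intros)+
    \<comment> \<open>After unfolding, this coefficient is the Fourier transform of the Gaussian at
      \<open>w\<close>.\<close>
    have "(\<integral>x. indicator cell x * (?T x * cos (2 * pi * (w \<bullet> x))) \<partial>lborel) = far_integrand w t"
      using has_bochner_integral_gaussian_cos[OF t, of w] w
      by (subst integral_periodization[OF gint gs])
         (auto simp: cos_dual_periodic has_bochner_integral_iff)
    then show "(\<integral>x. indicator cell x * ((?T x - ?H x) * cos (2 * pi * (w \<bullet> x))) \<partial>lborel) = 0"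
      unfolding diff[OF cw(1)] by (simp only: cosine_series_cos_coeff[OF c w] diff_self)
    have "(\<integral>x. indicator cell x * (?T x * sin (2 * pi * (w \<bullet> x))) \<partial>lborel) = 0"
      using has_bochner_integral_gaussian_sin[OF t, of w] w
      by (subst integral_periodization[OF gint gs])
         (auto simp: sin_dual_periodic has_bochner_integral_iff)
    then show "(\<integral>x. indicator cell x * ((?T x - ?H x) * sin (2 * pi * (w \<bullet> x))) \<partial>lborel) = 0"
      unfolding diff[OF cw(2)] by (simp only: cosine_series_sin_coeff[OF c w] diff_self)
  qed
  then show ?thesis by simp
qed

end

section \<open>Variations of a signed measure\<close>

lemma space_halfline [simp]: "space halfline = {0<..}"
  by (simp add: halfline_def space_restrict_space)

lemma sets_pos_part [simp]: "sets (pos_part \<mu>) = sets halfline"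
  and space_pos_part [simp]: "space (pos_part \<mu>) = {0<..}"
  and sets_neg_part [simp]: "sets (neg_part \<mu>) = sets halfline"
  and space_neg_part [simp]: "space (neg_part \<mu>) = {0<..}"
  using sets.sigma_sets_eq[of halfline] sets.space_closed[of halfline]
  by (simp_all add: pos_part_def neg_part_def)

text \<open>\<open>measure_of\<close> attains its prescribed values only once they are known to be
  countably additive, so the set function is studied on its own first.\<close>

definition upper_variation :: "(real set \<Rightarrow> ereal) \<Rightarrow> real set \<Rightarrow> ennreal" where
  "upper_variation \<mu> A = (SUP B\<in>{B \<in> sets halfline. B \<subseteq> A}. e2ennreal (\<mu> B))"

lemma e2ennreal_le_upper_variation:
  "B \<in> sets halfline \<Longrightarrow> B \<subseteq> A \<Longrightarrow> e2ennreal (\<mu> B) \<le> upper_variation \<mu> A"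
  unfolding upper_variation_def by (rule SUP_upper) auto

lemma le_enn2ereal_upper_variation:
  assumes "B \<in> sets halfline" "B \<subseteq> A"
  shows "\<mu> B \<le> enn2ereal (upper_variation \<mu> A)"
proof -
  have "\<mu> B \<le> enn2ereal (e2ennreal (\<mu> B))"
    by (cases "0 \<le> \<mu> B") (auto simp: enn2ereal_e2ennreal intro: order_trans[of _ 0])
  also have "\<dots> \<le> enn2ereal (upper_variation \<mu> A)"
    using e2ennreal_le_upper_variation[OF assms] by (simp add: less_eq_ennreal.rep_eq)
  finally show ?thesis .
qed

lemma enn2ereal_sum: "enn2ereal (sum f A) = (\<Sum>i\<in>A. enn2ereal (f i))"
  by (induction A rule: infinite_finite_induct) (auto simp: plus_ennreal.rep_eq zero_ennreal.rep_eq)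

lemma signed_measure_additive:
  assumes \<mu>: "signed_measure \<mu>" and A: "A \<in> sets halfline" "B \<in> sets halfline" "A \<inter> B = {}"
  shows "\<mu> (A \<union> B) = \<mu> A + \<mu> B"
proof -
  have "range (binaryset A B) \<subseteq> sets halfline" "disjoint_family (binaryset A B)"
    using A by (auto simp: range_binaryset_eq disjoint_family_on_def binaryset_def)
  then have "(\<lambda>i. \<mu> (binaryset A B i)) sums \<mu> (\<Union>i. binaryset A B i)"
    using \<mu> unfolding signed_measure_def by blast
  moreover have "(\<lambda>i. \<mu> (binaryset A B i)) sums (\<mu> A + \<mu> B)"
    using \<mu> by (intro binaryset_sums) (simp add: signed_measure_def)
  ultimately show ?thesis by (auto simp: UN_binaryset_eq dest: sums_unique2)
qed

lemma upper_variation_mono: "A \<subseteq> B \<Longrightarrow> upper_variation \<mu> A \<le> upper_variation \<mu> B"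
  unfolding upper_variation_def by (rule SUP_subset_mono) auto

text \<open>Competitors for \<open>A\<close> and \<open>B\<close> unite to one for the union. If
  \<mu> is nonpositive on one of them, its truncated value is 0 and the other serves alone.\<close>

lemma upper_variation_superadditive:
  assumes \<mu>: "signed_measure \<mu>" and AB: "A \<inter> B = {}"
  shows "upper_variation \<mu> A + upper_variation \<mu> B \<le> upper_variation \<mu> (A \<union> B)"
proof -
  have 1: "e2ennreal (\<mu> C) + e2ennreal (\<mu> D) \<le> upper_variation \<mu> (A \<union> B)"
    if C: "C \<in> sets halfline" "C \<subseteq> A" and D: "D \<in> sets halfline" "D \<subseteq> B" for C D
  proof -
    have "C \<inter> D = {}" using C D AB by auto
    then have add: "\<mu> (C \<union> D) = \<mu> C + \<mu> D" using C D by (intro signed_measure_additive \<mu>) auto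
    consider "0 \<le> \<mu> C" "0 \<le> \<mu> D" | "\<mu> C \<le> 0" | "\<mu> D \<le> 0" by force
    then show ?thesis
    proof cases
      case 1
      then have "e2ennreal (\<mu> C) + e2ennreal (\<mu> D) = e2ennreal (\<mu> (C \<union> D))"
        by (simp add: add plus_ennreal.abs_eq eq_onp_same_args)
      also have "\<dots> \<le> upper_variation \<mu> (A \<union> B)" using C D by (intro e2ennreal_le_upper_variation) auto
      finally show ?thesis .
    next
      case 2
      then have "e2ennreal (\<mu> C) = 0" by (simp add: e2ennreal_neg)
      then show ?thesis using D by (auto intro!: e2ennreal_le_upper_variation)
    next
      case 3
      then have "e2ennreal (\<mu> D) = 0" by (simp add: e2ennreal_neg)
      then show ?thesis using C by (auto intro!: e2ennreal_le_upper_variation)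
    qed
  qed
  let ?S = "\<lambda>A. {B \<in> sets halfline. B \<subseteq> A}"
  have ne: "?S A \<noteq> {}" for A by (auto intro: exI[of _ "{}"])
  have "e2ennreal (\<mu> C) + upper_variation \<mu> B \<le> upper_variation \<mu> (A \<union> B)" if "C \<in> ?S A" for C
    unfolding upper_variation_def[of \<mu> B] ennreal_SUP_add_right[OF ne]
    using 1 that by (intro SUP_least) auto
  then show ?thesis
    unfolding upper_variation_def[of \<mu> A] ennreal_SUP_add_left[OF ne, symmetric]
    by (intro SUP_least)
qed

lemma upper_variation_empty: "signed_measure \<mu> \<Longrightarrow> upper_variation \<mu> {} = 0"
proof -
  assume "signed_measure \<mu>"
  then have "\<mu> {} = 0" by (simp add: signed_measure_def)
  moreover have "{B \<in> sets halfline. B \<subseteq> {}} = {{}}" by auto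
  ultimately show ?thesis by (simp add: upper_variation_def)
qed

text \<open>Superadditivity gives one inequality. For the other, a competitor for the union is cut
  along the \<open>A i\<close>, and each piece competes for its own \<open>A i\<close>. No Hahn
  decomposition enters.\<close>

lemma countably_additive_upper_variation:
  assumes \<mu>: "signed_measure \<mu>"
  shows "countably_additive (sets halfline) (upper_variation \<mu>)"
proof (rule countably_additiveI)
  fix A :: "nat \<Rightarrow> real set"
  assume A: "range A \<subseteq> sets halfline" "disjoint_family A" "(\<Union>i. A i) \<in> sets halfline"
  have fin: "(\<Sum>i<n. upper_variation \<mu> (A i)) \<le> upper_variation \<mu> (\<Union>i<n. A i)" for n
  proof (induction n)
    case (Suc n)
    have "(\<Union>i<n. A i) \<inter> A n = {}"
      using A(2) unfolding disjoint_family_on_def by (fastforce dest: less_imp_neq)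
    note sup = upper_variation_superadditive[OF \<mu> this]
    have "(\<Sum>i<Suc n. upper_variation \<mu> (A i)) = (\<Sum>i<n. upper_variation \<mu> (A i)) + upper_variation \<mu> (A n)"
      by simp
    also have "\<dots> \<le> upper_variation \<mu> (\<Union>i<n. A i) + upper_variation \<mu> (A n)"
      by (rule add_right_mono[OF Suc])
    also note sup
    also have "(\<Union>i<n. A i) \<union> A n = (\<Union>i<Suc n. A i)" by (auto simp: lessThan_Suc)
    finally show ?case .
  qed simp
  show "(\<Sum>i. upper_variation \<mu> (A i)) = upper_variation \<mu> (\<Union>i. A i)"
  proof (rule antisym)
    show "(\<Sum>i. upper_variation \<mu> (A i)) \<le> upper_variation \<mu> (\<Union>i. A i)"
    proof (rule suminf_le_const)
      show "(\<Sum>i<n. upper_variation \<mu> (A i)) \<le> upper_variation \<mu> (\<Union>i. A i)" for n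
        by (rule order_trans[OF fin upper_variation_mono]) auto
    qed simp
    show "upper_variation \<mu> (\<Union>i. A i) \<le> (\<Sum>i. upper_variation \<mu> (A i))"
      unfolding upper_variation_def[of \<mu> "\<Union>i. A i"]
    proof (rule SUP_least)
      fix B assume B: "B \<in> {B \<in> sets halfline. B \<subseteq> (\<Union>i. A i)}"
      have Un: "(\<Union>i. B \<inter> A i) = B" using B by auto
      have "(\<lambda>i. \<mu> (B \<inter> A i)) sums \<mu> (\<Union>i. B \<inter> A i)"
      proof -
        have "range (\<lambda>i. B \<inter> A i) \<subseteq> sets halfline" using A(1) B by auto
        moreover have "disjoint_family (\<lambda>i. B \<inter> A i)" using A(2) by (auto simp: disjoint_family_on_def)
        ultimately show ?thesis using \<mu> unfolding signed_measure_def by blast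
      qed
      then have lim: "(\<lambda>n. \<Sum>i<n. \<mu> (B \<inter> A i)) \<longlonglongrightarrow> \<mu> B" unfolding Un sums_def .
      have "\<mu> B \<le> enn2ereal (\<Sum>i. upper_variation \<mu> (A i))"
      proof (rule LIMSEQ_le_const2[OF lim], intro exI allI impI)
        fix n
        have "(\<Sum>i<n. \<mu> (B \<inter> A i)) \<le> (\<Sum>i<n. enn2ereal (upper_variation \<mu> (A i)))"
          using A(1) B by (intro sum_mono le_enn2ereal_upper_variation) auto
        also have "\<dots> = enn2ereal (\<Sum>i<n. upper_variation \<mu> (A i))" by (rule enn2ereal_sum[symmetric])
        also have "\<dots> \<le> enn2ereal (\<Sum>i. upper_variation \<mu> (A i))"
          unfolding less_eq_ennreal.rep_eq[symmetric] by (rule sum_le_suminf) auto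
        finally show "(\<Sum>i<n. \<mu> (B \<inter> A i)) \<le> enn2ereal (\<Sum>i. upper_variation \<mu> (A i))" .
      qed
      then have "e2ennreal (\<mu> B) \<le> e2ennreal (enn2ereal (\<Sum>i. upper_variation \<mu> (A i)))"
        by (rule e2ennreal_mono)
      then show "e2ennreal (\<mu> B) \<le> (\<Sum>i. upper_variation \<mu> (A i))" by (simp add: e2ennreal_enn2ereal)
    qed
  qed
qed

lemma emeasure_pos_part:
  assumes "signed_measure \<mu>" "A \<in> sets halfline"
  shows "emeasure (pos_part \<mu>) A = upper_variation \<mu> A"
proof -
  have eq: "pos_part \<mu> = measure_of {0<..} (sets halfline) (upper_variation \<mu>)"
    unfolding pos_part_def upper_variation_def[abs_def] by (rule refl)
  have "sigma_algebra {0<..} (sets halfline)"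
    using sets.sigma_algebra_axioms[of halfline] by simp
  moreover have "positive (sets halfline) (upper_variation \<mu>)"
    using assms by (simp add: positive_def upper_variation_empty)
  ultimately show ?thesis
    unfolding eq using countably_additive_upper_variation[OF assms(1)] assms(2)
    by (rule emeasure_measure_of_sigma)
qed

lemma signed_measure_uminus:
  assumes \<mu>: "signed_measure \<mu>"
  shows "signed_measure (\<lambda>A. - \<mu> A)"
  unfolding signed_measure_def
proof (intro conjI allI impI)
  show "- \<mu> {} = 0" using \<mu> by (simp add: signed_measure_def)
  show "(\<forall>A\<in>sets halfline. - \<mu> A \<noteq> - \<infinity>) \<or> (\<forall>A\<in>sets halfline. - \<mu> A \<noteq> \<infinity>)"
    using \<mu> by (auto simp: signed_measure_def ereal_uminus_eq_reorder)
  fix A :: "nat \<Rightarrow> real set" assume A: "range A \<subseteq> sets halfline" "disjoint_family A"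
  have "(\<lambda>i. \<mu> (A i)) sums \<mu> (\<Union>i. A i)" using \<mu> A unfolding signed_measure_def by blast
  then have "(\<lambda>n. - (\<Sum>i<n. \<mu> (A i))) \<longlonglongrightarrow> - \<mu> (\<Union>i. A i)"
    unfolding sums_def by (rule tendsto_uminus_ereal)
  moreover have "- (\<Sum>i<n. \<mu> (A i)) = (\<Sum>i<n. - \<mu> (A i))" for n
  proof -
    have fin: "(\<forall>i. \<mu> (A i) \<noteq> -\<infinity>) \<or> (\<forall>i. \<mu> (A i) \<noteq> \<infinity>)"
      using \<mu> A(1) unfolding signed_measure_def by blast
    \<comment> \<open>Negation commutes with addition of extended reals except at opposite
      infinities; the induction therefore also records that the partial sums avoid an infinity which
      all terms avoid.\<close>
    have "(- (\<Sum>i<n. \<mu> (A i)) = (\<Sum>i<n. - \<mu> (A i))) \<and>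
       ((\<forall>i. \<mu> (A i) \<noteq> -\<infinity>) \<longrightarrow> (\<Sum>i<n. \<mu> (A i)) \<noteq> -\<infinity>) \<and> ((\<forall>i. \<mu> (A i) \<noteq> \<infinity>) \<longrightarrow> (\<Sum>i<n. \<mu> (A i)) \<noteq> \<infinity>)"
    proof (induction n)
      case (Suc n)
      have neg: "- (a + b) = - a + - b" if "(a \<noteq> -\<infinity> \<and> b \<noteq> -\<infinity>) \<or> (a \<noteq> \<infinity> \<and> b \<noteq> \<infinity>)" for a b :: ereal
        using that by (cases a; cases b) auto
      show ?case using Suc fin by (auto simp: neg)
    qed simp
    then show ?thesis by blast
  qed
  ultimately show "(\<lambda>i. - \<mu> (A i)) sums - \<mu> (\<Union>i. A i)" unfolding sums_def by simp
qed

lemma neg_part_eq: "neg_part \<mu> = pos_part (\<lambda>A. - \<mu> A)"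
  by (simp add: neg_part_def pos_part_def)

text \<open>With \<open>\<mu> A = a\<close> finite, \<open>\<mu> B = a - \<mu> (A - B)\<close> for
  every measurable \<open>B \<subseteq> A\<close>, so passing to complements exchanges the
  competitors of the two suprema. This gives \<open>P \<le> a + N\<close> and
  \<open>N \<le> P - a\<close> for the two variations \<open>P\<close> and \<open>N\<close> of
  \<open>A\<close>.\<close>

theorem jordan_decomposition:
  assumes \<mu>: "signed_measure \<mu>" and fin: "finite_measure (neg_part \<mu>)"
    and A: "A \<in> sets halfline" "\<bar>\<mu> A\<bar> \<noteq> \<infinity>"
  shows "\<mu> A = enn2ereal (emeasure (pos_part \<mu>) A) - enn2ereal (emeasure (neg_part \<mu>) A)"
proof -
  let ?P = "emeasure (pos_part \<mu>) A" and ?N = "emeasure (neg_part \<mu>) A"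
  have P: "?P = upper_variation \<mu> A" by (rule emeasure_pos_part[OF \<mu> A(1)])
  have N: "?N = upper_variation (\<lambda>A. - \<mu> A) A"
    unfolding neg_part_eq by (rule emeasure_pos_part[OF signed_measure_uminus[OF \<mu>] A(1)])
  obtain n where n: "?N = ennreal n" "n \<ge> 0"
    using finite_measure.emeasure_finite[OF fin, of A] by (metis ennreal_cases infinity_ennreal_def)
  obtain a where a: "\<mu> A = ereal a" using A(2) by (cases "\<mu> A") auto
  \<comment> \<open>Finiteness of the lower variation excludes the value -\<infinity> on subsets, so
    additivity can be solved for real values.\<close>
  have low: "- \<mu> B \<le> ereal n" if "B \<in> sets halfline" "B \<subseteq> A" for B
    using le_enn2ereal_upper_variation[of B A "\<lambda>A. - \<mu> A"] that n N by (simp add: ennreal.rep_eq enn2ereal_ennreal)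
  have split: "\<exists>b. \<mu> B = ereal b \<and> \<mu> (A - B) = ereal (a - b)" if B: "B \<in> sets halfline" "B \<subseteq> A" for B
  proof -
    have "A = B \<union> (A - B)" using B by auto
    then have "\<mu> A = \<mu> B + \<mu> (A - B)"
      using signed_measure_additive[OF \<mu> B(1), of "A - B"] A(1) B by (metis Diff_disjoint sets.Diff)
    moreover have "\<mu> B \<noteq> -\<infinity>" "\<mu> (A - B) \<noteq> -\<infinity>"
      using low[of B] low[of "A - B"] A(1) B by auto
    ultimately show ?thesis using a by (cases "\<mu> B"; cases "\<mu> (A - B)") auto
  qed
  have "?P \<le> ennreal (a + n)"
    unfolding P upper_variation_def
  proof (rule SUP_least)
    fix B assume B: "B \<in> {B \<in> sets halfline. B \<subseteq> A}"
    then obtain b where b: "\<mu> B = ereal b" "\<mu> (A - B) = ereal (a - b)" using split by blast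
    have "b \<le> a + n" using low[of "A - B"] A(1) B b by auto
    then show "e2ennreal (\<mu> B) \<le> ennreal (a + n)" by (simp add: b ennreal_def[symmetric] ennreal_leI e2ennreal_ereal)
  qed
  moreover have an: "a + n \<ge> 0"
    using low[of A] a A(1) by auto
  ultimately obtain p where p: "?P = ennreal p" "p \<ge> 0" "p \<le> a + n"
    by (metis ennreal_cases ennreal_le_iff ennreal_less_top leD top.not_eq_extremum)
  have pa: "b \<le> p" if "B \<in> sets halfline" "B \<subseteq> A" "\<mu> B = ereal b" for B b
    using le_enn2ereal_upper_variation[of B A \<mu>] that p P by (simp add: enn2ereal_ennreal)
  have "?N \<le> ennreal (p - a)"
    unfolding N upper_variation_def
  proof (rule SUP_least)
    fix B assume B: "B \<in> {B \<in> sets halfline. B \<subseteq> A}"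
    then obtain b where b: "\<mu> B = ereal b" "\<mu> (A - B) = ereal (a - b)" using split by blast
    have "- b \<le> p - a" using pa[of "A - B" "a - b"] A(1) B b by auto
    then show "e2ennreal (- \<mu> B) \<le> ennreal (p - a)" by (simp add: b ennreal_leI e2ennreal_ereal)
  qed
  moreover have "p - a \<ge> 0" using pa[of A a] A a by auto
  ultimately have "n \<le> p - a" using n by (simp add: ennreal_le_iff)
  then have "p - n = a" using p by simp
  then show ?thesis using p n a by (simp add: enn2ereal_ennreal)
qed

section \<open>Integrals against a signed measure\<close>

lemma measurable_halflineI:
  assumes "sets Q = sets halfline" "h \<in> borel_measurable borel"
  shows "h \<in> borel_measurable Q"
  using assms(2) unfolding measurable_cong_sets[OF assms(1) refl] halfline_def by (rule measurable_restrict_space1)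

definition set_integral_diff :: "(real set \<Rightarrow> ereal) \<Rightarrow> real set \<Rightarrow> (real \<Rightarrow> real) \<Rightarrow> real" where
  "set_integral_diff \<mu> A h = (\<integral>t. indicator A t * h t \<partial>pos_part \<mu>) - (\<integral>t. indicator A t * h t \<partial>neg_part \<mu>)"

lemma integrable_of_nn_integral:
  fixes h :: "real \<Rightarrow> real"
  assumes Q: "sets Q = sets halfline" and h: "h \<in> borel_measurable borel" and A: "A \<in> sets borel"
    and h0: "\<And>t. t \<in> A \<Longrightarrow> 0 \<le> h t" and fin: "(\<integral>\<^sup>+t\<in>A. ennreal (h t) \<partial>Q) < \<infinity>"
  shows "integrable Q (\<lambda>t. indicator A t * h t)"
proof (rule integrableI_nonneg)
  note h [measurable] A [measurable]
  have "(\<lambda>t. indicator A t * h t) \<in> borel_measurable borel" by measurable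
  then show "(\<lambda>t. indicator A t * h t) \<in> borel_measurable Q" by (rule measurable_halflineI[OF Q])
  show "AE t in Q. 0 \<le> indicator A t * h t" using h0 by (auto simp: indicator_def)
  have "(\<integral>\<^sup>+t. ennreal (indicator A t * h t) \<partial>Q) = (\<integral>\<^sup>+t\<in>A. ennreal (h t) \<partial>Q)"
    by (rule nn_integral_cong) (auto simp: indicator_def)
  then show "(\<integral>\<^sup>+t. ennreal (indicator A t * h t) \<partial>Q) < \<infinity>" using fin by simp
qed

lemma set_nn_integral_eq_integral:
  fixes h :: "real \<Rightarrow> real"
  assumes h0: "\<And>t. t \<in> A \<Longrightarrow> 0 \<le> h t" and int: "integrable Q (\<lambda>t. indicator A t * h t)"
  shows "(\<integral>\<^sup>+t\<in>A. ennreal (h t) \<partial>Q) = ennreal (\<integral>t. indicator A t * h t \<partial>Q)"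
proof -
  have "(\<integral>\<^sup>+t. ennreal (indicator A t * h t) \<partial>Q) = ennreal (\<integral>t. indicator A t * h t \<partial>Q)"
    by (rule nn_integral_eq_integral[OF int]) (use h0 in \<open>auto simp: indicator_def\<close>)
  moreover have "(\<integral>\<^sup>+t. ennreal (indicator A t * h t) \<partial>Q) = (\<integral>\<^sup>+t\<in>A. ennreal (h t) \<partial>Q)"
    by (rule nn_integral_cong) (auto simp: indicator_def)
  ultimately show ?thesis by simp
qed

lemma signed_integral_eq:
  assumes h0: "\<And>t. t \<in> A \<Longrightarrow> 0 \<le> h t"
    and P: "integrable (pos_part \<mu>) (\<lambda>t. indicator A t * h t)"
    and N: "integrable (neg_part \<mu>) (\<lambda>t. indicator A t * h t)"
  shows "signed_integral \<mu> A h = ereal (set_integral_diff \<mu> A h)"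
proof -
  have "0 \<le> (\<integral>t. indicator A t * h t \<partial>Q)" for Q
    by (rule Bochner_Integration.integral_nonneg) (use h0 in \<open>auto simp: indicator_def\<close>)
  then show ?thesis
    using set_nn_integral_eq_integral[OF h0 P] set_nn_integral_eq_integral[OF h0 N]
    by (simp add: signed_integral_def set_integral_diff_def enn2ereal_ennreal)
qed

text \<open>An infinite positive part gives the value \<infinity> whatever is subtracted, since
  \<infinity> - \<infinity> = \<infinity> for extended reals.\<close>

lemma signed_integral_less_top_imp:
  assumes "signed_integral \<mu> A h < \<infinity>"
  shows "(\<integral>\<^sup>+t\<in>A. ennreal (h t) \<partial>pos_part \<mu>) < \<infinity>"
proof (rule ccontr)
  assume "\<not> ?thesis"
  then have "(\<integral>\<^sup>+t\<in>A. ennreal (h t) \<partial>pos_part \<mu>) = \<infinity>"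
    by (metis infinity_ennreal_def less_top)
  then show False using assms by (simp add: signed_integral_def)
qed

lemma integrable_halfline_bounded:
  fixes h :: "real \<Rightarrow> real"
  assumes Q: "sets Q = sets halfline" "finite_measure Q" and h: "h \<in> borel_measurable borel" and A: "A \<in> sets borel"
    and B: "\<And>t. t \<in> A \<Longrightarrow> \<bar>h t\<bar> \<le> B"
  shows "integrable Q (\<lambda>t. indicator A t * h t)"
proof (rule finite_measure.integrable_const_bound[OF Q(2), of _ "max B 0"])
  note h [measurable] A [measurable]
  show "AE t in Q. norm (indicator A t * h t) \<le> max B 0" using B by (auto simp: indicator_def intro: max.coboundedI1)
  have "(\<lambda>t. indicator A t * h t) \<in> borel_measurable borel" by measurable
  then show "(\<lambda>t. indicator A t * h t) \<in> borel_measurable Q" by (rule measurable_halflineI[OF Q(1)])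
qed

text \<open>Continuity in the rate is needed up to and including 0: for the positive part that is
  the point where the kernel may become infinite.\<close>

lemma tendsto_laplace_tail:
  assumes Q: "sets Q = sets halfline" and fin: "\<And>s. s > 0 \<Longrightarrow> (\<integral>\<^sup>+t\<in>{1..}. ennreal (exp (- s * t)) \<partial>Q) < \<infinity>"
    and u: "\<And>n. 0 \<le> u n" "u \<longlonglongrightarrow> s"
  shows "(\<lambda>n. \<integral>\<^sup>+t\<in>{1..}. ennreal (exp (- u n * t)) \<partial>Q) \<longlonglongrightarrow> (\<integral>\<^sup>+t\<in>{1..}. ennreal (exp (- s * t)) \<partial>Q)"
proof -
  have meas [measurable]: "(\<lambda>t. ennreal (exp (- s * t)) * indicator {1..} t) \<in> borel_measurable Q" for s
  proof -
    have "(\<lambda>t. ennreal (exp (- s * t)) * indicator {1..} t) \<in> borel_measurable borel" by measurable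
    then show ?thesis unfolding measurable_cong_sets[OF Q refl] halfline_def by (rule measurable_restrict_space1)
  qed
  have pt: "(\<lambda>n. ennreal (exp (- u n * t)) * indicator {1..} t) \<longlonglongrightarrow> ennreal (exp (- s * t)) * indicator {1..} t" for t
    using u(2) by (auto simp: indicator_def intro!: tendsto_ennrealI tendsto_intros)
  have s0: "0 \<le> s" using u by (intro LIMSEQ_le_const) auto
  show ?thesis
  proof (cases "s = 0")
    case True
    \<comment> \<open>The limit may be infinite here, so dominated convergence is replaced by Fatou's lemma.\<close>
    have le: "(\<integral>\<^sup>+t\<in>{1..}. ennreal (exp (- u n * t)) \<partial>Q) \<le> (\<integral>\<^sup>+t\<in>{1..}. ennreal (exp (- s * t)) \<partial>Q)" for n
      using u(1)[of n] True by (intro nn_integral_mono) (auto simp: indicator_def)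
    have fatou: "(\<integral>\<^sup>+t\<in>{1..}. ennreal (exp (- s * t)) \<partial>Q) \<le> liminf (\<lambda>n. \<integral>\<^sup>+t\<in>{1..}. ennreal (exp (- u n * t)) \<partial>Q)"
    proof -
      have eq: "liminf (\<lambda>n. ennreal (exp (- u n * t)) * indicator {1..} t) = ennreal (exp (- s * t)) * indicator {1..} t" for t
        by (rule lim_imp_Liminf[OF _ pt]) simp
      show ?thesis
        using nn_integral_liminf[of "\<lambda>n t. ennreal (exp (- u n * t)) * indicator {1..} t" Q, OF meas] unfolding eq .
    qed
    show ?thesis
    proof (rule order_tendstoI)
      fix a assume "a < (\<integral>\<^sup>+t\<in>{1..}. ennreal (exp (- s * t)) \<partial>Q)"
      with fatou have "a < liminf (\<lambda>n. \<integral>\<^sup>+t\<in>{1..}. ennreal (exp (- u n * t)) \<partial>Q)" by (rule less_le_trans[rotated])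
      then show "\<forall>\<^sub>F n in sequentially. a < (\<integral>\<^sup>+t\<in>{1..}. ennreal (exp (- u n * t)) \<partial>Q)"
        by (rule less_LiminfD)
    next
      fix a assume "(\<integral>\<^sup>+t\<in>{1..}. ennreal (exp (- s * t)) \<partial>Q) < a"
      then show "\<forall>\<^sub>F n in sequentially. (\<integral>\<^sup>+t\<in>{1..}. ennreal (exp (- u n * t)) \<partial>Q) < a"
        using le by (intro always_eventually allI) (rule le_less_trans)
    qed
  next
    case False
    \<comment> \<open>A positive limit keeps the rates eventually above \<open>s / 2\<close>, which
      provides the dominating function; the index is shifted because this holds only
      eventually.\<close>
    then have "s / 2 < s" using s0 by simp
    then have "\<forall>\<^sub>F n in sequentially. s / 2 < u n" by (rule order_tendstoD(1)[OF u(2)])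
    then obtain n0 where n0: "\<And>n. n \<ge> n0 \<Longrightarrow> s / 2 < u n" by (auto simp: eventually_sequentially)
    have "(\<lambda>n. \<integral>\<^sup>+t\<in>{1..}. ennreal (exp (- u (n + n0) * t)) \<partial>Q) \<longlonglongrightarrow> (\<integral>\<^sup>+t\<in>{1..}. ennreal (exp (- s * t)) \<partial>Q)"
    proof (rule nn_integral_dominated_convergence[where w = "\<lambda>t. ennreal (exp (- (s / 2) * t)) * indicator {1..} t"])
      show "AE t in Q. ennreal (exp (- u (n + n0) * t)) * indicator {1..} t \<le> ennreal (exp (- (s / 2) * t)) * indicator {1..} t" for n
        using n0[of "n + n0"] by (intro AE_I2) (auto simp: indicator_def intro!: ennreal_leI mult_right_mono)
      show "(\<integral>\<^sup>+t\<in>{1..}. ennreal (exp (- (s / 2) * t)) \<partial>Q) < \<infinity>" using False s0 by (intro fin) simp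
      show "AE t in Q. (\<lambda>n. ennreal (exp (- u (n + n0) * t)) * indicator {1..} t) \<longlonglongrightarrow> ennreal (exp (- s * t)) * indicator {1..} t"
        by (intro AE_I2 LIMSEQ_ignore_initial_segment[OF pt])
    qed (rule meas)+
    then show ?thesis by (rule LIMSEQ_offset)
  qed
qed

text \<open>Addition on \<^typ>\<open>ereal\<close> is not continuous, so the general facts on unions do not apply.\<close>
lemma has_sum_ereal_finite_exception:
  fixes g :: "'a \<Rightarrow> ereal"
  assumes S: "finite S" "S \<subseteq> A" and g: "\<And>v. v \<in> A - S \<Longrightarrow> g v = ereal (r v)" and r: "(r has_sum s) (A - S)"
  shows "(g has_sum (sum g S + ereal s)) A"
proof -
  have filt: "filterlim (\<lambda>F. F - S) (finite_subsets_at_top (A - S)) (finite_subsets_at_top A)"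
    unfolding filterlim_iff eventually_finite_subsets_at_top
  proof (intro allI impI, elim exE conjE)
    fix Pr X assume X: "finite X" "X \<subseteq> A - S" "\<forall>Y. finite Y \<and> X \<subseteq> Y \<and> Y \<subseteq> A - S \<longrightarrow> Pr Y"
    show "\<exists>X. finite X \<and> X \<subseteq> A \<and> (\<forall>Y. finite Y \<and> X \<subseteq> Y \<and> Y \<subseteq> A \<longrightarrow> Pr (Y - S))"
      by (rule exI[of _ X]) (use X in blast)
  qed
  have "((\<lambda>F. sum r (F - S)) \<longlongrightarrow> s) (finite_subsets_at_top A)"
    using filterlim_compose[OF _ filt, of "sum r" "nhds s"] r by (simp add: has_sum_def)
  then have "((\<lambda>F. sum g S + ereal (sum r (F - S))) \<longlongrightarrow> sum g S + ereal s) (finite_subsets_at_top A)"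
    by (intro tendsto_add_ereal_general1 tendsto_const tendsto_ereal) simp_all
  moreover have "\<forall>\<^sub>F F in finite_subsets_at_top A. sum g S + ereal (sum r (F - S)) = sum g F"
    unfolding eventually_finite_subsets_at_top
  proof (intro exI[of _ S] conjI S allI impI)
    fix F assume F: "finite F \<and> S \<subseteq> F \<and> F \<subseteq> A"
    have "sum g F = sum g S + sum g (F - S)"
      using F by (subst sum.union_disjoint[symmetric]) (auto simp: Un_absorb1 finite_subset)
    also have "sum g (F - S) = (\<Sum>v\<in>F - S. ereal (r v))" using g F by (intro sum.cong) auto
    finally show "sum g S + ereal (sum r (F - S)) = sum g F" by simp
  qed
  ultimately show ?thesis unfolding has_sum_def by (rule Lim_transform_eventually)
qed

text \<open>Addition is continuous at limits other than -\<infinity>; the second conjunct keeps the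
  induction hypothesis usable for the next summand.\<close>

lemma tendsto_sum_ereal_not_MInf:
  fixes g :: "'i \<Rightarrow> 'a \<Rightarrow> ereal"
  assumes "finite S" "\<And>i. i \<in> S \<Longrightarrow> (g i \<longlongrightarrow> l i) F" "\<And>i. i \<in> S \<Longrightarrow> l i \<noteq> -\<infinity>"
  shows "((\<lambda>x. \<Sum>i\<in>S. g i x) \<longlongrightarrow> (\<Sum>i\<in>S. l i)) F \<and> (\<Sum>i\<in>S. l i) \<noteq> -\<infinity>"
  using assms
  by (induction S rule: finite_induct) (auto intro!: tendsto_add_ereal_nonneg)

section \<open>The two parts of the periodic kernel\<close>

text \<open>The kernel sees the potential only through \<mu>. The two finiteness conditions are what
  (W1) with \<alpha> = 1 and (W2) say about the positive part.\<close>

locale lattice_measure = unimodular_lattice V for V :: "real^'n^'n" +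
  fixes \<mu> :: "real set \<Rightarrow> ereal"
  assumes finite_neg: "finite_measure (neg_part \<mu>)"
    and near_finite: "\<And>q :: real^'n. q \<noteq> 0 \<Longrightarrow> (\<integral>\<^sup>+t\<in>{1..}. ennreal (exp (- (norm q)\<^sup>2 * t)) \<partial>pos_part \<mu>) < \<infinity>"
    and far_finite: "\<And>w0. w0 \<in> dual_lattice V - {0} \<Longrightarrow> (\<And>w. w \<in> dual_lattice V - {0} \<Longrightarrow> norm w0 \<le> norm w) \<Longrightarrow>
      (\<integral>\<^sup>+t\<in>{0<..<1}. ennreal (t powr (- real CARD('n) / 2) * exp (- pi\<^sup>2 * (norm w0)\<^sup>2 / t)) \<partial>pos_part \<mu>) < \<infinity>"
begin

lemma near_finite_pos: "s > 0 \<Longrightarrow> (\<integral>\<^sup>+t\<in>{1..}. ennreal (exp (- s * t)) \<partial>pos_part \<mu>) < \<infinity>"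
proof -
  assume s: "s > 0"
  obtain i :: 'n where True by simp
  define q :: "real^'n" where "q = sqrt s *\<^sub>R axis i 1"
  have "norm q = sqrt s" using s by (simp add: q_def norm_axis_1)
  moreover from this have "q \<noteq> 0" using s by auto
  ultimately show ?thesis using near_finite[of q] s by simp
qed

lemma neg_bounded_integrable:
  fixes h :: "real \<Rightarrow> real"
  assumes "h \<in> borel_measurable borel" "A \<in> sets borel" "\<And>t. t \<in> A \<Longrightarrow> \<bar>h t\<bar> \<le> B"
  shows "integrable (neg_part \<mu>) (\<lambda>t. indicator A t * h t)"
  by (rule integrable_halfline_bounded[OF sets_neg_part finite_neg assms])

lemma neg_exp_integrable: "s \<ge> 0 \<Longrightarrow> integrable (neg_part \<mu>) (\<lambda>t. indicator {1..} t * exp (- s * t))"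
  by (rule neg_bounded_integrable[where B = 1]) auto

lemma pos_exp_integrable: "s > 0 \<Longrightarrow> integrable (pos_part \<mu>) (\<lambda>t. indicator {1..} t * exp (- s * t))"
  by (rule integrable_of_nn_integral[OF sets_pos_part _ _ _ near_finite_pos]) auto

lemma neg_exp_finite: "s \<ge> 0 \<Longrightarrow> (\<integral>\<^sup>+t\<in>{1..}. ennreal (exp (- s * t)) \<partial>neg_part \<mu>) < \<infinity>"
  by (subst set_nn_integral_eq_integral[OF _ neg_exp_integrable]) auto

lemma near_exists: "signed_integral_exists \<mu> {1..} (\<lambda>t. exp (- (norm q)\<^sup>2 * t))"
  unfolding signed_integral_exists_def using neg_exp_finite[of "(norm q)\<^sup>2"] by simp

lemma near_term_not_MInf: "near_term \<mu> q \<noteq> -\<infinity>"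
proof -
  let ?X = "\<lambda>Q. \<integral>\<^sup>+t\<in>{1..}. ennreal (exp (- (norm q)\<^sup>2 * t)) \<partial>Q"
  have "enn2ereal (?X (neg_part \<mu>)) \<noteq> \<infinity>"
    using neg_exp_finite[of "(norm q)\<^sup>2"] by auto
  moreover have "0 \<le> enn2ereal (?X (pos_part \<mu>))" by (rule enn2ereal_nonneg)
  ultimately show ?thesis
    unfolding near_term_def signed_integral_def
    by (cases "enn2ereal (?X (pos_part \<mu>))"; cases "enn2ereal (?X (neg_part \<mu>))") auto
qed

definition near_real :: "real^'n \<Rightarrow> real" where
  "near_real q = set_integral_diff \<mu> {1..} (\<lambda>t. exp (- (norm q)\<^sup>2 * t))"

lemma near_term_eq: "q \<noteq> 0 \<Longrightarrow> near_term \<mu> q = ereal (near_real q)"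
  unfolding near_term_def near_real_def
  by (intro signed_integral_eq pos_exp_integrable neg_exp_integrable) auto

text \<open>This includes \<open>q = 0\<close> with value \<infinity>: the negative part stays
  finite there, so the difference is still continuous.\<close>

lemma tendsto_near_term:
  fixes f :: "'a::t2_space \<Rightarrow> real^'n"
  assumes "(f \<longlongrightarrow> q) (at z within T)"
  shows "((\<lambda>x. near_term \<mu> (f x)) \<longlongrightarrow> near_term \<mu> q) (at z within T)"
proof -
  have "isCont (near_term \<mu>) q"
    unfolding continuous_at_sequentially comp_def
  proof (intro allI impI)
    fix u :: "nat \<Rightarrow> real^'n" assume u: "u \<longlonglongrightarrow> q"
    then have n: "(\<lambda>n. (norm (u n))\<^sup>2) \<longlonglongrightarrow> (norm q)\<^sup>2" by (intro tendsto_intros)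
    let ?G = "\<lambda>Q q. enn2ereal (\<integral>\<^sup>+t\<in>{1..}. ennreal (exp (- (norm (q :: real^'n))\<^sup>2 * t)) \<partial>Q)"
    have "(\<lambda>n. ?G (pos_part \<mu>) (u n)) \<longlonglongrightarrow> ?G (pos_part \<mu>) q"
      by (rule continuous_on_tendsto_compose[OF continuous_on_enn2ereal tendsto_laplace_tail[OF sets_pos_part near_finite_pos _ n]]) auto
    moreover have "(\<lambda>n. ?G (neg_part \<mu>) (u n)) \<longlonglongrightarrow> ?G (neg_part \<mu>) q"
      using neg_exp_finite
      by (intro continuous_on_tendsto_compose[OF continuous_on_enn2ereal tendsto_laplace_tail[OF sets_neg_part _ _ n]]) auto
    moreover have "?G (neg_part \<mu>) q \<noteq> \<infinity>" "?G (pos_part \<mu>) q \<noteq> -\<infinity>"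
      using neg_exp_finite[of "(norm q)\<^sup>2"] by (auto simp: less_top[symmetric])
    ultimately show "(\<lambda>n. near_term \<mu> (u n)) \<longlonglongrightarrow> near_term \<mu> q"
      unfolding near_term_def signed_integral_def by (intro tendsto_diff_ereal_general) auto
  qed
  then show ?thesis using assms by (rule isCont_tendsto_compose)
qed

definition near_const :: real where
  "near_const = (\<integral>t. indicator {1..} t * exp (- (1/2) * t) \<partial>pos_part \<mu>) + (\<integral>t. indicator {1..} t * exp (- (1/2) * t) \<partial>neg_part \<mu>)"

text \<open>For \<open>t \<ge> 1\<close> and \<open>|q| \<ge> 1\<close> the exponent
  \<open>|q|^2 t\<close> is at least \<open>t / 2 + |q|^2 / 2\<close>. One half keeps the integral
  over \<open>t\<close> finite, the other gives decay in \<open>q\<close>.\<close>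

lemma near_real_bound:
  assumes q: "norm q \<ge> 1"
  shows "\<bar>near_real q\<bar> \<le> near_const * exp (- (1/2) * (norm q)\<^sup>2)"
proof -
  have q1: "1 \<le> (norm q)\<^sup>2" using q by (simp add: one_le_power)
  have le: "\<bar>\<integral>t. indicator {1..} t * exp (- (norm q)\<^sup>2 * t) \<partial>Q\<bar> \<le> (\<integral>t. indicator {1..} t * exp (- (1/2) * t) \<partial>Q) * exp (- (1/2) * (norm q)\<^sup>2)"
    if int: "\<And>s. s > 0 \<Longrightarrow> integrable Q (\<lambda>t. indicator {1..} t * exp (- s * t))" for Q
  proof -
    have "\<bar>\<integral>t. indicator {1..} t * exp (- (norm q)\<^sup>2 * t) \<partial>Q\<bar> = (\<integral>t. indicator {1..} t * exp (- (norm q)\<^sup>2 * t) \<partial>Q)"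
      by (intro abs_of_nonneg Bochner_Integration.integral_nonneg) auto
    also have "\<dots> \<le> (\<integral>t. (indicator {1..} t * exp (- (1/2) * t)) * exp (- (1/2) * (norm q)\<^sup>2) \<partial>Q)"
    proof (rule integral_mono)
      fix t
      show "indicator {1..} t * exp (- (norm q)\<^sup>2 * t) \<le> (indicator {1..} t * exp (- (1/2) * t)) * exp (- (1/2) * (norm q)\<^sup>2)"
      proof (cases "t \<ge> 1")
        case True
        \<comment> \<open>Expanded, the right-hand side is
          \<open>|q|^2 t - t / 2 - |q|^2 / 2\<close>.\<close>
        have "0 \<le> ((norm q)\<^sup>2 - 1) * (t - 1) + (1/2) * ((norm q)\<^sup>2 - 1) + (1/2) * (t - 1)"
          using True q1 by (intro add_nonneg_nonneg mult_nonneg_nonneg) auto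
        then have "- (norm q)\<^sup>2 * t \<le> - (1/2) * t + - (1/2) * (norm q)\<^sup>2" by (simp add: field_simps)
        then show ?thesis using True by (simp add: exp_add[symmetric])
      qed (simp add: indicator_def)
    next
      show "integrable Q (\<lambda>t. indicator {1..} t * exp (- (norm q)\<^sup>2 * t))"
        by (rule int) (use q1 in linarith)
      show "integrable Q (\<lambda>t. (indicator {1..} t * exp (- (1/2) * t)) * exp (- (1/2) * (norm q)\<^sup>2))"
        by (rule integrable_mult_left, rule int) simp
    qed
    finally show ?thesis by simp
  qed
  have "\<bar>near_real q\<bar> \<le> \<bar>\<integral>t. indicator {1..} t * exp (- (norm q)\<^sup>2 * t) \<partial>pos_part \<mu>\<bar> + \<bar>\<integral>t. indicator {1..} t * exp (- (norm q)\<^sup>2 * t) \<partial>neg_part \<mu>\<bar>"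
    unfolding near_real_def set_integral_diff_def by (rule abs_triangle_ineq4)
  also have "\<dots> \<le> near_const * exp (- (1/2) * (norm q)\<^sup>2)"
    using add_mono[OF le[OF pos_exp_integrable] le[OF neg_exp_integrable]] by (simp add: near_const_def distrib_right)
  finally show ?thesis .
qed

text \<open>The margin 1 ensures \<open>|z + v| \<ge> 1\<close> for all other \<open>v\<close> when
  \<open>|z| \<le> R\<close>. In particular every \<open>v\<close> with \<open>z + v = 0\<close>,
  where the term may be infinite, lies in this finite set.\<close>

definition near_set :: "real \<Rightarrow> (real^'n) set" where
  "near_set R = {v \<in> lattice V. norm v \<le> R + 1}"

lemma finite_near_set: "finite (near_set R)"
  unfolding near_set_def by (rule finite_lattice_ball)

lemma norm_ge_1_outside:
  assumes "norm z \<le> R" "v \<in> lattice V - near_set R"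
  shows "norm (z + v) \<ge> 1"
proof -
  have "norm v > R + 1" using assms by (auto simp: near_set_def)
  then show ?thesis using assms(1) norm_triangle_ineq4[of "z + v" z] by simp
qed

lemma near_const_nonneg: "near_const \<ge> 0"
  unfolding near_const_def by (intro add_nonneg_nonneg Bochner_Integration.integral_nonneg) auto

lemma near_real_bound_outside:
  assumes z: "norm z \<le> R" and v: "v \<in> lattice V - near_set R"
  shows "\<bar>near_real (z + v)\<bar> \<le> near_const * (exp ((1/2) * R\<^sup>2) * exp (- (1/4) * (norm v)\<^sup>2))"
proof -
  have "\<bar>near_real (z + v)\<bar> \<le> near_const * exp (- (1/2) * (norm (z + v))\<^sup>2)"
    by (rule near_real_bound[OF norm_ge_1_outside[OF z v]])
  also have "\<dots> \<le> near_const * (exp ((1/2) * (norm z)\<^sup>2) * exp (- ((1/2)/2) * (norm v)\<^sup>2))"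
    by (intro mult_left_mono exp_neg_norm_sq_shift near_const_nonneg) simp
  also have "\<dots> \<le> near_const * (exp ((1/2) * R\<^sup>2) * exp (- (1/4) * (norm v)\<^sup>2))"
  proof -
    have "(norm z)\<^sup>2 \<le> R\<^sup>2" using z by (intro power_mono) auto
    then show ?thesis by (intro mult_left_mono mult_mono near_const_nonneg) auto
  qed
  finally show ?thesis .
qed

lemma summable_near_bound: "(\<lambda>v. near_const * (c * exp (- (1/4) * (norm v)\<^sup>2))) summable_on (lattice V - near_set R)"
proof (rule summable_on_subset_banach)
  show "(\<lambda>v. near_const * (c * exp (- (1/4) * (norm v)\<^sup>2))) summable_on lattice V"
    by (intro summable_on_cmult_right summable_gaussian) simp
qed auto

lemma near_real_abs_summable:
  assumes z: "norm z \<le> R"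
  shows "(\<lambda>v. \<bar>near_real (z + v)\<bar>) summable_on (lattice V - near_set R)"
  by (rule summable_on_comparison_test[OF summable_near_bound near_real_bound_outside[OF z]]) auto

lemma near_has_sum:
  assumes z: "norm z \<le> R"
  shows "((\<lambda>v. near_term \<mu> (z + v)) has_sum
    (\<Sum>v\<in>near_set R. near_term \<mu> (z + v)) + ereal (\<Sum>\<^sub>\<infinity>v\<in>lattice V - near_set R. near_real (z + v))) (lattice V)"
proof (rule has_sum_ereal_finite_exception[OF finite_near_set])
  show "near_set R \<subseteq> lattice V" by (auto simp: near_set_def)
  show "near_term \<mu> (z + v) = ereal (near_real (z + v))" if "v \<in> lattice V - near_set R" for v
    using norm_ge_1_outside[OF z that] by (intro near_term_eq) auto
  show "((\<lambda>v. near_real (z + v)) has_sum (\<Sum>\<^sub>\<infinity>v\<in>lattice V - near_set R. near_real (z + v))) (lattice V - near_set R)"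
    using near_real_abs_summable[OF z] by (intro has_sum_infsum) (simp add: abs_summable_summable)
qed

definition near_sum :: "real^'n \<Rightarrow> ereal" where
  "near_sum z = (\<Sum>\<^sub>\<infinity>v\<in>lattice V. near_term \<mu> (z + v))"

lemma near_summable: "(\<lambda>v. near_term \<mu> (z + v)) summable_on lattice V"
  using near_has_sum[OF order_refl] by (rule has_sum_imp_summable)

lemma near_sum_eq:
  "norm z \<le> R \<Longrightarrow> near_sum z = (\<Sum>v\<in>near_set R. near_term \<mu> (z + v)) + ereal (\<Sum>\<^sub>\<infinity>v\<in>lattice V - near_set R. near_real (z + v))"
  unfolding near_sum_def by (rule infsumI[OF near_has_sum])

lemma sum_near_term_not_MInf: "finite S \<Longrightarrow> (\<Sum>v\<in>S. near_term \<mu> (z + v)) \<noteq> -\<infinity>"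
  using tendsto_sum_ereal_not_MInf[of S "\<lambda>v x. near_term \<mu> (z + v)" "\<lambda>v. near_term \<mu> (z + v)" sequentially] near_term_not_MInf
  by auto

lemma near_sum_not_MInf: "near_sum z \<noteq> -\<infinity>"
  using sum_near_term_not_MInf[OF finite_near_set] by (auto simp: near_sum_eq[OF order_refl])

lemma near_sum_finite:
  assumes "z \<notin> lattice V"
  shows "\<bar>near_sum z\<bar> \<noteq> \<infinity>" "near_sum z = ereal (\<Sum>\<^sub>\<infinity>v\<in>lattice V. near_real (z + v))"
    "(\<lambda>v. near_real (z + v)) summable_on lattice V"
proof -
  have nz: "z + v \<noteq> 0" if "v \<in> lattice V" for v
    using lattice_uminus[OF that] assms by (metis eq_neg_iff_add_eq_0)
  have a: "(\<lambda>v. near_real (z + v)) summable_on (lattice V - near_set (norm z))"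
    using near_real_abs_summable[OF order_refl] by (simp add: abs_summable_summable)
  have "(\<lambda>v. near_real (z + v)) summable_on ((lattice V - near_set (norm z)) \<union> near_set (norm z))"
    by (rule summable_on_union[OF a summable_on_finite[OF finite_near_set]])
  moreover have L: "lattice V - near_set (norm z) \<union> near_set (norm z) = lattice V" by (auto simp: near_set_def)
  ultimately show s: "(\<lambda>v. near_real (z + v)) summable_on lattice V" by simp
  have "((\<lambda>v. near_term \<mu> (z + v)) has_sum (\<Sum>v\<in>{}. near_term \<mu> (z + v)) + ereal (\<Sum>\<^sub>\<infinity>v\<in>lattice V. near_real (z + v))) (lattice V)"
    by (rule has_sum_ereal_finite_exception) (use s nz near_term_eq in auto)
  then show "near_sum z = ereal (\<Sum>\<^sub>\<infinity>v\<in>lattice V. near_real (z + v))"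
    unfolding near_sum_def by (simp add: infsumI)
  then show "\<bar>near_sum z\<bar> \<noteq> \<infinity>" by simp
qed

lemma continuous_near_sum: "continuous_on UNIV near_sum"
  unfolding continuous_on_def
proof
  fix z :: "real^'n"
  \<comment> \<open>One radius for the whole unit ball around \<open>z\<close>, so that all its
    points share the same finite exceptional set.\<close>
  define R where "R = norm z + 1"
  let ?g = "\<lambda>x. (\<Sum>v\<in>near_set R. near_term \<mu> (x + v)) + ereal (\<Sum>\<^sub>\<infinity>v\<in>lattice V - near_set R. near_real (x + v))"
  have R: "norm x \<le> R" if "x \<in> ball z 1" for x
    using that norm_triangle_ineq2[of x z] by (simp add: dist_norm norm_minus_commute R_def)
  have evb: "\<forall>\<^sub>F x in at z. x \<in> ball z 1"
    by (rule eventually_at_in_open') auto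
  have ne: "norm z \<le> R" by (simp add: R_def)
  have 1: "((\<lambda>x. \<Sum>v\<in>near_set R. near_term \<mu> (x + v)) \<longlongrightarrow> (\<Sum>v\<in>near_set R. near_term \<mu> (z + v))) (at z)"
    by (rule conjunct1[OF tendsto_sum_ereal_not_MInf[OF finite_near_set]])
       (auto intro!: tendsto_near_term tendsto_intros simp: near_term_not_MInf)
  have 2: "((\<lambda>x. \<Sum>\<^sub>\<infinity>v\<in>lattice V - near_set R. near_real (x + v)) \<longlongrightarrow> (\<Sum>\<^sub>\<infinity>v\<in>lattice V - near_set R. near_real (z + v))) (at z)"
  proof (rule tendsto_infsum_dominated[where S = "ball z 1" and M = "\<lambda>v. near_const * (exp ((1/2) * R\<^sup>2) * exp (- (1/4) * (norm v)\<^sup>2))"])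
    fix v assume v: "v \<in> lattice V - near_set R"
    have ev: "\<forall>\<^sub>F x in at z. near_term \<mu> (x + v) = ereal (near_real (x + v))"
      using evb
    proof eventually_elim
      case (elim x)
      show ?case using norm_ge_1_outside[OF R[OF elim] v] by (intro near_term_eq) auto
    qed
    have eq: "near_term \<mu> (z + v) = ereal (near_real (z + v))"
      using norm_ge_1_outside[OF ne v] by (intro near_term_eq) auto
    have "((\<lambda>x. near_term \<mu> (x + v)) \<longlongrightarrow> near_term \<mu> (z + v)) (at z)"
      by (intro tendsto_near_term tendsto_intros)
    then have "((\<lambda>x. ereal (near_real (x + v))) \<longlongrightarrow> ereal (near_real (z + v))) (at z)"
      unfolding tendsto_cong[OF ev] eq .
    then show "((\<lambda>x. near_real (x + v)) \<longlongrightarrow> near_real (z + v)) (at z)" by simp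
  qed (use near_real_bound_outside R evb summable_near_bound in auto)
  have "(?g \<longlongrightarrow> ?g z) (at z)"
    by (intro tendsto_add_ereal_general1 1 tendsto_ereal 2) simp
  moreover have "\<forall>\<^sub>F x in at z. ?g x = near_sum x"
    using evb by eventually_elim (rule near_sum_eq[OF R, symmetric])
  ultimately show "(near_sum \<longlongrightarrow> near_sum z) (at z)"
    unfolding near_sum_eq[OF ne] by (rule Lim_transform_eventually)
qed

lemma near_sum_uminus: "near_sum (- z) = near_sum z"
proof -
  have nm: "near_term \<mu> (- q) = near_term \<mu> q" for q :: "real^'n" by (simp add: near_term_def)
  have "near_sum z = (\<Sum>\<^sub>\<infinity>v\<in>lattice V. near_term \<mu> (z + - v))"
    unfolding near_sum_def by (rule infsum_reindex_bij_betw[OF bij_lattice_uminus, symmetric])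
  also have "\<dots> = (\<Sum>\<^sub>\<infinity>v\<in>lattice V. near_term \<mu> (- z + v))"
  proof (rule infsum_cong)
    fix v show "near_term \<mu> (z + - v) = near_term \<mu> (- z + v)"
      using nm[of "z + - v"] by (simp add: add.commute)
  qed
  finally show ?thesis by (simp add: near_sum_def)
qed

lemma near_sum_periodic: "u \<in> lattice V \<Longrightarrow> near_sum (z + u) = near_sum z"
  using infsum_reindex_bij_betw[OF bij_lattice_add, of u "\<lambda>v. near_term \<mu> (z + v)"]
  by (simp add: near_sum_def add_ac)

end

section \<open>The far sum\<close>

lemma powr_exp_bound:
  fixes a t :: real and d :: nat
  assumes a: "a > 0" and t: "t > 0" and d: "d > 0"
  shows "t powr (- real d / 2) * exp (- a / t) \<le> sqrt ((real d / (2 * a)) ^ d)"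
proof (rule real_le_rsqrt)
  \<comment> \<open>Squaring removes the half-integer power and leaves the \<open>d\<close>-th power
    of \<open>y * exp (- ?b * y)\<close> with \<open>y = 1 / t\<close>, which is at most
    \<open>1 / ?b\<close> because \<open>?b * y \<le> exp (?b * y)\<close>.\<close>
  let ?b = "2 * a / real d"
  have b: "?b > 0" using a d by simp
  have "?b * (1 / t) \<le> exp (?b * (1 / t))" using exp_ge_add_one_self[of "?b * (1 / t)"] by linarith
  then have le: "1 / t * exp (- (?b * (1 / t))) \<le> real d / (2 * a)"
    using b t a d by (simp add: exp_minus field_simps)
  have "(t powr (- real d / 2))\<^sup>2 = (1 / t) ^ d"
    using t by (simp add: power2_eq_square powr_add[symmetric] powr_minus powr_realpow field_simps)
  moreover have "(exp (- a / t))\<^sup>2 = exp (- (?b * (1 / t))) ^ d"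
    using d by (simp add: exp_of_nat_mult[symmetric] exp_double[symmetric])
  ultimately have "(t powr (- real d / 2) * exp (- a / t))\<^sup>2 = (1 / t * exp (- (?b * (1 / t)))) ^ d"
    by (simp only: power_mult_distrib)
  also have "\<dots> \<le> (real d / (2 * a)) ^ d"
    using le t by (intro power_mono) auto
  finally show "(t powr (- real d / 2) * exp (- a / t))\<^sup>2 \<le> (real d / (2 * a)) ^ d" .
qed

lemma far_integrand_eq:
  fixes w :: "real^'n"
  shows "far_integrand w t = pi powr (real CARD('n) / 2) * (t powr (- real CARD('n) / 2) * exp (- pi\<^sup>2 * (norm w)\<^sup>2 / t))"
  by (simp add: far_integrand_def powr_minus_divide)

lemma far_integrand_measurable [measurable]: "far_integrand w \<in> borel_measurable borel"
  unfolding far_integrand_def by measurable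

context unimodular_lattice
begin

definition shortest_dual :: "real^'n" where
  "shortest_dual = (SOME w0. w0 \<in> dual_lattice V - {0} \<and> (\<forall>w \<in> dual_lattice V - {0}. norm w0 \<le> norm w))"

lemma shortest_dual: "shortest_dual \<in> dual_lattice V - {0}"
  "w \<in> dual_lattice V - {0} \<Longrightarrow> norm shortest_dual \<le> norm w"
proof -
  have "shortest_dual \<in> dual_lattice V - {0} \<and> (\<forall>w \<in> dual_lattice V - {0}. norm shortest_dual \<le> norm w)"
    unfolding shortest_dual_def by (rule someI_ex) (use ex_minimal_dual in blast)
  then show "shortest_dual \<in> dual_lattice V - {0}" "w \<in> dual_lattice V - {0} \<Longrightarrow> norm shortest_dual \<le> norm w"
    by auto
qed

lemma norm_sq_shortest: "w \<in> dual_lattice V - {0} \<Longrightarrow> (norm shortest_dual)\<^sup>2 \<le> (norm w)\<^sup>2"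
  using shortest_dual(2) by (intro power_mono) auto

lemma norm_shortest_pos: "(norm shortest_dual)\<^sup>2 > 0"
  using shortest_dual(1) by simp

text \<open>Half of the exponent, bounded below through the shortest dual vector, absorbs the
  singular power of \<open>t\<close> uniformly in \<open>w\<close>; the other half gives Gaussian
  decay because \<open>t \<le> 2\<close>. The range up to 2 is what \<open>t + e\<close> needs when
  \<open>t < 1\<close> and \<open>e \<le> 1\<close>.\<close>

lemma far_integrand_uniform:
  "\<exists>C\<ge>0. \<forall>w \<in> dual_lattice V - {0}. \<forall>t. 0 < t \<longrightarrow> t \<le> 2 \<longrightarrow> far_integrand w t \<le> C * exp (- (pi\<^sup>2 / 4) * (norm w)\<^sup>2)"
proof -
  define a where "a = pi\<^sup>2 * (norm shortest_dual)\<^sup>2 / 2"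
  have a: "a > 0" using norm_shortest_pos by (simp add: a_def)
  define B where "B = sqrt ((real CARD('n) / (2 * a)) ^ CARD('n))"
  have B: "B \<ge> 0" using a by (simp add: B_def)
  show ?thesis
  proof (intro exI[of _ "pi powr (real CARD('n) / 2) * B"] conjI ballI allI impI)
    show "0 \<le> pi powr (real CARD('n) / 2) * B" using B by simp
    fix w :: "real^'n" and t :: real assume w: "w \<in> dual_lattice V - {0}" and t: "0 < t" "t \<le> 2"
    have 1: "pi\<^sup>2 * (norm shortest_dual)\<^sup>2 / (2 * t) \<le> pi\<^sup>2 * (norm w)\<^sup>2 / (2 * t)"
      using norm_sq_shortest[OF w] t by (intro divide_right_mono mult_left_mono) auto
    have 2: "pi\<^sup>2 * (norm w)\<^sup>2 / 4 \<le> pi\<^sup>2 * (norm w)\<^sup>2 / (2 * t)"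
      using t by (intro divide_left_mono) auto
    have "- pi\<^sup>2 * (norm w)\<^sup>2 / t = - (pi\<^sup>2 * (norm w)\<^sup>2 / (2 * t)) - pi\<^sup>2 * (norm w)\<^sup>2 / (2 * t)"
      using t by (simp add: field_simps)
    also have "\<dots> \<le> - (pi\<^sup>2 * (norm shortest_dual)\<^sup>2 / (2 * t)) - pi\<^sup>2 * (norm w)\<^sup>2 / 4"
      using 1 2 by linarith
    also have "\<dots> = - a / t + - (pi\<^sup>2 / 4) * (norm w)\<^sup>2" by (simp add: a_def)
    finally have "exp (- pi\<^sup>2 * (norm w)\<^sup>2 / t) \<le> exp (- a / t + - (pi\<^sup>2 / 4) * (norm w)\<^sup>2)"
      by (simp only: exp_le_cancel_iff)
    then have "t powr (- real CARD('n) / 2) * exp (- pi\<^sup>2 * (norm w)\<^sup>2 / t) \<le>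
      t powr (- real CARD('n) / 2) * (exp (- a / t) * exp (- (pi\<^sup>2 / 4) * (norm w)\<^sup>2))"
      unfolding exp_add by (rule mult_left_mono) simp
    also have "\<dots> = (t powr (- real CARD('n) / 2) * exp (- a / t)) * exp (- (pi\<^sup>2 / 4) * (norm w)\<^sup>2)"
      by (simp only: mult.assoc)
    also have "\<dots> \<le> B * exp (- (pi\<^sup>2 / 4) * (norm w)\<^sup>2)"
      unfolding B_def using powr_exp_bound[OF a t(1), of "CARD('n)"] by (intro mult_right_mono) auto
    finally show "far_integrand w t \<le> pi powr (real CARD('n) / 2) * B * exp (- (pi\<^sup>2 / 4) * (norm w)\<^sup>2)"
      unfolding far_integrand_eq mult.assoc by (rule mult_left_mono) simp
  qed
qed

end

context lattice_measure
begin

definition short_weight :: "real \<Rightarrow> real" where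
  "short_weight t = t powr (- real CARD('n) / 2) * exp (- pi\<^sup>2 * (norm shortest_dual)\<^sup>2 / t)"

lemma short_weight_measurable [measurable]: "short_weight \<in> borel_measurable borel"
  unfolding short_weight_def by measurable

lemma short_weight_nonneg: "0 \<le> short_weight t"
  by (simp add: short_weight_def)

text \<open>For the positive part this is (W2). The negative part is a finite measure and the weight
  is bounded on (0,1).\<close>

lemma short_weight_integrable:
  "integrable (pos_part \<mu>) (\<lambda>t. indicator {0<..<1} t * short_weight t)"
  "integrable (neg_part \<mu>) (\<lambda>t. indicator {0<..<1} t * short_weight t)"
proof -
  have "(\<integral>\<^sup>+t\<in>{0<..<1}. ennreal (short_weight t) \<partial>pos_part \<mu>) < \<infinity>"
    unfolding short_weight_def using shortest_dual by (rule far_finite)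
  then show "integrable (pos_part \<mu>) (\<lambda>t. indicator {0<..<1} t * short_weight t)"
    by (intro integrable_of_nn_integral) (auto simp: short_weight_nonneg)
  have "\<bar>short_weight t\<bar> \<le> sqrt ((real CARD('n) / (2 * (pi\<^sup>2 * (norm shortest_dual)\<^sup>2))) ^ CARD('n))" if "t \<in> {0<..<1}" for t
    using powr_exp_bound[of "pi\<^sup>2 * (norm shortest_dual)\<^sup>2" t "CARD('n)"] that norm_shortest_pos short_weight_nonneg[of t]
    by (auto simp: short_weight_def)
  then show "integrable (neg_part \<mu>) (\<lambda>t. indicator {0<..<1} t * short_weight t)"
    by (intro neg_bounded_integrable) auto
qed

lemma far_integrand_le_short_weight:
  assumes w: "w \<in> dual_lattice V - {0}" and t: "t \<in> {0<..<1}"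
  shows "far_integrand w t \<le> pi powr (real CARD('n) / 2) * exp (pi\<^sup>2 * (norm shortest_dual)\<^sup>2) * exp (- pi\<^sup>2 * (norm w)\<^sup>2) * short_weight t"
proof -
  have t': "0 < t" "t < 1" using t by auto
  \<comment> \<open>Multiplied out, this product is the required inequality between exponents;
    \<open>1 / t - 1\<close> is nonnegative on (0,1).\<close>
  have "0 \<le> (pi\<^sup>2 * (norm w)\<^sup>2 - pi\<^sup>2 * (norm shortest_dual)\<^sup>2) * (1 / t - 1)"
    using norm_sq_shortest[OF w] t' by (intro mult_nonneg_nonneg) (auto intro!: mult_left_mono)
  then have "- pi\<^sup>2 * (norm w)\<^sup>2 / t \<le> pi\<^sup>2 * (norm shortest_dual)\<^sup>2 + - pi\<^sup>2 * (norm w)\<^sup>2 + - pi\<^sup>2 * (norm shortest_dual)\<^sup>2 / t"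
    by (simp add: algebra_simps)
  then have "exp (- pi\<^sup>2 * (norm w)\<^sup>2 / t) \<le>
      exp (pi\<^sup>2 * (norm shortest_dual)\<^sup>2) * exp (- pi\<^sup>2 * (norm w)\<^sup>2) * exp (- pi\<^sup>2 * (norm shortest_dual)\<^sup>2 / t)"
    by (simp only: exp_add[symmetric] exp_le_cancel_iff)
  then have "pi powr (real CARD('n) / 2) * (t powr (- real CARD('n) / 2) * exp (- pi\<^sup>2 * (norm w)\<^sup>2 / t)) \<le>
    pi powr (real CARD('n) / 2) * (t powr (- real CARD('n) / 2) * (exp (pi\<^sup>2 * (norm shortest_dual)\<^sup>2) * exp (- pi\<^sup>2 * (norm w)\<^sup>2) * exp (- pi\<^sup>2 * (norm shortest_dual)\<^sup>2 / t)))"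
    by (intro mult_left_mono) auto
  then show ?thesis unfolding far_integrand_eq short_weight_def by (simp only: mult_ac)
qed

lemma far_integrable:
  assumes w: "w \<in> dual_lattice V - {0}"
  shows "integrable (pos_part \<mu>) (\<lambda>t. indicator {0<..<1} t * far_integrand w t)"
    "integrable (neg_part \<mu>) (\<lambda>t. indicator {0<..<1} t * far_integrand w t)"
proof -
  let ?c = "pi powr (real CARD('n) / 2) * exp (pi\<^sup>2 * (norm shortest_dual)\<^sup>2) * exp (- pi\<^sup>2 * (norm w)\<^sup>2)"
  have bd: "norm (indicator {0<..<1} t * far_integrand w t) \<le> norm (?c * (indicator {0<..<1} t * short_weight t))" for t
    using far_integrand_le_short_weight[OF w, of t] far_integrand_nonneg[of w t] short_weight_nonneg[of t]
    by (auto simp: indicator_def abs_mult)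
  have m: "(\<lambda>t. indicator {0<..<1} t * far_integrand w t) \<in> borel_measurable borel" by measurable
  show "integrable (pos_part \<mu>) (\<lambda>t. indicator {0<..<1} t * far_integrand w t)"
    using bd by (intro Bochner_Integration.integrable_bound[OF integrable_mult_right[OF short_weight_integrable(1), of ?c]]
        measurable_halflineI[OF sets_pos_part m] AE_I2)
  show "integrable (neg_part \<mu>) (\<lambda>t. indicator {0<..<1} t * far_integrand w t)"
    using bd by (intro Bochner_Integration.integrable_bound[OF integrable_mult_right[OF short_weight_integrable(2), of ?c]]
        measurable_halflineI[OF sets_neg_part m] AE_I2)
qed

definition far_real :: "real^'n \<Rightarrow> real" where
  "far_real w = set_integral_diff \<mu> {0<..<1} (far_integrand w)"

lemma far_coeff_eq: "w \<in> dual_lattice V - {0} \<Longrightarrow> far_coeff \<mu> w = ereal (far_real w)"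
  unfolding far_coeff_def far_real_def by (intro signed_integral_eq far_integrable far_integrand_nonneg)

lemma far_exists:
  assumes "w \<in> dual_lattice V - {0}"
  shows "signed_integral_exists \<mu> {0<..<1} (far_integrand w)"
  unfolding signed_integral_exists_def
  using set_nn_integral_eq_integral[OF far_integrand_nonneg far_integrable(2)[OF assms]] by simp

lemma far_real_bound:
  "\<exists>K. \<forall>w \<in> dual_lattice V - {0}. \<bar>far_real w\<bar> \<le> K * exp (- pi\<^sup>2 * (norm w)\<^sup>2)"
proof (intro exI ballI)
  fix w :: "real^'n" assume w: "w \<in> dual_lattice V - {0}"
  let ?k = "pi powr (real CARD('n) / 2) * exp (pi\<^sup>2 * (norm shortest_dual)\<^sup>2)"
  let ?J = "\<lambda>Q. \<integral>t. indicator {0<..<1} t * short_weight t \<partial>Q"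
  have le: "\<bar>\<integral>t. indicator {0<..<1} t * far_integrand w t \<partial>Q\<bar> \<le> ?k * exp (- pi\<^sup>2 * (norm w)\<^sup>2) * ?J Q"
    if 1: "integrable Q (\<lambda>t. indicator {0<..<1} t * far_integrand w t)"
      and 2: "integrable Q (\<lambda>t. indicator {0<..<1} t * short_weight t)" for Q
  proof -
    have "\<bar>\<integral>t. indicator {0<..<1} t * far_integrand w t \<partial>Q\<bar> = (\<integral>t. indicator {0<..<1} t * far_integrand w t \<partial>Q)"
      by (intro abs_of_nonneg Bochner_Integration.integral_nonneg) (auto simp: far_integrand_nonneg)
    also have "\<dots> \<le> (\<integral>t. ?k * exp (- pi\<^sup>2 * (norm w)\<^sup>2) * (indicator {0<..<1} t * short_weight t) \<partial>Q)"
      using far_integrand_le_short_weight[OF w]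
      by (intro integral_mono 1 integrable_mult_right 2) (auto simp: indicator_def)
    finally show ?thesis by simp
  qed
  have "\<bar>far_real w\<bar> \<le> \<bar>\<integral>t. indicator {0<..<1} t * far_integrand w t \<partial>pos_part \<mu>\<bar> + \<bar>\<integral>t. indicator {0<..<1} t * far_integrand w t \<partial>neg_part \<mu>\<bar>"
    unfolding far_real_def set_integral_diff_def by (rule abs_triangle_ineq4)
  also have "\<dots> \<le> (?k * (?J (pos_part \<mu>) + ?J (neg_part \<mu>))) * exp (- pi\<^sup>2 * (norm w)\<^sup>2)"
    using add_mono[OF le[OF far_integrable(1)[OF w] short_weight_integrable(1)] le[OF far_integrable(2)[OF w] short_weight_integrable(2)]]
    by (simp add: algebra_simps)
  finally show "\<bar>far_real w\<bar> \<le> (?k * (?J (pos_part \<mu>) + ?J (neg_part \<mu>))) * exp (- pi\<^sup>2 * (norm w)\<^sup>2)" .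
qed

lemma summable_gaussian_dual_nonzero:
  assumes "c > 0"
  shows "(\<lambda>w. K * exp (- c * (norm w)\<^sup>2)) summable_on (dual_lattice V - {0})"
proof (rule summable_on_subset_banach)
  show "(\<lambda>w. K * exp (- c * (norm w)\<^sup>2)) summable_on dual_lattice V"
    using assms by (intro summable_on_cmult_right summable_gaussian_dual)
qed auto

lemma far_real_summable: "(\<lambda>w. \<bar>far_real w\<bar>) summable_on (dual_lattice V - {0})"
proof -
  obtain K where K: "\<And>w. w \<in> dual_lattice V - {0} \<Longrightarrow> \<bar>far_real w\<bar> \<le> K * exp (- pi\<^sup>2 * (norm w)\<^sup>2)"
    using far_real_bound by blast
  show ?thesis
    by (rule summable_on_comparison_test[OF summable_gaussian_dual_nonzero K]) auto
qed

lemma far_real_uminus: "far_real (- w) = far_real w"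
  unfolding far_real_def set_integral_diff_def far_integrand_minus ..

definition far_sum :: "real^'n \<Rightarrow> real" where
  "far_sum z = (\<Sum>\<^sub>\<infinity>w\<in>dual_lattice V - {0}. far_real w * cos (2 * pi * (w \<bullet> z)))"

lemma continuous_far_sum: "continuous_on UNIV far_sum"
  unfolding far_sum_def[abs_def] by (rule continuous_cosine_series[OF far_real_summable])

lemma far_sum_uminus: "far_sum (- z) = far_sum z"
  by (simp add: far_sum_def)

lemma far_sum_periodic: "u \<in> lattice V \<Longrightarrow> far_sum (z + u) = far_sum z"
  unfolding far_sum_def by (rule infsum_cong) (simp add: cos_dual_periodic)

lemma far_term_eq:
  assumes "w \<in> dual_lattice V - {0}"
  shows "far_term \<mu> z w = cis (2 * pi * (w \<bullet> z)) * complex_of_real (far_real w)"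
  using far_coeff_eq[OF assms] by (simp add: far_term_def cis_conv_exp mult_ac)

lemma far_term_summable: "far_term \<mu> z summable_on (dual_lattice V - {0})"
proof (rule abs_summable_summable)
  show "(\<lambda>w. norm (far_term \<mu> z w)) summable_on (dual_lattice V - {0})"
    by (rule summable_on_cong[THEN iffD1, OF _ far_real_summable]) (simp add: far_term_eq norm_mult)
qed

lemma far_term_infsum: "(\<Sum>\<^sub>\<infinity>w\<in>dual_lattice V - {0}. far_term \<mu> z w) = complex_of_real (far_sum z)"
proof -
  let ?S = "\<Sum>\<^sub>\<infinity>w\<in>dual_lattice V - {0}. far_term \<mu> z w"
  have hs: "(far_term \<mu> z has_sum ?S) (dual_lattice V - {0})" by (rule has_sum_infsum[OF far_term_summable])
  have "((\<lambda>w. Re (far_term \<mu> z w)) has_sum Re ?S) (dual_lattice V - {0})"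
    by (rule has_sum_bounded_linear[OF bounded_linear_Re hs])
  then have "((\<lambda>w. far_real w * cos (2 * pi * (w \<bullet> z))) has_sum Re ?S) (dual_lattice V - {0})"
    by (rule has_sum_cong[THEN iffD1, rotated]) (simp add: far_term_eq)
  then have "Re ?S = far_sum z" unfolding far_sum_def by (rule infsumI[symmetric])
  moreover have "Im ?S = 0"
  proof -
    have im: "((\<lambda>w. Im (far_term \<mu> z w)) has_sum Im ?S) (dual_lattice V - {0})"
      by (rule has_sum_bounded_linear[OF bounded_linear_Im hs])
    then have s: "((\<lambda>w. far_real w * sin (2 * pi * (w \<bullet> z))) has_sum Im ?S) (dual_lattice V - {0})"
      by (rule has_sum_cong[THEN iffD1, rotated]) (simp add: far_term_eq)
    \<comment> \<open>Reindexing by negation changes the sign of the sine but not of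
      \<open>far_real\<close>, so the imaginary part equals its own negative.\<close>
    then have "((\<lambda>w. far_real (- w) * sin (2 * pi * (- w \<bullet> z))) has_sum Im ?S) (dual_lattice V - {0})"
      unfolding has_sum_reindex_bij_betw[OF bij_dual_uminus, where f = "\<lambda>w. far_real w * sin (2 * pi * (w \<bullet> z))"] .
    then have "((\<lambda>w. - (far_real w * sin (2 * pi * (w \<bullet> z)))) has_sum Im ?S) (dual_lattice V - {0})"
      by (simp add: far_real_uminus)
    moreover have "((\<lambda>w. - (far_real w * sin (2 * pi * (w \<bullet> z)))) has_sum - Im ?S) (dual_lattice V - {0})"
      using s by (simp add: has_sum_uminus)
    ultimately have "Im ?S = - Im ?S" by (rule has_sum_unique)
    then show ?thesis by simp
  qed
  ultimately show ?thesis by (simp add: complex_eq_iff)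
qed

section \<open>Properties of the kernel\<close>

lemma periodic_kernel_eq: "periodic_kernel V \<mu> x y = near_sum (x - y) + ereal (far_sum (x - y))"
  by (simp add: periodic_kernel_def near_sum_def far_term_infsum)

lemma periodic_kernel_well_definedI: "periodic_kernel_well_defined V \<mu> x y"
  unfolding periodic_kernel_well_defined_def
  using near_exists near_term_not_MInf near_summable far_exists far_coeff_eq far_term_summable near_sum_not_MInf[of "x - y"]
  by (auto simp: far_term_infsum periodic_kernel_eq)

lemma continuous_periodic_kernel: "continuous_on UNIV (\<lambda>(x, y). periodic_kernel V \<mu> x y)"
proof -
  let ?d = "\<lambda>p :: (real^'n) \<times> (real^'n). fst p - snd p"
  have d: "continuous_on UNIV ?d" by (intro continuous_intros)
  have 1: "continuous_on UNIV (\<lambda>p. near_sum (?d p))"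
    using continuous_on_compose2[OF continuous_near_sum d] by auto
  have 2: "continuous_on UNIV (\<lambda>p. far_sum (?d p))"
    using continuous_on_compose2[OF continuous_far_sum d] by auto
  have "continuous_on UNIV (\<lambda>p. near_sum (?d p) + ereal (far_sum (?d p)))"
    unfolding continuous_on_def
  proof
    fix p :: "(real^'n) \<times> (real^'n)"
    show "((\<lambda>p. near_sum (?d p) + ereal (far_sum (?d p))) \<longlongrightarrow> near_sum (?d p) + ereal (far_sum (?d p))) (at p)"
    \<comment> \<open>The far summand is real, so the addition is continuous even where the near sum
      is \<infinity>.\<close>
    proof (rule tendsto_add_ereal_general1)
      show "((\<lambda>p. near_sum (?d p)) \<longlongrightarrow> near_sum (?d p)) (at p)"
        using 1 unfolding continuous_on_def by blast
      show "((\<lambda>p. ereal (far_sum (?d p))) \<longlongrightarrow> ereal (far_sum (?d p))) (at p)"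
        using 2 unfolding continuous_on_def by (intro tendsto_ereal) blast
    qed simp
  qed
  then show ?thesis by (simp add: periodic_kernel_eq case_prod_beta)
qed

lemma periodic_kernel_finite: "x - y \<notin> lattice V \<Longrightarrow> \<bar>periodic_kernel V \<mu> x y\<bar> \<noteq> \<infinity>"
  using near_sum_finite(2)[of "x - y"] by (simp add: periodic_kernel_eq)

lemma periodic_kernel_sym: "periodic_kernel V \<mu> x y = periodic_kernel V \<mu> y x"
  using near_sum_uminus[of "x - y"] far_sum_uminus[of "x - y"] by (simp add: periodic_kernel_eq)

lemma periodic_kernel_periodic:
  assumes "v \<in> lattice V"
  shows "periodic_kernel V \<mu> (x + v) y = periodic_kernel V \<mu> x y"
    "periodic_kernel V \<mu> x (y + v) = periodic_kernel V \<mu> x y"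
  using near_sum_periodic[OF assms, of "x - y"] far_sum_periodic[OF assms, of "x - y"]
    near_sum_periodic[OF lattice_uminus[OF assms], of "x - y"] far_sum_periodic[OF lattice_uminus[OF assms], of "x - y"]
  by (simp_all add: periodic_kernel_eq algebra_simps)

end

section \<open>Comparison with the classical energy\<close>

text \<open>For nonnegative extended reals \<open>infsum\<close> is the supremum of the finite sums,
  so a value below \<infinity> is a genuine bound and not the default of a divergent sum.\<close>

lemma
  fixes f :: "'a \<Rightarrow> ereal"
  assumes fin: "(\<Sum>\<^sub>\<infinity>x\<in>A. \<bar>f x\<bar>) < \<infinity>"
  shows ereal_abs_infsum_finite: "x \<in> A \<Longrightarrow> \<bar>f x\<bar> \<noteq> \<infinity>"
    and ereal_abs_infsum_summable: "(\<lambda>x. \<bar>real_of_ereal (f x)\<bar>) summable_on A"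
proof -
  have SUP: "(\<Sum>\<^sub>\<infinity>x\<in>A. \<bar>f x\<bar>) = (SUP F\<in>{F. finite F \<and> F \<subseteq> A}. \<Sum>x\<in>F. \<bar>f x\<bar>)"
    by (rule nonneg_infsum_complete) simp
  have le: "(\<Sum>x\<in>F. \<bar>f x\<bar>) \<le> (\<Sum>\<^sub>\<infinity>x\<in>A. \<bar>f x\<bar>)" if "finite F" "F \<subseteq> A" for F
    unfolding SUP by (rule SUP_upper) (use that in auto)
  show 1: "\<bar>f x\<bar> \<noteq> \<infinity>" if "x \<in> A" for x
    using le[of "{x}"] that fin by auto
  obtain B where B: "(\<Sum>\<^sub>\<infinity>x\<in>A. \<bar>f x\<bar>) = ereal B"
    using fin le[of "{}"] by (cases "\<Sum>\<^sub>\<infinity>x\<in>A. \<bar>f x\<bar>") auto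
  show "(\<lambda>x. \<bar>real_of_ereal (f x)\<bar>) summable_on A"
  proof (rule nonneg_bdd_above_summable_on)
    show "bdd_above (sum (\<lambda>x. \<bar>real_of_ereal (f x)\<bar>) ` {F. F \<subseteq> A \<and> finite F})"
    proof (rule bdd_aboveI2)
      fix F assume F: "F \<in> {F. F \<subseteq> A \<and> finite F}"
      have "ereal (\<Sum>x\<in>F. \<bar>real_of_ereal (f x)\<bar>) = (\<Sum>x\<in>F. ereal \<bar>real_of_ereal (f x)\<bar>)" by simp
      also have "\<dots> = (\<Sum>x\<in>F. \<bar>f x\<bar>)"
      proof (rule sum.cong)
        fix x assume "x \<in> F"
        then have "\<bar>f x\<bar> \<noteq> \<infinity>" using F by (intro 1) auto
        then show "ereal \<bar>real_of_ereal (f x)\<bar> = \<bar>f x\<bar>" by (cases "f x") auto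
      qed simp
      also have "\<dots> \<le> ereal B" using le[of F] F B by simp
      finally show "(\<Sum>x\<in>F. \<bar>real_of_ereal (f x)\<bar>) \<le> B" by simp
    qed
  qed (rule abs_ge_zero)
qed

lemma integrable_unit_bounded:
  fixes h :: "real \<Rightarrow> real"
  assumes Q: "sets Q = sets halfline" "emeasure Q {0<..<1} < \<infinity>" and h [measurable]: "h \<in> borel_measurable borel"
    and B: "\<And>t. 0 < t \<Longrightarrow> t < 1 \<Longrightarrow> \<bar>h t\<bar> \<le> B"
  shows "integrable Q (\<lambda>t. indicator {0<..<1} t * h t)"
    and "(\<integral>t. \<bar>indicator {0<..<1} t * h t\<bar> \<partial>Q) \<le> B * measure Q {0<..<1}"
proof -
  have S: "{0<..<1} \<in> sets Q"
    unfolding Q(1) halfline_def by (auto simp: sets_restrict_space image_iff intro!: bexI[of _ "{0<..<1}"])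
  have i: "integrable Q (\<lambda>t. B * indicator {0<..<1} t)"
    using S Q(2) by (intro integrable_mult_right integrable_real_indicator) auto
  have "(\<lambda>t. indicator {0<..<1} t * h t) \<in> borel_measurable borel" by measurable
  note m = measurable_halflineI[OF Q(1) this]
  have le: "\<bar>indicator {0<..<1} t * h t\<bar> \<le> B * indicator {0<..<1} t" for t
    using B by (auto simp: indicator_def)
  show int: "integrable Q (\<lambda>t. indicator {0<..<1} t * h t)"
    by (rule Bochner_Integration.integrable_bound[OF i m]) (use le in \<open>auto intro!: AE_I2 order_trans[OF le abs_ge_self]\<close>)
  have "(\<integral>t. \<bar>indicator {0<..<1} t * h t\<bar> \<partial>Q) \<le> (\<integral>t. B * indicator {0<..<1} t \<partial>Q)"
    by (intro integral_mono integrable_abs int i le)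
  also have "\<dots> = B * measure Q {0<..<1}"
    using S sets.Int_space_eq2[OF S] by (simp add: Int_commute)
  finally show "(\<integral>t. \<bar>indicator {0<..<1} t * h t\<bar> \<partial>Q) \<le> B * measure Q {0<..<1}" .
qed

lemma has_sum_real_diff:
  fixes a b :: real
  assumes "(f has_sum a) A" "(g has_sum b) A"
  shows "((\<lambda>x. f x - g x) has_sum (a - b)) A"
  using has_sum_add[OF assms(1) has_sum_cmult_right[OF assms(2), of "- 1"]] by simp

section \<open>Abel regularisation\<close>

context unimodular_lattice
begin

text \<open>A majorant for fixed \<open>e\<close> that includes \<open>w = 0\<close>; its constant
  grows without bound as \<open>e\<close> tends to 0.\<close>

lemma far_integrand_le_of_ge:
  fixes w :: "real^'n"
  assumes "0 < e" "e \<le> s" "s \<le> 2"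
  shows "far_integrand w s \<le> pi powr (real CARD('n) / 2) / e powr (real CARD('n) / 2) * exp (- (pi\<^sup>2 / 2) * (norm w)\<^sup>2)"
proof -
  have "pi powr (real CARD('n) / 2) / s powr (real CARD('n) / 2) \<le> pi powr (real CARD('n) / 2) / e powr (real CARD('n) / 2)"
    using assms by (intro divide_left_mono powr_mono2) auto
  moreover have "pi\<^sup>2 * (norm w)\<^sup>2 / 2 \<le> pi\<^sup>2 * (norm w)\<^sup>2 / s"
    using assms by (intro divide_left_mono) auto
  then have "exp (- pi\<^sup>2 * (norm w)\<^sup>2 / s) \<le> exp (- (pi\<^sup>2 / 2) * (norm w)\<^sup>2)" by simp
  ultimately show ?thesis unfolding far_integrand_def by (intro mult_mono) auto
qed

text \<open>The theta transformation at \<open>t + e\<close>, integrated over \<open>t\<close>.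
  Since \<open>e \<le> t + e \<le> 2\<close>, both sums have majorants independent of
  \<open>t\<close>, and \<open>Q\<close> has finite mass on (0,1), so the exchanges are legitimate.
  It is stated for one nonnegative measure, to be applied to both variations.\<close>

lemma regularised_poisson:
  assumes Q: "sets Q = sets halfline" "emeasure Q {0<..<1} < \<infinity>" and e: "0 < e" "e \<le> 1"
  defines "J \<equiv> \<lambda>h. \<integral>t. indicator {0<..<1} t * h t \<partial>Q"
  shows "\<exists>S. ((\<lambda>v. J (\<lambda>t. exp (- (t + e) * (norm (z + v))\<^sup>2))) has_sum S) (lattice V) \<and>
    ((\<lambda>w. J (\<lambda>t. far_integrand w (t + e)) * cos (2 * pi * (w \<bullet> z))) has_sum S) (dual_lattice V)"
proof -
  let ?f = "\<lambda>v t. indicator {0<..<1} t * exp (- (t + e) * (norm (z + v))\<^sup>2)"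
  let ?g = "\<lambda>w t. indicator {0<..<1} t * (far_integrand w (t + e) * cos (2 * pi * (w \<bullet> z)))"
  let ?b = "\<lambda>w::real^'n. pi powr (real CARD('n) / 2) / e powr (real CARD('n) / 2) * exp (- (pi\<^sup>2 / 2) * (norm w)\<^sup>2)"
  have fm: "(\<lambda>t. exp (- (t + e) * (norm (z + v))\<^sup>2)) \<in> borel_measurable borel" for v by measurable
  have fb: "\<bar>exp (- (t + e) * (norm (z + v))\<^sup>2)\<bar> \<le> exp (- e * (norm (z + v))\<^sup>2)" if "0 < t" "t < 1" for t v
    using mult_nonneg_nonneg[of t "(norm (z + v))\<^sup>2"] that by (simp add: algebra_simps)
  have gm: "(\<lambda>t. far_integrand w (t + e) * cos (2 * pi * (w \<bullet> z))) \<in> borel_measurable borel" for w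
    by measurable
  have gb: "\<bar>far_integrand w (t + e) * cos (2 * pi * (w \<bullet> z))\<bar> \<le> ?b w" if "0 < t" "t < 1" for t w
  proof -
    have "\<bar>far_integrand w (t + e) * cos (2 * pi * (w \<bullet> z))\<bar> \<le> far_integrand w (t + e)"
      by (simp add: abs_mult far_integrand_nonneg mult_left_le)
    also have "\<dots> \<le> ?b w" using that e by (intro far_integrand_le_of_ge) auto
    finally show ?thesis .
  qed
  have bs: "?b summable_on dual_lattice V"
    by (intro summable_on_cmult_right summable_gaussian_dual) simp
  have es: "(\<lambda>v. exp (- e * (norm (z + v))\<^sup>2)) summable_on lattice V" by (rule summable_gaussian_shift[OF e(1)])
  have 1: "((\<lambda>v. \<integral>t. ?f v t \<partial>Q) has_sum (\<integral>t. (\<Sum>\<^sub>\<infinity>v\<in>lattice V. ?f v t) \<partial>Q)) (lattice V)"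
  proof (rule has_sum_integral[OF countable_lattice integrable_unit_bounded(1)[OF Q fm fb]])
    show "(\<lambda>v. \<integral>t. \<bar>?f v t\<bar> \<partial>Q) summable_on lattice V"
      by (rule summable_on_comparison_test[OF summable_on_cmult_left[OF es] integrable_unit_bounded(2)[OF Q fm fb]]) auto
    show "(\<lambda>v. \<bar>?f v t\<bar>) summable_on lattice V" for t
      by (rule summable_on_comparison_test[OF es]) (use fb[of t] in \<open>auto simp: indicator_def\<close>)
  qed
  have 2: "((\<lambda>w. \<integral>t. ?g w t \<partial>Q) has_sum (\<integral>t. (\<Sum>\<^sub>\<infinity>w\<in>dual_lattice V. ?g w t) \<partial>Q)) (dual_lattice V)"
  proof (rule has_sum_integral[OF countable_dual integrable_unit_bounded(1)[OF Q gm gb]])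
    show "(\<lambda>w. \<integral>t. \<bar>?g w t\<bar> \<partial>Q) summable_on dual_lattice V"
      by (rule summable_on_comparison_test[OF summable_on_cmult_left[OF bs] integrable_unit_bounded(2)[OF Q gm gb]]) auto
    show "(\<lambda>w. \<bar>?g w t\<bar>) summable_on dual_lattice V" for t
      by (rule summable_on_comparison_test[OF bs]) (use gb[of t] in \<open>auto simp: indicator_def\<close>)
  qed
  have eq: "(\<Sum>\<^sub>\<infinity>v\<in>lattice V. ?f v t) = (\<Sum>\<^sub>\<infinity>w\<in>dual_lattice V. ?g w t)" for t
  proof (cases "t \<in> {0<..<1}")
    case True
    then have "t + e > 0" using e by simp
    then show ?thesis using theta_transformation[of "t + e" z] True by simp
  qed simp
  have g': "(\<integral>t. ?g w t \<partial>Q) = J (\<lambda>t. far_integrand w (t + e)) * cos (2 * pi * (w \<bullet> z))" for w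
    unfolding J_def mult.assoc[symmetric] by simp
  show ?thesis using 1 2 unfolding eq g' by (auto simp: J_def)
qed

end

text \<open>Finite mass near 0 holds for G-type potentials and makes the exchanges on (0,1) possible
  after regularisation.\<close>

locale short_finite_lattice_measure = lattice_measure V \<mu> for V :: "real^'n^'n" and \<mu> +
  assumes short_finite: "emeasure (pos_part \<mu>) {0<..<1} < \<infinity>"
begin

lemma short_finite_neg: "emeasure (neg_part \<mu>) {0<..<1} < \<infinity>"
  using finite_measure.emeasure_finite[OF finite_neg] by (simp add: less_top[symmetric])

lemmas unit_bounded_pos = integrable_unit_bounded[OF sets_pos_part short_finite]
lemmas unit_bounded_neg = integrable_unit_bounded[OF sets_neg_part short_finite_neg]

definition short_real :: "real^'n \<Rightarrow> real" where
  "short_real q = set_integral_diff \<mu> {0<..<1} (\<lambda>t. exp (- (norm q)\<^sup>2 * t))"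

definition far_reg :: "real \<Rightarrow> real^'n \<Rightarrow> real" where
  "far_reg e w = set_integral_diff \<mu> {0<..<1} (\<lambda>t. far_integrand w (t + e))"

lemma regularised_short_sum:
  assumes e: "0 < e" "e \<le> 1"
  shows "\<exists>S. ((\<lambda>v. exp (- e * (norm (z + v))\<^sup>2) * short_real (z + v)) has_sum S) (lattice V) \<and>
    ((\<lambda>w. far_reg e w * cos (2 * pi * (w \<bullet> z))) has_sum S) (dual_lattice V)"
proof -
  let ?J = "\<lambda>Q h. \<integral>t. indicator {0<..<1} t * h t \<partial>Q"
  obtain SP where P: "((\<lambda>v. ?J (pos_part \<mu>) (\<lambda>t. exp (- (t + e) * (norm (z + v))\<^sup>2))) has_sum SP) (lattice V)"
      "((\<lambda>w. ?J (pos_part \<mu>) (\<lambda>t. far_integrand w (t + e)) * cos (2 * pi * (w \<bullet> z))) has_sum SP) (dual_lattice V)"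
    using regularised_poisson[OF sets_pos_part short_finite e] by blast
  obtain SN where N: "((\<lambda>v. ?J (neg_part \<mu>) (\<lambda>t. exp (- (t + e) * (norm (z + v))\<^sup>2))) has_sum SN) (lattice V)"
      "((\<lambda>w. ?J (neg_part \<mu>) (\<lambda>t. far_integrand w (t + e)) * cos (2 * pi * (w \<bullet> z))) has_sum SN) (dual_lattice V)"
    using regularised_poisson[OF sets_neg_part short_finite_neg e] by blast
  have "?J (pos_part \<mu>) (\<lambda>t. exp (- (t + e) * (norm q)\<^sup>2)) - ?J (neg_part \<mu>) (\<lambda>t. exp (- (t + e) * (norm q)\<^sup>2))
      = exp (- e * (norm q)\<^sup>2) * short_real q" for q :: "real^'n"
  proof -
    have "indicator {0<..<1} t * exp (- (t + e) * (norm q)\<^sup>2) =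
        exp (- e * (norm q)\<^sup>2) * (indicator {0<..<1} t * exp (- (norm q)\<^sup>2 * t))" for t
      by (simp add: exp_add[symmetric] algebra_simps)
    then show ?thesis by (simp only: short_real_def set_integral_diff_def integral_mult_right_zero right_diff_distrib)
  qed
  then have "((\<lambda>v. exp (- e * (norm (z + v))\<^sup>2) * short_real (z + v)) has_sum (SP - SN)) (lattice V)"
    using has_sum_real_diff[OF P(1) N(1)] by simp
  moreover have "((\<lambda>w. far_reg e w * cos (2 * pi * (w \<bullet> z))) has_sum (SP - SN)) (dual_lattice V)"
    using has_sum_real_diff[OF P(2) N(2)] by (simp add: far_reg_def set_integral_diff_def left_diff_distrib)
  ultimately show ?thesis by blast
qed

text \<open>A sequence, as dominated convergence of integrals is sequential; values at most 1 keep
  \<open>t + eps k\<close> within the range of \<open>far_integrand_uniform\<close>.\<close>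

definition eps :: "nat \<Rightarrow> real" where "eps k = 1 / real (Suc k)"

lemma eps: "0 < eps k" "eps k \<le> 1" "eps \<longlonglongrightarrow> 0"
proof -
  show "0 < eps k" "eps k \<le> 1" by (simp_all add: eps_def)
  show "eps \<longlonglongrightarrow> 0"
    using LIMSEQ_inverse_real_of_nat unfolding eps_def[abs_def] inverse_eq_divide .
qed

text \<open>Uniform in \<open>k\<close>, hence the majorant for passing to the limit in the dual
  sum. At \<open>w = 0\<close> no such bound is available.\<close>

lemma far_reg_bound:
  "\<exists>C. \<forall>k. \<forall>w\<in>dual_lattice V - {0}. \<bar>far_reg (eps k) w\<bar> \<le> C * exp (- (pi\<^sup>2 / 4) * (norm w)\<^sup>2)"
proof -
  obtain C where C: "\<And>w t. w \<in> dual_lattice V - {0} \<Longrightarrow> 0 < t \<Longrightarrow> t \<le> 2 \<Longrightarrow> far_integrand w t \<le> C * exp (- (pi\<^sup>2 / 4) * (norm w)\<^sup>2)"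
    using far_integrand_uniform by blast
  show ?thesis
  proof (intro exI allI ballI)
    fix k w assume w: "w \<in> dual_lattice V - {0}"
    let ?h = "\<lambda>t. far_integrand w (t + eps k)"
    let ?B = "C * exp (- (pi\<^sup>2 / 4) * (norm w)\<^sup>2)"
    have b: "\<bar>?h t\<bar> \<le> ?B" if "0 < t" "t < 1" for t
      using C[OF w, of "t + eps k"] eps(1,2)[of k] that far_integrand_nonneg[of w "t + eps k"] by simp
    have m: "?h \<in> borel_measurable borel" by measurable
    have "\<bar>far_reg (eps k) w\<bar> \<le> \<bar>\<integral>t. indicator {0<..<1} t * ?h t \<partial>pos_part \<mu>\<bar> + \<bar>\<integral>t. indicator {0<..<1} t * ?h t \<partial>neg_part \<mu>\<bar>"
      unfolding far_reg_def set_integral_diff_def by (rule abs_triangle_ineq4)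
    also have "\<dots> \<le> ?B * measure (pos_part \<mu>) {0<..<1} + ?B * measure (neg_part \<mu>) {0<..<1}"
      by (intro add_mono order_trans[OF integral_abs_bound] unit_bounded_pos(2)[OF m b] unit_bounded_neg(2)[OF m b])
    also have "\<dots> = (C * (measure (pos_part \<mu>) {0<..<1} + measure (neg_part \<mu>) {0<..<1})) * exp (- (pi\<^sup>2 / 4) * (norm w)\<^sup>2)"
      by (simp add: algebra_simps)
    finally show "\<bar>far_reg (eps k) w\<bar> \<le> (C * (measure (pos_part \<mu>) {0<..<1} + measure (neg_part \<mu>) {0<..<1})) * exp (- (pi\<^sup>2 / 4) * (norm w)\<^sup>2)" .
  qed
qed

lemma far_reg_tendsto:
  assumes w: "w \<in> dual_lattice V - {0}"
  shows "(\<lambda>k. far_reg (eps k) w) \<longlonglongrightarrow> far_real w"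
proof -
  obtain C where C: "C \<ge> 0" "\<And>t. 0 < t \<Longrightarrow> t \<le> 2 \<Longrightarrow> far_integrand w t \<le> C * exp (- (pi\<^sup>2 / 4) * (norm w)\<^sup>2)"
    using far_integrand_uniform w by blast
  let ?B = "C * exp (- (pi\<^sup>2 / 4) * (norm w)\<^sup>2)"
  have lim: "(\<lambda>k. \<integral>t. indicator {0<..<1} t * far_integrand w (t + eps k) \<partial>Q) \<longlonglongrightarrow> (\<integral>t. indicator {0<..<1} t * far_integrand w t \<partial>Q)"
    if Q: "sets Q = sets halfline" "emeasure Q {0<..<1} < \<infinity>" for Q
  proof (rule integral_dominated_convergence[where w = "\<lambda>t. indicator {0<..<1} t * ?B"])
    have "(\<lambda>t. indicator {0<..<1} t * far_integrand w t) \<in> borel_measurable borel" by measurable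
    then show "(\<lambda>t. indicator {0<..<1} t * far_integrand w t) \<in> borel_measurable Q" by (rule measurable_halflineI[OF Q(1)])
    have "(\<lambda>t. indicator {0<..<1} t * far_integrand w (t + eps k)) \<in> borel_measurable borel" for k by measurable
    then show "(\<lambda>t. indicator {0<..<1} t * far_integrand w (t + eps k)) \<in> borel_measurable Q" for k by (rule measurable_halflineI[OF Q(1)])
    show "integrable Q (\<lambda>t. indicator {0<..<1} t * ?B)"
      by (rule integrable_unit_bounded(1)[OF Q]) auto
    show "AE t in Q. (\<lambda>k. indicator {0<..<1} t * far_integrand w (t + eps k)) \<longlonglongrightarrow> indicator {0<..<1} t * far_integrand w t"
    proof (rule AE_I2)
      fix t
      have "(\<lambda>k. far_integrand w (t + eps k)) \<longlonglongrightarrow> far_integrand w (t + 0)" if "t > 0"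
        unfolding far_integrand_def using that by (intro tendsto_intros eps(3)) auto
      then show "(\<lambda>k. indicator {0<..<1} t * far_integrand w (t + eps k)) \<longlonglongrightarrow> indicator {0<..<1} t * far_integrand w t"
        by (cases "t \<in> {0<..<1}") auto
    qed
    show "AE t in Q. norm (indicator {0<..<1} t * far_integrand w (t + eps k)) \<le> indicator {0<..<1} t * ?B" for k
    proof (rule AE_I2)
      fix t
      show "norm (indicator {0<..<1} t * far_integrand w (t + eps k)) \<le> indicator {0<..<1} t * ?B"
        using C(2)[of "t + eps k"] eps(1,2)[of k] far_integrand_nonneg[of w "t + eps k"] by (auto simp: indicator_def)
    qed
  qed
  show ?thesis
    unfolding far_reg_def far_real_def set_integral_diff_def
    by (intro tendsto_diff lim sets_pos_part sets_neg_part short_finite short_finite_neg)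
qed

text \<open>
  This limit exists as soon as \<open>\<Sum>v. f (z + v)\<close> converges absolutely for a single \<open>z\<close>; otherwise
  its value is irrelevant.
\<close>
definition zero_mode :: real where
  "zero_mode = lim (\<lambda>k. far_reg (eps k) 0)"

text \<open>Nothing makes \<open>t powr (- d / 2)\<close> integrable near 0, so the limit in
  \<open>zero_mode\<close> cannot be computed directly. The regularised identity is solved for the
  term at 0 instead: the lattice sum converges by absolute summability, the remaining dual sum by
  \<open>far_reg_bound\<close>, so the term at 0 converges as well.\<close>

lemma short_sum_eq:
  assumes sum: "(\<lambda>v. \<bar>short_real (z + v)\<bar>) summable_on lattice V"
  shows "(\<Sum>\<^sub>\<infinity>v\<in>lattice V. short_real (z + v)) = far_sum z + zero_mode"
proof -
  let ?L = "\<lambda>k. \<Sum>\<^sub>\<infinity>v\<in>lattice V. exp (- eps k * (norm (z + v))\<^sup>2) * short_real (z + v)"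
  let ?R = "\<lambda>k. \<Sum>\<^sub>\<infinity>w\<in>dual_lattice V - {0}. far_reg (eps k) w * cos (2 * pi * (w \<bullet> z))"
  obtain C where C: "\<And>k w. w \<in> dual_lattice V - {0} \<Longrightarrow> \<bar>far_reg (eps k) w\<bar> \<le> C * exp (- (pi\<^sup>2 / 4) * (norm w)\<^sup>2)"
    using far_reg_bound by blast
  have L: "?L \<longlonglongrightarrow> (\<Sum>\<^sub>\<infinity>v\<in>lattice V. short_real (z + v))"
  \<comment> \<open>The Abel factor is at most 1, so the absolutely summable family is its own
    majorant.\<close>
  proof (rule tendsto_infsum_dominated[where S = UNIV, OF _ _ _ sum])
    fix v
    have "(\<lambda>k. exp (- eps k * (norm (z + v))\<^sup>2) * short_real (z + v)) \<longlonglongrightarrow> exp (- 0 * (norm (z + v))\<^sup>2) * short_real (z + v)"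
      by (intro tendsto_intros eps(3))
    then show "(\<lambda>k. exp (- eps k * (norm (z + v))\<^sup>2) * short_real (z + v)) \<longlonglongrightarrow> short_real (z + v)" by simp
    show "\<bar>exp (- eps k * (norm (z + v))\<^sup>2) * short_real (z + v)\<bar> \<le> \<bar>short_real (z + v)\<bar>" for k
      unfolding abs_mult using eps(1)[of k] by (intro mult_left_le_one_le) auto
  qed auto
  have R: "?R \<longlonglongrightarrow> far_sum z"
    unfolding far_sum_def
  proof (rule tendsto_infsum_dominated[where S = UNIV and M = "\<lambda>w. C * exp (- (pi\<^sup>2 / 4) * (norm w)\<^sup>2)"])
    fix w assume w: "w \<in> dual_lattice V - {0}"
    show "(\<lambda>k. far_reg (eps k) w * cos (2 * pi * (w \<bullet> z))) \<longlonglongrightarrow> far_real w * cos (2 * pi * (w \<bullet> z))"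
      by (intro tendsto_intros far_reg_tendsto[OF w])
    show "\<bar>far_reg (eps k) w * cos (2 * pi * (w \<bullet> z))\<bar> \<le> C * exp (- (pi\<^sup>2 / 4) * (norm w)\<^sup>2)" for k
      unfolding abs_mult using C[OF w, of k] by (intro order_trans[OF mult_left_le]) auto
  next
    show "(\<lambda>w. C * exp (- (pi\<^sup>2 / 4) * (norm w)\<^sup>2)) summable_on (dual_lattice V - {0})"
      by (rule summable_gaussian_dual_nonzero) simp
  qed auto
  have eq: "?L k = far_reg (eps k) 0 + ?R k" for k
  proof -
    obtain S where S: "((\<lambda>v. exp (- eps k * (norm (z + v))\<^sup>2) * short_real (z + v)) has_sum S) (lattice V)"
      "((\<lambda>w. far_reg (eps k) w * cos (2 * pi * (w \<bullet> z))) has_sum S) (dual_lattice V)"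
      using regularised_short_sum[OF eps(1,2)] by blast
    let ?t = "\<lambda>w. far_reg (eps k) w * cos (2 * pi * (w \<bullet> z))"
    have "?t summable_on (dual_lattice V - {0})"
      by (rule summable_on_subset_banach[OF has_sum_imp_summable[OF S(2)]]) auto
    then have "(?t has_sum ?R k) (dual_lattice V - {0})" by (rule has_sum_infsum)
    then have "(?t has_sum (?t 0 + ?R k)) (insert 0 (dual_lattice V - {0}))"
      by (intro has_sum_insert) auto
    moreover have "insert 0 (dual_lattice V - {0}) = dual_lattice V" using dual_lattice_zero by auto
    ultimately have "S = far_reg (eps k) 0 + ?R k" using has_sum_unique[OF S(2)] by simp
    then show ?thesis using infsumI[OF S(1)] by simp
  qed
  have "(\<lambda>k. ?L k - ?R k) \<longlonglongrightarrow> (\<Sum>\<^sub>\<infinity>v\<in>lattice V. short_real (z + v)) - far_sum z"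
    by (intro tendsto_diff L R)
  then have "zero_mode = (\<Sum>\<^sub>\<infinity>v\<in>lattice V. short_real (z + v)) - far_sum z"
    unfolding eq zero_mode_def by (intro limI) simp
  then show ?thesis by simp
qed

text \<open>The integral formula is assumed wherever \<open>f\<close> is finite, so that lattice
  points are covered when \<open>f 0\<close> is finite.\<close>

lemma classical_sum_eq:
  assumes f: "\<And>q :: real^'n. \<bar>f q\<bar> \<noteq> \<infinity> \<Longrightarrow> f q = signed_integral \<mu> {0<..} (\<lambda>t. exp (- (norm q)\<^sup>2 * t))"
    and fin: "(\<Sum>\<^sub>\<infinity>v\<in>lattice V. \<bar>f (z + v)\<bar>) < \<infinity>"
  shows "(\<Sum>\<^sub>\<infinity>v\<in>lattice V. f (z + v)) = near_sum z + ereal (far_sum z) + ereal zero_mode"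
proof -
  have split: "near_term \<mu> q = ereal (near_real q) \<and> f q = ereal (near_real q + short_real q)" if q: "\<bar>f q\<bar> \<noteq> \<infinity>" for q
  proof -
    let ?h = "\<lambda>t. exp (- (norm q)\<^sup>2 * t)"
    have "signed_integral \<mu> {0<..} ?h < \<infinity>" using f[OF q] q by auto
    then have "(\<integral>\<^sup>+t\<in>{0<..}. ennreal (?h t) \<partial>pos_part \<mu>) < \<infinity>" by (rule signed_integral_less_top_imp)
    then have P: "integrable (pos_part \<mu>) (\<lambda>t. indicator {0<..} t * ?h t)"
      by (intro integrable_of_nn_integral[OF sets_pos_part]) auto
    have N: "integrable (neg_part \<mu>) (\<lambda>t. indicator {0<..} t * ?h t)"
      by (rule neg_bounded_integrable[where B = 1]) auto
    have N1: "integrable (neg_part \<mu>) (\<lambda>t. indicator {1..} t * ?h t)" by (rule neg_exp_integrable) simp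
    have m: "?h \<in> borel_measurable borel" by measurable
    have b: "\<bar>?h t\<bar> \<le> 1" if "0 < t" "t < 1" for t using that by simp
    have eq: "indicator {1..} t * ?h t = indicator {0<..} t * ?h t - indicator {0<..<1} t * ?h t" for t :: real
      by (auto simp: indicator_def)
    have P1: "integrable (pos_part \<mu>) (\<lambda>t. indicator {1..} t * ?h t)"
      unfolding eq by (intro Bochner_Integration.integrable_diff P unit_bounded_pos(1)[OF m b])
    have "f q = ereal (set_integral_diff \<mu> {0<..} ?h)"
      unfolding f[OF q] by (intro signed_integral_eq P N) simp
    moreover have "near_real q = set_integral_diff \<mu> {0<..} ?h - short_real q"
      unfolding near_real_def short_real_def set_integral_diff_def eq
      using Bochner_Integration.integral_diff[OF P unit_bounded_pos(1)[OF m b]]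
        Bochner_Integration.integral_diff[OF N unit_bounded_neg(1)[OF m b]] by simp
    moreover have "near_term \<mu> q = ereal (near_real q)"
      unfolding near_term_def near_real_def by (intro signed_integral_eq P1 N1) simp
    ultimately show ?thesis by simp
  qed
  note s = split[OF ereal_abs_infsum_finite[OF fin]]
  have near: "(\<lambda>v. \<bar>near_real (z + v)\<bar>) summable_on lattice V"
  proof -
    have "(\<lambda>v. \<bar>near_real (z + v)\<bar>) summable_on ((lattice V - near_set (norm z)) \<union> near_set (norm z))"
      by (rule summable_on_union[OF near_real_abs_summable[OF order_refl] summable_on_finite[OF finite_near_set]])
    moreover have "lattice V - near_set (norm z) \<union> near_set (norm z) = lattice V" by (auto simp: near_set_def)
    ultimately show ?thesis by simp
  qed
  have "(\<lambda>v. \<bar>near_real (z + v) + short_real (z + v)\<bar>) summable_on lattice V"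
    by (rule summable_on_cong[THEN iffD1, OF _ ereal_abs_infsum_summable[OF fin]]) (simp add: s)
  \<comment> \<open>The near part is always absolutely summable here, so the part over (0,1)
    inherits absolute summability from \<open>f\<close> by the triangle inequality.\<close>
  from summable_on_add[OF this near] have short: "(\<lambda>v. \<bar>short_real (z + v)\<bar>) summable_on lattice V"
    by (rule summable_on_comparison_test) auto
  have n: "((\<lambda>v. near_real (z + v)) has_sum (\<Sum>\<^sub>\<infinity>v\<in>lattice V. near_real (z + v))) (lattice V)"
    using near by (intro has_sum_infsum) (simp add: abs_summable_summable)
  have sh: "((\<lambda>v. short_real (z + v)) has_sum (\<Sum>\<^sub>\<infinity>v\<in>lattice V. short_real (z + v))) (lattice V)"
    using short by (intro has_sum_infsum) (simp add: abs_summable_summable)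
  have "((\<lambda>v. near_term \<mu> (z + v)) has_sum (\<Sum>v\<in>{}. near_term \<mu> (z + v)) + ereal (\<Sum>\<^sub>\<infinity>v\<in>lattice V. near_real (z + v))) (lattice V)"
    by (rule has_sum_ereal_finite_exception) (use s n in auto)
  then have 1: "near_sum z = ereal (\<Sum>\<^sub>\<infinity>v\<in>lattice V. near_real (z + v))"
    unfolding near_sum_def by (simp add: infsumI)
  have "((\<lambda>v. f (z + v)) has_sum (\<Sum>v\<in>{}. f (z + v)) + ereal ((\<Sum>\<^sub>\<infinity>v\<in>lattice V. near_real (z + v)) + (\<Sum>\<^sub>\<infinity>v\<in>lattice V. short_real (z + v)))) (lattice V)"
    by (rule has_sum_ereal_finite_exception) (use s has_sum_add[OF n sh] in auto)
  then have "(\<Sum>\<^sub>\<infinity>v\<in>lattice V. f (z + v)) = ereal ((\<Sum>\<^sub>\<infinity>v\<in>lattice V. near_real (z + v)) + (\<Sum>\<^sub>\<infinity>v\<in>lattice V. short_real (z + v)))"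
    by (simp add: infsumI)
  then show ?thesis by (simp add: 1 short_sum_eq[OF short] add.assoc)
qed

lemma classical_energy_eq:
  assumes f: "\<And>q :: real^'n. \<bar>f q\<bar> \<noteq> \<infinity> \<Longrightarrow> f q = signed_integral \<mu> {0<..} (\<lambda>t. exp (- (norm q)\<^sup>2 * t))"
    and conv: "classical_energy_abs_convergent V f N x"
  shows "classical_periodic_energy V f N x = periodic_energy V \<mu> N x + ereal (zero_mode * (real N * (real N - 1)))"
proof -
  let ?S = "\<lambda>i j. \<Sum>\<^sub>\<infinity>v\<in>lattice V. \<bar>f (x i - x j + v)\<bar>"
  have S0: "0 \<le> ?S i j" for i j by (rule infsum_nonneg) simp
  have fin: "?S i j < \<infinity>" if i: "i \<in> {1..N}" and j: "j \<in> {1..N} - {i}" for i j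
  proof -
    have "?S i j \<le> (\<Sum>j\<in>{1..N} - {i}. ?S i j)"
      using sum_mono2[of "{1..N} - {i}" "{j}" "?S i"] j S0 by simp
    also have "\<dots> \<le> (\<Sum>i\<in>{1..N}. \<Sum>j\<in>{1..N} - {i}. ?S i j)"
      using sum_mono2[of "{1..N}" "{i}" "\<lambda>i. \<Sum>j\<in>{1..N} - {i}. ?S i j"] i by (simp add: sum_nonneg S0)
    also have "\<dots> < \<infinity>" using conv unfolding classical_energy_abs_convergent_def .
    finally show ?thesis .
  qed
  have "classical_periodic_energy V f N x = (\<Sum>i\<in>{1..N}. \<Sum>j\<in>{1..N} - {i}. periodic_kernel V \<mu> (x i) (x j) + ereal zero_mode)"
    unfolding classical_periodic_energy_def
    by (intro sum.cong refl) (simp add: classical_sum_eq[OF f fin] periodic_kernel_eq)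
  also have "\<dots> = periodic_energy V \<mu> N x + (\<Sum>i\<in>{1..N}. \<Sum>j\<in>{1..N} - {i}. ereal zero_mode)"
    by (simp add: periodic_energy_def sum.distrib)
  \<comment> \<open>For \<open>N = 0\<close> the factor \<open>real N - 1\<close> is negative, but
    both sides are 0.\<close>
  also have "(\<Sum>i\<in>{1..N}. \<Sum>j\<in>{1..N} - {i}. ereal zero_mode) = ereal (zero_mode * (real N * (real N - 1)))"
  proof -
    have "(\<Sum>i\<in>{1..N}. \<Sum>j\<in>{1..N} - {i}. zero_mode) = (\<Sum>i\<in>{1..N}. (real N - 1) * zero_mode)"
      by (rule sum.cong) (auto simp: card_Diff_singleton of_nat_diff)
    then show ?thesis by (simp add: algebra_simps)
  qed
  finally show ?thesis .
qed

end

section \<open>From potentials to the locale assumptions, and the theorem\<close>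

lemma lattice_measure_of_weak_G_type:
  fixes V :: "real^'n^'n"
  assumes "det V = 1" "weak_G_type_potential V f \<mu>"
  shows "lattice_measure V \<mu>"
proof -
  note W = assms(2)[unfolded weak_G_type_potential_def]
  have W1: "finite_measure (neg_part \<mu>)" using W by (elim conjE)
  have W2: "signed_integral \<mu> {1..} (\<lambda>t. exp (- (norm q)\<^sup>2 * t)) < \<infinity>" if "q \<noteq> 0" for q :: "real^'n"
    using W[THEN conjunct2, THEN conjunct2, THEN conjunct2, THEN conjunct2, THEN conjunct1] that
    by (elim exE, drule_tac x = q in spec) simp
  have F: "signed_integral \<mu> {0<..<1} (\<lambda>t. t powr (- real CARD('n) / 2) * exp (- pi\<^sup>2 * (norm w0)\<^sup>2 / t)) < \<infinity>"
    if "w0 \<in> dual_lattice V - {0}" "\<And>w. w \<in> dual_lattice V - {0} \<Longrightarrow> norm w0 \<le> norm w" for w0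
    using W[THEN conjunct2, THEN conjunct2, THEN conjunct2, THEN conjunct2, THEN conjunct2, THEN bspec, OF that(1)]
    by (rule mp) (intro ballI that(2))
  show ?thesis
  proof (intro lattice_measure.intro unimodular_lattice.intro lattice_measure_axioms.intro)
    show "det V = 1" by fact
    show "finite_measure (neg_part \<mu>)" by fact
    show "(\<integral>\<^sup>+t\<in>{1..}. ennreal (exp (- (norm q)\<^sup>2 * t)) \<partial>pos_part \<mu>) < \<infinity>" if "q \<noteq> 0" for q :: "real^'n"
      by (rule signed_integral_less_top_imp[OF W2[OF that]])
    show "(\<integral>\<^sup>+t\<in>{0<..<1}. ennreal (t powr (- real CARD('n) / 2) * exp (- pi\<^sup>2 * (norm w0)\<^sup>2 / t)) \<partial>pos_part \<mu>) < \<infinity>"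
      if "w0 \<in> dual_lattice V - {0}" "\<And>w. w \<in> dual_lattice V - {0} \<Longrightarrow> norm w0 \<le> norm w" for w0
      using F[OF that] by (rule signed_integral_less_top_imp)
  qed
qed

lemma G_type_eq_integral:
  fixes f :: "real^'n \<Rightarrow> ereal"
  assumes G: "G_type_potential f \<mu>" and q: "\<bar>f q\<bar> \<noteq> \<infinity>"
  shows "f q = signed_integral \<mu> {0<..} (\<lambda>t. exp (- (norm q)\<^sup>2 * t))"
proof (cases "q = 0")
  case True
  \<comment> \<open>Absolute convergence allows \<open>x\<^sub>i - x\<^sub>j \<in> lattice V\<close> when \<open>f 0\<close> is finite.\<close>
  have f0: "f 0 = \<mu> {0<..}" and \<mu>: "signed_measure \<mu>" "finite_measure (neg_part \<mu>)"
    using G by (auto simp: G_type_potential_def)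
  have S: "{0<..} \<in> sets halfline" using sets.top[of halfline] by simp
  have "(\<integral>\<^sup>+t\<in>{0<..}. ennreal 1 \<partial>Q) = emeasure Q {0<..}" if "sets Q = sets halfline" for Q
    using S that by simp
  then have "signed_integral \<mu> {0<..} (\<lambda>t. exp (- (norm q)\<^sup>2 * t)) =
      enn2ereal (emeasure (pos_part \<mu>) {0<..}) - enn2ereal (emeasure (neg_part \<mu>) {0<..})"
    by (simp add: signed_integral_def True S)
  also have "\<dots> = \<mu> {0<..}"
    using jordan_decomposition[OF \<mu> S] q f0 True by simp
  finally show ?thesis using f0 True by simp
next
  case False
  then show ?thesis using G by (auto simp: G_type_potential_def)
qed

text \<open>The integral representing \<open>f\<close> at a unit vector is finite, and its weight
  \<open>exp (- t)\<close> is at least \<open>exp (- 1)\<close> on (0,1).\<close>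

lemma G_type_short_finite:
  fixes f :: "real^'n \<Rightarrow> ereal"
  assumes G: "G_type_potential f \<mu>"
  shows "emeasure (pos_part \<mu>) {0<..<1} < \<infinity>"
proof -
  obtain i :: 'n where True by simp
  define q :: "real^'n" where "q = axis i 1"
  have nq: "norm q = 1" by (simp add: q_def norm_axis_1)
  then have "q \<noteq> 0" by auto
  then have "signed_integral \<mu> {0<..} (\<lambda>t. exp (- (norm q)\<^sup>2 * t)) < \<infinity>"
    using G by (auto simp: G_type_potential_def)
  then have fin: "(\<integral>\<^sup>+t\<in>{0<..}. ennreal (exp (- t)) \<partial>pos_part \<mu>) < \<infinity>"
    using signed_integral_less_top_imp nq by fastforce
  have S: "{0<..<1} \<in> sets (pos_part \<mu>)"
    unfolding sets_pos_part halfline_def by (auto simp: sets_restrict_space image_iff intro!: bexI[of _ "{0<..<1}"])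
  have "ennreal (exp (- 1)) * emeasure (pos_part \<mu>) {0<..<1} = (\<integral>\<^sup>+t. ennreal (exp (- 1)) * indicator {0<..<1} t \<partial>pos_part \<mu>)"
    by (rule nn_integral_cmult_indicator[OF S, symmetric])
  also have "\<dots> \<le> (\<integral>\<^sup>+t\<in>{0<..}. ennreal (exp (- t)) \<partial>pos_part \<mu>)"
    by (rule nn_integral_mono) (auto simp: indicator_def intro!: ennreal_leI)
  finally have "ennreal (exp (- 1)) * emeasure (pos_part \<mu>) {0<..<1} < \<infinity>" using fin by simp
  then show ?thesis by (auto simp: ennreal_mult_less_top)
qed

theorem theorem1p1:
  fixes V :: "real^'n^'n" and f :: "real^'n \<Rightarrow> ereal" and \<mu> :: "real set \<Rightarrow> ereal"
  assumes "det V = 1"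
    and "weak_G_type_potential V f \<mu>"
  shows
    "((\<forall>x y. periodic_kernel_well_defined V \<mu> x y) \<and>
      continuous_on UNIV (\<lambda>(x, y). periodic_kernel V \<mu> x y) \<and>
      (\<forall>x y. x - y \<notin> lattice V \<longrightarrow> \<bar>periodic_kernel V \<mu> x y\<bar> \<noteq> \<infinity>))
   \<and> ((\<forall>x y. periodic_kernel V \<mu> x y = periodic_kernel V \<mu> y x) \<and>
      (\<forall>x y. \<forall>v\<in>lattice V. periodic_kernel V \<mu> (x + v) y = periodic_kernel V \<mu> x y \<and>
                           periodic_kernel V \<mu> x (y + v) = periodic_kernel V \<mu> x y) \<and>
      (\<forall>x y x' y'. x - y = x' - y' \<longrightarrow> periodic_kernel V \<mu> x y = periodic_kernel V \<mu> x' y'))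
   \<and> (G_type_potential f \<mu> \<longrightarrow>
      (\<exists>C::real. \<forall>N x. classical_energy_abs_convergent V f N x \<longrightarrow>
         classical_periodic_energy V f N x
           = periodic_energy V \<mu> N x + ereal (C * (real N * (real N - 1)))))"
proof -
  interpret lattice_measure V \<mu> by (rule lattice_measure_of_weak_G_type[OF assms])
  have c: "\<exists>C::real. \<forall>N x. classical_energy_abs_convergent V f N x \<longrightarrow>
         classical_periodic_energy V f N x
           = periodic_energy V \<mu> N x + ereal (C * (real N * (real N - 1)))"
    if G: "G_type_potential f \<mu>"
  proof -
    interpret short_finite_lattice_measure V \<mu>
      by unfold_locales (rule G_type_short_finite[OF G])
    show ?thesis
      \<comment> \<open>The witness is \<open>zero_mode\<close>, which depends only on
        \<open>V\<close> and \<mu>, hence neither on \<open>N\<close> nor on the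
        configuration.\<close>
      using classical_energy_eq[OF G_type_eq_integral[OF G]] by blast
  qed
  have a: "(\<forall>x y. periodic_kernel_well_defined V \<mu> x y) \<and>
      continuous_on UNIV (\<lambda>(x, y). periodic_kernel V \<mu> x y) \<and>
      (\<forall>x y. x - y \<notin> lattice V \<longrightarrow> \<bar>periodic_kernel V \<mu> x y\<bar> \<noteq> \<infinity>)"
    using periodic_kernel_well_definedI continuous_periodic_kernel periodic_kernel_finite by blast
  have b1: "\<forall>x y. periodic_kernel V \<mu> x y = periodic_kernel V \<mu> y x"
    by (intro allI periodic_kernel_sym)
  have b2: "\<forall>x y. \<forall>v\<in>lattice V. periodic_kernel V \<mu> (x + v) y = periodic_kernel V \<mu> x y \<and>
      periodic_kernel V \<mu> x (y + v) = periodic_kernel V \<mu> x y"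
    by (intro allI ballI conjI periodic_kernel_periodic)
  have b3: "\<forall>x y x' y'. x - y = x' - y' \<longrightarrow> periodic_kernel V \<mu> x y = periodic_kernel V \<mu> x' y'"
    by (intro allI impI) (simp only: periodic_kernel_eq)
  show ?thesis
    by (rule conjI[OF a conjI[OF conjI[OF b1 conjI[OF b2 b3]] impI[OF c]]])
qed

end
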